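(* Let $n\ge 2$. The multiplicity of $X_{2,n}$ at $P_\sigma$ (the origin) is equal to the Catalan number $$Cat_{n-2}=\frac{1}{n-1}\binom{2n-4}{n-2}.$$
   Context: $K$ is an algebraically closed field of arbitrary characteristic. $I_{2,n}=\{(i_1,i_2)\in\mathbb{Z}^2: 1\le i_1<i_2\le n\}$ with the componentwise order, a finite distributive lattice (join and meet are componentwise max and min). $X_{2,n}=X(I_{2,n})\subset\mathbb{A}^{\#I_{2,n}}$ is the affine toric variety whose vanishing ideal in $K[X_\alpha,\alpha\in I_{2,n}]$ is generated by the binomials $X_\alpha X_\beta-X_{\alpha\vee\beta}X_{\alpha\wedge\beta}$. Writing $X_{2,n}=X_\sigma$ for its associated (full-dimensional, strongly convex) cone $\sigma$, the distinguished point $P_\sigma$ of the face $\sigma$ is the origin of $\mathbb{A}^{\#I_{2,n}}$, the unique torus-fixed point. The multiplicity $\mathrm{mult}_PX$ of a variety $X$ at a closed point $P$ is the degree of the graded ring $\mathrm{gr}(\mathcal{O}_{X,P},\mathfrak{m}_P)$ (for a graded ring of dimension $r+1$, its degree $e$ is defined by the leading coefficient $e/r!$ of the Hilbert polynomial). *)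

theory Defs
  imports
    "HOL-Algebra.QuotRing"
    "HOL-Algebra.Ideal_Product"
    "HOL-Algebra.Embedded_Algebras"
    "HOL-Computational_Algebra.Polynomial"
    "HOL-Library.Poly_Mapping"
    "HOL-Library.Product_Order"
    "HOL-Library.Extended_Nat"
begin

section \<open>Krull dimension, localization, associated graded ring\<close>

definition krull_dim :: "('a, 'b) ring_scheme \<Rightarrow> enat" where
  "krull_dim R = Sup {enat l | l. \<exists>P :: nat \<Rightarrow> 'a set.
     (\<forall>i\<le>l. primeideal (P i) R) \<and> (\<forall>i<l. P i \<subset> P (Suc i))}"

text \<open>
  Fractions are equivalence classes of pairs \<open>(a, s)\<close>; the factor \<open>u\<close> is needed since
  \<open>S\<close> may contain zero divisors.
\<close>

definition fraction_rel ::
    "('a, 'b) ring_scheme \<Rightarrow> 'a set \<Rightarrow> (('a \<times> 'a) \<times> ('a \<times> 'a)) set" where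
  "fraction_rel R S = {((a, s), (b, t)). a \<in> carrier R \<and> s \<in> S \<and> b \<in> carrier R \<and> t \<in> S \<and>
     (\<exists>u\<in>S. u \<otimes>\<^bsub>R\<^esub> ((a \<otimes>\<^bsub>R\<^esub> t) \<ominus>\<^bsub>R\<^esub> (b \<otimes>\<^bsub>R\<^esub> s)) = \<zero>\<^bsub>R\<^esub>)}"

definition fraction :: "('a, 'b) ring_scheme \<Rightarrow> 'a set \<Rightarrow> 'a \<Rightarrow> 'a \<Rightarrow> ('a \<times> 'a) set" where
  "fraction R S a s = fraction_rel R S `` {(a, s)}"

definition localization ::
    "('a, 'b) ring_scheme \<Rightarrow> 'a set \<Rightarrow> (('a \<times> 'a) set) ring" where
  "localization R S = \<lparr>
     carrier = (carrier R \<times> S) // fraction_rel R S,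
     monoid.mult = (\<lambda>x y. \<Union>(a, s)\<in>x. \<Union>(b, t)\<in>y. fraction R S (a \<otimes>\<^bsub>R\<^esub> b) (s \<otimes>\<^bsub>R\<^esub> t)),
     one = fraction R S \<one>\<^bsub>R\<^esub> \<one>\<^bsub>R\<^esub>,
     zero = fraction R S \<zero>\<^bsub>R\<^esub> \<one>\<^bsub>R\<^esub>,
     add = (\<lambda>x y. \<Union>(a, s)\<in>x. \<Union>(b, t)\<in>y.
              fraction R S ((a \<otimes>\<^bsub>R\<^esub> t) \<oplus>\<^bsub>R\<^esub> (b \<otimes>\<^bsub>R\<^esub> s)) (s \<otimes>\<^bsub>R\<^esub> t)) \<rparr>"

definition localization_at ::
    "('a, 'b) ring_scheme \<Rightarrow> 'a set \<Rightarrow> (('a \<times> 'a) set) ring" where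
  "localization_at R p = localization R (carrier R - p)"

definition localization_max_ideal ::
    "('a, 'b) ring_scheme \<Rightarrow> 'a set \<Rightarrow> ('a \<times> 'a) set set" where
  "localization_max_ideal R p =
     {fraction R (carrier R - p) a s | a s. a \<in> p \<and> s \<in> carrier R - p}"

primrec ideal_power :: "('a, 'b) ring_scheme \<Rightarrow> 'a set \<Rightarrow> nat \<Rightarrow> 'a set" where
  "ideal_power R I 0 = carrier R"
| "ideal_power R I (Suc k) = ideal_power R I k \<cdot>\<^bsub>R\<^esub> I"

text \<open>
  The associated graded ring \<open>gr(R, I) = \<Oplus>\<^sub>k I\<^sup>k / I\<^sup>k\<^sup>+\<^sup>1\<close>: an element \<open>x\<close> is a finitely supported
  family whose entry \<open>x k\<close> is a coset of \<open>I\<^sup>k\<^sup>+\<^sup>1\<close> in \<open>I\<^sup>k\<close>.  The entry of a product in degree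
  \<open>k\<close> is the coset of \<open>\<Sum>i\<le>k. a i \<otimes> b (k - i)\<close>, for any choice of representatives \<open>a i \<in> x i\<close>
  and \<open>b i \<in> y i\<close>.
\<close>

definition assoc_graded :: "('a, 'b) ring_scheme \<Rightarrow> 'a set \<Rightarrow> (nat \<Rightarrow> 'a set) ring" where
  "assoc_graded R I = \<lparr>
     carrier = {x. (\<forall>k. \<exists>a\<in>ideal_power R I k. x k = ideal_power R I (Suc k) +>\<^bsub>R\<^esub> a) \<and>
                   finite {k. x k \<noteq> ideal_power R I (Suc k)}},
     monoid.mult = (\<lambda>x y k. {c. \<exists>a b. (\<forall>i\<le>k. a i \<in> x i \<and> b i \<in> y i) \<and>
               c \<in> ideal_power R I (Suc k) +>\<^bsub>R\<^esub> (\<Oplus>\<^bsub>R\<^esub>i\<in>{..k}. a i \<otimes>\<^bsub>R\<^esub> b (k - i))}),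
     one = (\<lambda>k. if k = 0 then ideal_power R I (Suc 0) +>\<^bsub>R\<^esub> \<one>\<^bsub>R\<^esub> else ideal_power R I (Suc k)),
     zero = (\<lambda>k. ideal_power R I (Suc k)),
     add = (\<lambda>x y k. x k <+>\<^bsub>R\<^esub> y k) \<rparr>"

definition assoc_graded_part :: "('a, 'b) ring_scheme \<Rightarrow> 'a set \<Rightarrow> nat \<Rightarrow> (nat \<Rightarrow> 'a set) set" where
  "assoc_graded_part R I k =
     {x \<in> carrier (assoc_graded R I). \<forall>j. j \<noteq> k \<longrightarrow> x j = ideal_power R I (Suc j)}"


section \<open>Degree of a graded ring\<close>

text \<open>
  A graded ring is given by a ring \<open>G\<close> and its homogeneous parts \<open>H k\<close>, where \<open>H 0\<close> is a field.
\<close>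

definition is_hilbert_poly :: "('a, 'b) ring_scheme \<Rightarrow> (nat \<Rightarrow> 'a set) \<Rightarrow> rat poly \<Rightarrow> bool" where
  "is_hilbert_poly G H p \<longleftrightarrow>
     (\<forall>\<^sub>F k in sequentially. \<exists>d. ring.dimension G d (H 0) (H k) \<and> poly p (of_nat k) = of_nat d)"

definition has_graded_degree :: "('a, 'b) ring_scheme \<Rightarrow> (nat \<Rightarrow> 'a set) \<Rightarrow> rat \<Rightarrow> bool" where
  "has_graded_degree G H e \<longleftrightarrow>
     (\<exists>r p. krull_dim G = enat (r + 1) \<and> is_hilbert_poly G H p \<and>
        Polynomial.lead_coeff p = e / fact r)"

definition graded_degree :: "('a, 'b) ring_scheme \<Rightarrow> (nat \<Rightarrow> 'a set) \<Rightarrow> rat" where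
  "graded_degree G H = (THE e. has_graded_degree G H e)"


section \<open>Affine varieties and multiplicity at a point\<close>

text \<open>
  Polynomials with coefficients in \<open>'k\<close> are finitely supported functions on monomials, and
  monomials are finitely supported functions from variables to exponents.  A finite set \<open>V\<close> of
  variables gives the polynomial ring \<open>K[X\<^sub>v, v \<in> V]\<close> and the affine space
  \<open>V \<rightarrow>\<^sub>E UNIV\<close>.
\<close>

definition mpoly_ring :: "'v set \<Rightarrow> (('v \<Rightarrow>\<^sub>0 nat) \<Rightarrow>\<^sub>0 'k::comm_ring_1) ring" where
  "mpoly_ring V = \<lparr>
     carrier = {p. \<forall>m\<in>Poly_Mapping.keys p. Poly_Mapping.keys m \<subseteq> V},
     monoid.mult = (*), one = 1, zero = 0, add = (+) \<rparr>"

definition mvar :: "'v \<Rightarrow> ('v \<Rightarrow>\<^sub>0 nat) \<Rightarrow>\<^sub>0 'k::comm_ring_1" where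
  "mvar v = Poly_Mapping.single (Poly_Mapping.single v 1) 1"

definition mpoly_eval :: "(('v \<Rightarrow>\<^sub>0 nat) \<Rightarrow>\<^sub>0 'k::comm_ring_1) \<Rightarrow> ('v \<Rightarrow> 'k) \<Rightarrow> 'k" where
  "mpoly_eval p x = (\<Sum>m\<in>Poly_Mapping.keys p. Poly_Mapping.lookup p m *
     (\<Prod>v\<in>Poly_Mapping.keys m. x v ^ Poly_Mapping.lookup m v))"

definition zero_locus ::
    "'v set \<Rightarrow> (('v \<Rightarrow>\<^sub>0 nat) \<Rightarrow>\<^sub>0 'k::comm_ring_1) set \<Rightarrow> ('v \<Rightarrow> 'k) set" where
  "zero_locus V F = {x \<in> V \<rightarrow>\<^sub>E UNIV. \<forall>f\<in>F. mpoly_eval f x = 0}"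

definition vanishing_ideal ::
    "'v set \<Rightarrow> ('v \<Rightarrow> 'k) set \<Rightarrow> (('v \<Rightarrow>\<^sub>0 nat) \<Rightarrow>\<^sub>0 'k::comm_ring_1) set" where
  "vanishing_ideal V X = {f \<in> carrier (mpoly_ring V). \<forall>x\<in>X. mpoly_eval f x = 0}"

definition coordinate_ring ::
    "'v set \<Rightarrow> ('v \<Rightarrow> 'k) set \<Rightarrow> ((('v \<Rightarrow>\<^sub>0 nat) \<Rightarrow>\<^sub>0 'k::comm_ring_1) set) ring" where
  "coordinate_ring V X = mpoly_ring V Quot vanishing_ideal V X"

definition point_ideal ::
    "'v set \<Rightarrow> ('v \<Rightarrow> 'k) set \<Rightarrow> ('v \<Rightarrow> 'k) \<Rightarrow> (('v \<Rightarrow>\<^sub>0 nat) \<Rightarrow>\<^sub>0 'k::comm_ring_1) set set" where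
  "point_ideal V X P = {vanishing_ideal V X +>\<^bsub>mpoly_ring V\<^esub> f | f.
     f \<in> carrier (mpoly_ring V) \<and> mpoly_eval f P = 0}"

definition multiplicity_at :: "'v set \<Rightarrow> ('v \<Rightarrow> 'k::field) set \<Rightarrow> ('v \<Rightarrow> 'k) \<Rightarrow> rat" where
  "multiplicity_at V X P =
     (let A = coordinate_ring V X;
          p = point_ideal V X P;
          \<O> = localization_at A p;
          \<mm> = localization_max_ideal A p
      in graded_degree (assoc_graded \<O> \<mm>) (assoc_graded_part \<O> \<mm>))"

definition affine_origin :: "'v set \<Rightarrow> 'v \<Rightarrow> 'k::zero" where
  "affine_origin V = (\<lambda>v\<in>V. 0)"


section \<open>The toric variety of a distributive lattice\<close>

definition lattice_binomials :: "'v::lattice set \<Rightarrow> (('v \<Rightarrow>\<^sub>0 nat) \<Rightarrow>\<^sub>0 'k::comm_ring_1) set" where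
  "lattice_binomials L =
     {mvar \<alpha> * mvar \<beta> - mvar (sup \<alpha> \<beta>) * mvar (inf \<alpha> \<beta>) | \<alpha> \<beta>. \<alpha> \<in> L \<and> \<beta> \<in> L}"

text \<open>
  A closed set is the zero locus of its vanishing ideal, so the variety whose vanishing ideal is
  generated by the binomials is their zero locus.
\<close>

definition lattice_variety :: "'v::lattice set \<Rightarrow> ('v \<Rightarrow> 'k::field) set" where
  "lattice_variety L = zero_locus L (lattice_binomials L)"

definition I2 :: "nat \<Rightarrow> (nat \<times> nat) set" where
  "I2 n = {(i, j). 1 \<le> i \<and> i < j \<and> j \<le> n}"

definition X2 :: "nat \<Rightarrow> (nat \<times> nat \<Rightarrow> 'k::field) set" where
  "X2 n = lattice_variety (I2 n)"

end

theory Submission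
  imports Defs "HOL-Computational_Algebra.Fraction_Field"
begin

text \<open>
  The substitution of \<open>a\<^sub>i b\<^sub>j\<close> for the coordinate \<open>(i, j)\<close> identifies the coordinate ring with a
  monoid algebra \<open>B\<close>: two monomials with the same image take the same values on the variety, since
  the binomials allow to split off the variable of the largest row and column. \<open>B\<close> is graded and
  generated in degree 1, so the associated graded ring of its localization at the origin is \<open>B\<close>
  again. The monomials of degree \<open>k\<close> correspond to the semistandard tableaux of shape \<open>(k, k)\<close> with
  entries at most \<open>n\<close>; the branching rule and a Jacobi--Trudi determinant yield the Hilbert
  polynomial, of degree \<open>2 * n - 4\<close> with leading coefficient \<open>1 / ((n - 1)! * (n - 2)!)\<close>. The Krull
  dimension is bounded below by a flag of faces, and above because a chain of primes of length \<open>l\<close>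
  gives \<open>l\<close> algebraically independent elements, while the number of monomials of degree at most \<open>k\<close>
  is at most \<open>(k + 1) ^ (2 * n - 3)\<close>.
\<close>

section \<open>Polynomials and the vanishing ideal\<close>

text \<open>The parameters are numbered by naturals because polynomials over a linearly ordered
  monoid of monomials form an integral domain: \<open>B\<close> then lies in a fraction field, and
  the localization can be handled as a ring of honest fractions. Tableaux appear because a monomial
  of degree k in the a_i and degree k in the b_j is a product of k coordinates a_i b_j with i < j
  exactly when a Hall condition holds, and that condition is column strictness. The branching rule
  leaves the rectangular shapes, which is why all shapes (p, q) are counted. The degree is (2n-4)!
  times the leading coefficient. The factorial is dictated by the Krull dimension 2n-3, so this
  dimension has to be determined exactly and independently of the degree of the Hilbert
  polynomial.\<close>

lemma infinite_UNIV_alg_closed: "infinite (UNIV :: 'k::alg_closed_field set)"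
proof
  assume fin: "finite (UNIV :: 'k set)"
  \<comment> \<open>Over a finite field \<open>p + 1\<close> would have positive degree and yet take
    the value 1 everywhere.\<close>
  define p where "p = (\<Prod>a\<in>(UNIV :: 'k set). [:-a, 1:])"
  have "degree p = card (UNIV :: 'k set)"
    by (simp add: p_def degree_prod_eq_sum_degree)
  with fin have "degree p > 0"
    by (simp add: card_gt_0_iff)
  then have "degree (p + 1) > 0"
    by (metis degree_1 degree_add_eq_left)
  then obtain x where "poly (p + 1) x = 0"
    using alg_closed_imp_poly_has_root by blast
  moreover have "poly p x = 0"
    using fin by (auto simp: p_def poly_prod prod_zero_iff)
  ultimately show False
    by simp
qed

text \<open>One operator for several purposes: \<open>c = id\<close> gives evaluation of
  polynomials, \<open>c = Poly_Mapping.single 0\<close> gives the map between monoid algebras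
  induced by a map of monomials. Monomials have coefficients too, namely their exponents, so degrees
  and \<open>pmono\<close> are further instances.\<close>

definition lin_ext :: "('a::zero \<Rightarrow> 'b::comm_semiring_1) \<Rightarrow> ('m \<Rightarrow> 'b) \<Rightarrow> ('m \<Rightarrow>\<^sub>0 'a) \<Rightarrow> 'b" where
  "lin_ext c \<phi> f = (\<Sum>m\<in>Poly_Mapping.keys f. c (Poly_Mapping.lookup f m) * \<phi> m)"

lemma lin_ext_superset:
  assumes "finite S" "Poly_Mapping.keys f \<subseteq> S" "c 0 = 0"
  shows "lin_ext c \<phi> f = (\<Sum>m\<in>S. c (Poly_Mapping.lookup f m) * \<phi> m)"
  unfolding lin_ext_def
  by (rule sum.mono_neutral_left) (use assms in \<open>auto simp: in_keys_iff\<close>)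

lemma lin_ext_zero [simp]: "lin_ext c \<phi> 0 = 0"
  by (simp add: lin_ext_def)

lemma lin_ext_single: "c 0 = 0 \<Longrightarrow> lin_ext c \<phi> (Poly_Mapping.single m a) = c a * \<phi> m"
  by (subst lin_ext_superset[of "{m}"]) auto

lemma lin_ext_add:
  fixes f g :: "'m \<Rightarrow>\<^sub>0 'a::comm_monoid_add"
  assumes "c 0 = 0" "\<And>x y. c (x + y) = c x + c y"
  shows "lin_ext c \<phi> (f + g) = lin_ext c \<phi> f + lin_ext c \<phi> g"
proof -
  let ?S = "Poly_Mapping.keys f \<union> Poly_Mapping.keys g"
  have "lin_ext c \<phi> h = (\<Sum>m\<in>?S. c (Poly_Mapping.lookup h m) * \<phi> m)"
    if "Poly_Mapping.keys h \<subseteq> ?S" for h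
    using that assms(1) by (intro lin_ext_superset) auto
  then show ?thesis
    using Poly_Mapping.keys_add[of f g]
    by (simp add: lookup_add assms(2) distrib_right sum.distrib)
qed

lemma lin_ext_sum:
  fixes f :: "'i \<Rightarrow> 'm \<Rightarrow>\<^sub>0 'a::comm_monoid_add"
  assumes "c 0 = 0" "\<And>x y. c (x + y) = c x + c y"
  shows "lin_ext c \<phi> (\<Sum>i\<in>I. f i) = (\<Sum>i\<in>I. lin_ext c \<phi> (f i))"
  by (induction I rule: infinite_finite_induct) (auto simp: lin_ext_add assms)

lemma poly_mapping_sum_single:
  fixes f :: "'m \<Rightarrow>\<^sub>0 'a::comm_monoid_add"
  assumes "finite S" "Poly_Mapping.keys f \<subseteq> S"
  shows "f = (\<Sum>m\<in>S. Poly_Mapping.single m (Poly_Mapping.lookup f m))"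
  using assms
  by (intro poly_mapping_eqI)
    (auto simp: lookup_sum lookup_single when_def in_keys_iff sum.delta)

lemma lin_ext_mult:
  fixes f g :: "'m::monoid_add \<Rightarrow>\<^sub>0 'a::semiring_0"
  assumes "c 0 = 0" "\<And>x y. c (x + y) = c x + c y" "\<And>x y. c (x * y) = c x * c y"
    and "\<And>m m'. \<phi> (m + m') = \<phi> m * \<phi> m'"
  shows "lin_ext c \<phi> (f * g) = lin_ext c \<phi> f * lin_ext c \<phi> g"
proof -
  let ?F = "Poly_Mapping.keys f" and ?G = "Poly_Mapping.keys g"
  have "f * g = (\<Sum>m\<in>?F. Poly_Mapping.single m (Poly_Mapping.lookup f m)) *
      (\<Sum>m\<in>?G. Poly_Mapping.single m (Poly_Mapping.lookup g m))"
    by (simp flip: poly_mapping_sum_single)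
  also have "\<dots> = (\<Sum>m\<in>?F. \<Sum>m'\<in>?G.
      Poly_Mapping.single (m + m') (Poly_Mapping.lookup f m * Poly_Mapping.lookup g m'))"
    by (simp add: sum_product mult_single)
  also have "lin_ext c \<phi> \<dots> = (\<Sum>m\<in>?F. \<Sum>m'\<in>?G.
      (c (Poly_Mapping.lookup f m) * c (Poly_Mapping.lookup g m')) * (\<phi> m * \<phi> m'))"
    by (simp add: lin_ext_sum lin_ext_single assms)
  also have "\<dots> = lin_ext c \<phi> f * lin_ext c \<phi> g"
    by (simp add: lin_ext_def sum_product mult_ac)
  finally show ?thesis .
qed

lemma keys_add_nat: "Poly_Mapping.keys (f + g) = Poly_Mapping.keys f \<union> Poly_Mapping.keys (g :: 'v \<Rightarrow>\<^sub>0 nat)"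
  by (auto simp: in_keys_iff lookup_add)

lemma monomial_induct [consumes 1, case_names zero add]:
  fixes m :: "'v \<Rightarrow>\<^sub>0 nat"
  assumes "Poly_Mapping.keys m \<subseteq> V" and "P 0"
    and "\<And>v m. v \<in> V \<Longrightarrow> Poly_Mapping.keys m \<subseteq> V \<Longrightarrow> P m \<Longrightarrow> P (Poly_Mapping.single v 1 + m)"
  shows "P m"
  using assms(1)
proof (induction "\<Sum>v\<in>Poly_Mapping.keys m. Poly_Mapping.lookup m v" arbitrary: m rule: less_induct)
  case less
  show ?case
  proof (cases "m = 0")
    case False
    then obtain v where v: "v \<in> Poly_Mapping.keys m"
      by (metis keys_eq_empty all_not_in_conv)
    let ?m = "m - Poly_Mapping.single v 1"
    have m: "m = Poly_Mapping.single v 1 + ?m"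
      using v by (intro poly_mapping_eqI) (auto simp: lookup_add lookup_minus lookup_single in_keys_iff when_def)
    have keys: "Poly_Mapping.keys ?m \<subseteq> Poly_Mapping.keys m"
      by (auto simp: in_keys_iff lookup_minus)
    have "(\<Sum>v\<in>Poly_Mapping.keys ?m. Poly_Mapping.lookup ?m v)
        = (\<Sum>v\<in>Poly_Mapping.keys m. Poly_Mapping.lookup ?m v)"
      by (rule sum.mono_neutral_left) (use keys in \<open>auto simp: in_keys_iff\<close>)
    also have "\<dots> < (\<Sum>v\<in>Poly_Mapping.keys m. Poly_Mapping.lookup m v)"
      by (rule sum_strict_mono_ex1)
        (use v in \<open>auto simp: lookup_minus lookup_single in_keys_iff intro!: bexI[of _ v]\<close>)
    finally have "P ?m"
      using less keys by auto
    then show ?thesis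
      using assms(3)[of v ?m] v keys less.prems m by auto
  qed (simp add: assms(2))
qed

section \<open>Evaluation of monomials and the Kronecker substitution\<close>

definition monom_eval :: "('v \<Rightarrow> 'k::comm_ring_1) \<Rightarrow> ('v \<Rightarrow>\<^sub>0 nat) \<Rightarrow> 'k" where
  "monom_eval x m = (\<Prod>v\<in>Poly_Mapping.keys m. x v ^ Poly_Mapping.lookup m v)"

lemma mpoly_eval_eq: "mpoly_eval f x = lin_ext id (monom_eval x) f"
  by (simp add: mpoly_eval_def lin_ext_def monom_eval_def)

lemma monom_eval_superset:
  assumes "finite S" "Poly_Mapping.keys m \<subseteq> S"
  shows "monom_eval x m = (\<Prod>v\<in>S. x v ^ Poly_Mapping.lookup m v)"
  unfolding monom_eval_def
  by (rule prod.mono_neutral_left) (use assms in \<open>auto simp: in_keys_iff\<close>)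

lemma monom_eval_zero [simp]: "monom_eval x 0 = 1"
  by (simp add: monom_eval_def)

lemma monom_eval_single [simp]: "monom_eval x (Poly_Mapping.single v k) = x v ^ k"
  by (subst monom_eval_superset[of "{v}"]) auto

lemma monom_eval_add: "monom_eval x (m + m') = monom_eval x m * monom_eval x m'"
proof -
  let ?S = "Poly_Mapping.keys m \<union> Poly_Mapping.keys m'"
  have "monom_eval x h = (\<Prod>v\<in>?S. x v ^ Poly_Mapping.lookup h v)" if "Poly_Mapping.keys h \<subseteq> ?S" for h
    using that by (intro monom_eval_superset) auto
  then show ?thesis
    using Poly_Mapping.keys_add[of m m'] by (simp add: lookup_add power_add prod.distrib)
qed

text \<open>Serves the Kronecker substitution: exponent vectors with entries below \<open>D\<close>
  are the digit strings of their codes in base \<open>D\<close>.\<close>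

lemma digits_unique:
  fixes D :: nat
  assumes "(\<Sum>v<N. a v * D ^ v) = (\<Sum>v<N. b v * D ^ v)"
    and "\<And>v. v < N \<Longrightarrow> a v < D" "\<And>v. v < N \<Longrightarrow> b v < D" "v < N"
  shows "a v = b v"
  using assms
proof (induction N arbitrary: a b v)
  case (Suc N)
  have split: "(\<Sum>v<Suc N. c v * D ^ v) = c 0 + D * (\<Sum>v<N. c (Suc v) * D ^ v)" for c :: "nat \<Rightarrow> nat"
    unfolding sum.lessThan_Suc_shift by (simp add: sum_distrib_left mult_ac)
  have eq: "a 0 + D * (\<Sum>v<N. a (Suc v) * D ^ v) = b 0 + D * (\<Sum>v<N. b (Suc v) * D ^ v)"
    using Suc.prems(1) unfolding split .
  have "a 0 < D" "b 0 < D"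
    using Suc.prems by auto
  then have 0: "a 0 = b 0"
    using arg_cong[OF eq, of "\<lambda>x. x mod D"] by simp
  with eq \<open>a 0 < D\<close> have "(\<Sum>v<N. a (Suc v) * D ^ v) = (\<Sum>v<N. b (Suc v) * D ^ v)"
    by auto
  then have "a (Suc w) = b (Suc w)" if "w < N" for w
    using Suc.IH[of "\<lambda>v. a (Suc v)" "\<lambda>v. b (Suc v)" w] Suc.prems that by auto
  with 0 Suc.prems(4) show ?case
    by (cases v) auto
qed simp

text \<open>
  Kronecker substitution: for large \<open>D\<close>, the substitution of \<open>t ^ (D ^ v)\<close> for the variable \<open>v\<close>
  sends the monomials of \<open>g\<close> to distinct powers of \<open>t\<close>.
\<close>

lemma vanishing_poly_eq_0:
  fixes g :: "(nat \<Rightarrow>\<^sub>0 nat) \<Rightarrow>\<^sub>0 'k::field"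
  assumes inf: "infinite (UNIV :: 'k set)" and zero: "\<And>y. lin_ext id (monom_eval y) g = 0"
  shows "g = 0"
proof (rule ccontr)
  assume "g \<noteq> 0"
  then obtain \<mu> where \<mu>: "\<mu> \<in> Poly_Mapping.keys g"
    by (metis keys_eq_empty all_not_in_conv)
  define S where "S = (\<Union>m\<in>Poly_Mapping.keys g. Poly_Mapping.keys m)"
  have "finite S"
    by (simp add: S_def)
  then obtain N where N: "S \<subseteq> {..<N}"
    by (meson finite_nat_iff_bounded)
  \<comment> \<open>\<open>Suc\<close> makes every exponent a digit in base \<open>D\<close>. If
    \<open>S\<close> is empty the maximum is unspecified, but then all exponents are 0 and
    \<open>D > 0\<close> suffices.\<close>
  define D where "D = Suc (Max ((\<lambda>(m, v). Poly_Mapping.lookup m v) ` (Poly_Mapping.keys g \<times> S)))"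
  have D: "Poly_Mapping.lookup m v < D" if "m \<in> Poly_Mapping.keys g" for m v
  proof (cases "v \<in> S")
    case True
    have "Poly_Mapping.lookup m v \<in> (\<lambda>(m, v). Poly_Mapping.lookup m v) ` (Poly_Mapping.keys g \<times> S)"
      using that True by force
    then show ?thesis
      unfolding D_def using \<open>finite S\<close> by (intro le_imp_less_Suc Max_ge) auto
  next
    case False
    then have "Poly_Mapping.lookup m v = 0"
      using that by (auto simp: S_def in_keys_iff)
    then show ?thesis
      by (simp add: D_def)
  qed
  define \<kappa> where "\<kappa> m = (\<Sum>v<N. Poly_Mapping.lookup m v * D ^ v)" for m :: "nat \<Rightarrow>\<^sub>0 nat"
  have inj: "inj_on \<kappa> (Poly_Mapping.keys g)"
  proof (rule inj_onI, rule poly_mapping_eqI)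
    fix m m' v assume *: "m \<in> Poly_Mapping.keys g" "m' \<in> Poly_Mapping.keys g" "\<kappa> m = \<kappa> m'"
    show "Poly_Mapping.lookup m v = Poly_Mapping.lookup m' v"
    proof (cases "v < N")
      case True
      then show ?thesis
        using digits_unique[where N = N and a = "Poly_Mapping.lookup m" and D = D
            and b = "Poly_Mapping.lookup m'" and v = v] D *
        by (auto simp: \<kappa>_def)
    next
      case False
      then have "v \<notin> Poly_Mapping.keys m" "v \<notin> Poly_Mapping.keys m'"
        using N * by (auto simp: S_def)
      then show ?thesis
        by (simp add: in_keys_iff)
    qed
  qed
  have eval: "monom_eval (\<lambda>v. t ^ (D ^ v)) m = t ^ \<kappa> m" if "m \<in> Poly_Mapping.keys g" for t :: 'k and m
    using that N
    by (subst monom_eval_superset[of "{..<N}"])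
      (auto simp: S_def \<kappa>_def power_sum mult.commute simp flip: power_mult)
  \<comment> \<open>The univariate image of \<open>g\<close>. It vanishes identically, while
    injectivity of \<open>\<kappa>\<close> keeps the coefficient of \<open>\<mu>\<close> visible at
    the power \<open>\<kappa> \<mu>\<close>.\<close>
  define p where "p = (\<Sum>m\<in>Poly_Mapping.keys g. monom (Poly_Mapping.lookup g m) (\<kappa> m))"
  have "poly p t = 0" for t
    using zero[of "\<lambda>v. t ^ (D ^ v)"] by (simp add: p_def poly_sum poly_monom lin_ext_def eval)
  then have "p = 0"
    using inf poly_roots_finite[of p] by fastforce
  then have "0 = coeff p (\<kappa> \<mu>)"
    by simp
  also have "\<dots> = (\<Sum>m\<in>Poly_Mapping.keys g. if m = \<mu> then Poly_Mapping.lookup g m else 0)"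
    unfolding p_def coeff_sum coeff_monom using inj \<mu> by (intro sum.cong) (auto simp: inj_on_def)
  also have "\<dots> = Poly_Mapping.lookup g \<mu>"
    using \<mu> by simp
  finally show False
    using \<mu> by (simp add: in_keys_iff)
qed

section \<open>Pushforward along a map of monomials\<close>

definition push :: "('m \<Rightarrow> 'm') \<Rightarrow> ('m \<Rightarrow>\<^sub>0 'k) \<Rightarrow> ('m' \<Rightarrow>\<^sub>0 'k::comm_ring_1)" where
  "push \<phi> f = (\<Sum>m\<in>Poly_Mapping.keys f. Poly_Mapping.single (\<phi> m) (Poly_Mapping.lookup f m))"

lemma push_superset:
  assumes "finite S" "Poly_Mapping.keys f \<subseteq> S"
  shows "push \<phi> f = (\<Sum>m\<in>S. Poly_Mapping.single (\<phi> m) (Poly_Mapping.lookup f m))"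
  unfolding push_def
  by (rule sum.mono_neutral_left) (use assms in \<open>auto simp: in_keys_iff\<close>)

lemma push_eq_lin_ext:
  fixes \<phi> :: "'m \<Rightarrow> 'm'::comm_monoid_add"
  shows "push \<phi> = lin_ext (Poly_Mapping.single 0) (\<lambda>m. Poly_Mapping.single (\<phi> m) 1)"
  by (simp add: fun_eq_iff push_def lin_ext_def mult_single)

lemma push_single [simp]: "push \<phi> (Poly_Mapping.single m a) = Poly_Mapping.single (\<phi> m) a"
  by (subst push_superset[of "{m}"]) auto

lemma push_add:
  fixes \<phi> :: "'m \<Rightarrow> 'm'::comm_monoid_add"
  shows "push \<phi> (f + g) = push \<phi> f + push \<phi> g"
  by (simp add: push_eq_lin_ext lin_ext_add single_add)

lemma push_mult:
  fixes \<phi> :: "'m::comm_monoid_add \<Rightarrow> 'm'::comm_monoid_add"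
  assumes "\<And>m m'. \<phi> (m + m') = \<phi> m + \<phi> m'"
  shows "push \<phi> (f * g) = push \<phi> f * push \<phi> g"
  unfolding push_eq_lin_ext by (rule lin_ext_mult) (simp_all add: assms single_add mult_single)

lemma keys_push: "Poly_Mapping.keys (push \<phi> f) \<subseteq> \<phi> ` Poly_Mapping.keys f"
  unfolding push_def using Poly_Mapping.keys_sum by (fastforce split: if_splits)

lemma lookup_push:
  "Poly_Mapping.lookup (push \<phi> f) \<mu> = (\<Sum>m | m \<in> Poly_Mapping.keys f \<and> \<phi> m = \<mu>. Poly_Mapping.lookup f m)"
  unfolding push_def lookup_sum lookup_single when_def
  by (rule sum.inter_filter[symmetric]) simp

text \<open>
  The toric parametrization sends the coordinate with index \<open>(i, j)\<close> to \<open>a\<^sub>i b\<^sub>j\<close>; the parameters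
  \<open>a\<^sub>i\<close> and \<open>b\<^sub>j\<close> are the variables with the numbers \<open>2 * i\<close> and \<open>2 * j + 1\<close>.
\<close>

definition param :: "nat \<times> nat \<Rightarrow> (nat \<Rightarrow>\<^sub>0 nat)" where
  "param \<alpha> = Poly_Mapping.single (2 * fst \<alpha>) 1 + Poly_Mapping.single (2 * snd \<alpha> + 1) 1"

text \<open>An exponent k must contribute the k-fold multiple of \<open>param\<close>. In the
  convolution product on exponent vectors this multiple is the product with
  \<open>Poly_Mapping.single 0 k\<close>, so additivity comes from
  \<open>lin_ext_add\<close>.\<close>

definition pmono :: "(nat \<times> nat \<Rightarrow>\<^sub>0 nat) \<Rightarrow> (nat \<Rightarrow>\<^sub>0 nat)" where
  "pmono m = lin_ext (Poly_Mapping.single 0) param m"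

lemma pmono_zero [simp]: "pmono 0 = 0"
  by (simp add: pmono_def)

lemma pmono_add: "pmono (m + m') = pmono m + pmono m'"
  by (simp add: pmono_def lin_ext_add single_add)

lemma pmono_single [simp]: "pmono (Poly_Mapping.single \<alpha> (Suc 0)) = param \<alpha>"
  by (simp add: pmono_def lin_ext_single flip: One_nat_def)

lemma lookup_param:
  "Poly_Mapping.lookup (param \<alpha>) (2 * i) = (if i = fst \<alpha> then 1 else 0)"
  "Poly_Mapping.lookup (param \<alpha>) (Suc (2 * i)) = (if i = snd \<alpha> then 1 else 0)"
  by (auto simp: param_def lookup_add lookup_single when_def) presburger+

lemma monom_eval_pmono:
  "monom_eval y (pmono m) = monom_eval (\<lambda>\<alpha>. y (2 * fst \<alpha>) * y (2 * snd \<alpha> + 1)) m"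
proof -
  have "Poly_Mapping.keys m \<subseteq> UNIV" by simp
  then show ?thesis
    by (induction m rule: monomial_induct) (auto simp: pmono_add monom_eval_add param_def)
qed

definition tdeg :: "('v \<Rightarrow>\<^sub>0 nat) \<Rightarrow> nat" where
  "tdeg m = lin_ext id (\<lambda>_. 1) m"

lemma tdeg_zero [simp]: "tdeg 0 = 0"
  and tdeg_single [simp]: "tdeg (Poly_Mapping.single v k) = k"
  and tdeg_add: "tdeg (m + m') = tdeg m + tdeg m'"
  by (simp_all add: tdeg_def lin_ext_single lin_ext_add)

text \<open>Only the even variables, the a_i, are counted: each coordinate contributes exactly one
  of them, so this grading agrees with \<open>tdeg\<close> instead of doubling it.\<close>

definition adeg :: "(nat \<Rightarrow>\<^sub>0 nat) \<Rightarrow> nat" where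
  "adeg m = lin_ext id (\<lambda>v. if even v then 1 else 0) m"

lemma adeg_zero [simp]: "adeg 0 = 0"
  and adeg_single [simp]: "adeg (Poly_Mapping.single v k) = (if even v then k else 0)"
  and adeg_add: "adeg (m + m') = adeg m + adeg m'"
  by (simp_all add: adeg_def lin_ext_single lin_ext_add)

lemma adeg_pmono: "adeg (pmono m) = tdeg m"
proof -
  have "Poly_Mapping.keys m \<subseteq> UNIV" by simp
  then show ?thesis
    by (induction m rule: monomial_induct) (auto simp: pmono_add adeg_add tdeg_add param_def)
qed

lemma tdeg_eq_0_iff [simp]: "tdeg m = 0 \<longleftrightarrow> m = 0"
proof
  have "Poly_Mapping.keys m \<subseteq> UNIV" by simp
  then show "tdeg m = 0 \<Longrightarrow> m = 0"
    by (induction m rule: monomial_induct) (auto simp: tdeg_add)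
qed auto

lemma keys_pmono:
  "2 * i \<in> Poly_Mapping.keys (pmono m) \<longleftrightarrow> i \<in> fst ` Poly_Mapping.keys m"
  "2 * i + 1 \<in> Poly_Mapping.keys (pmono m) \<longleftrightarrow> i \<in> snd ` Poly_Mapping.keys m"
proof -
  have "Poly_Mapping.keys m \<subseteq> UNIV" by simp
  then have "(2 * i \<in> Poly_Mapping.keys (pmono m) \<longleftrightarrow> i \<in> fst ` Poly_Mapping.keys m) \<and>
    (2 * i + 1 \<in> Poly_Mapping.keys (pmono m) \<longleftrightarrow> i \<in> snd ` Poly_Mapping.keys m)"
    by (induction m rule: monomial_induct)
      (auto simp: pmono_add keys_add_nat param_def double_not_eq_Suc_double Suc_double_not_eq_double)
  then show "2 * i \<in> Poly_Mapping.keys (pmono m) \<longleftrightarrow> i \<in> fst ` Poly_Mapping.keys m"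
    "2 * i + 1 \<in> Poly_Mapping.keys (pmono m) \<longleftrightarrow> i \<in> snd ` Poly_Mapping.keys m"
    by auto
qed

text \<open>The last conclusion allows a second, different variable to be extracted afterwards, as
  the binomial relations require.\<close>

lemma extract_single:
  fixes m :: "'v \<Rightarrow>\<^sub>0 nat"
  assumes "v \<in> Poly_Mapping.keys m"
  obtains m' where "m = Poly_Mapping.single v 1 + m'" "Poly_Mapping.keys m' \<subseteq> Poly_Mapping.keys m"
    "Poly_Mapping.keys m - {v} \<subseteq> Poly_Mapping.keys m'"
proof
  let ?m = "m - Poly_Mapping.single v 1"
  show "m = Poly_Mapping.single v 1 + ?m"
    using assms by (intro poly_mapping_eqI) (auto simp: lookup_add lookup_minus lookup_single in_keys_iff when_def)
  show "Poly_Mapping.keys ?m \<subseteq> Poly_Mapping.keys m"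
    "Poly_Mapping.keys m - {v} \<subseteq> Poly_Mapping.keys ?m"
    by (auto simp: in_keys_iff lookup_minus lookup_single when_def split: if_splits)
qed

text \<open>
  Modulo the binomials one can split off the variable of the largest row and the largest column,
  both of which can be read off from the image of the monomial under \<open>pmono\<close>.
\<close>

lemma split_off_max:
  fixes x :: "nat \<times> nat \<Rightarrow> 'k::comm_ring_1"
  assumes binom: "\<And>\<alpha> \<beta>. \<alpha> \<in> L \<Longrightarrow> \<beta> \<in> L \<Longrightarrow> x \<alpha> * x \<beta> = x (sup \<alpha> \<beta>) * x (inf \<alpha> \<beta>)"
    and sub: "\<And>\<alpha> \<beta>. \<alpha> \<in> L \<Longrightarrow> \<beta> \<in> L \<Longrightarrow> inf \<alpha> \<beta> \<in> L"
    and m: "Poly_Mapping.keys m \<subseteq> L" "m \<noteq> 0"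
  defines "\<gamma> \<equiv> (Max (fst ` Poly_Mapping.keys m), Max (snd ` Poly_Mapping.keys m))"
  obtains m' where "Poly_Mapping.keys m' \<subseteq> L" "pmono m = param \<gamma> + pmono m'"
    "monom_eval x m = x \<gamma> * monom_eval x m'" "tdeg m = Suc (tdeg m')"
proof -
  have ne: "Poly_Mapping.keys m \<noteq> {}"
    using m by simp
  have "fst \<gamma> \<in> fst ` Poly_Mapping.keys m" "snd \<gamma> \<in> snd ` Poly_Mapping.keys m"
    using ne by (simp_all add: \<gamma>_def)
  then obtain \<alpha> \<beta> where \<alpha>: "\<alpha> \<in> Poly_Mapping.keys m" "fst \<alpha> = fst \<gamma>"
    and \<beta>: "\<beta> \<in> Poly_Mapping.keys m" "snd \<beta> = snd \<gamma>"
    by (metis imageE)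
  have le: "snd \<alpha> \<le> snd \<gamma>" "fst \<beta> \<le> fst \<gamma>"
    using \<alpha>(1) \<beta>(1) by (auto simp: \<gamma>_def)
  show thesis
  proof (cases "\<alpha> = \<beta>")
    case True
    obtain m' where m': "m = Poly_Mapping.single \<alpha> 1 + m'" "Poly_Mapping.keys m' \<subseteq> Poly_Mapping.keys m"
      using extract_single[OF \<alpha>(1)] by blast
    moreover have "\<alpha> = \<gamma>"
      using True \<alpha> \<beta> by (metis prod.collapse)
    ultimately show thesis
      using m by (intro that[of m'])
        (auto simp: pmono_add monom_eval_add tdeg_add)
  next
    case False
    obtain m1 where m1: "m = Poly_Mapping.single \<alpha> 1 + m1" "Poly_Mapping.keys m1 \<subseteq> Poly_Mapping.keys m"
      "Poly_Mapping.keys m - {\<alpha>} \<subseteq> Poly_Mapping.keys m1"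
      using extract_single[OF \<alpha>(1)] by blast
    then have "\<beta> \<in> Poly_Mapping.keys m1"
      using \<beta> False by auto
    from extract_single[OF this] obtain m2
      where m2: "m1 = Poly_Mapping.single \<beta> 1 + m2" "Poly_Mapping.keys m2 \<subseteq> Poly_Mapping.keys m1"
      by blast
    have \<alpha>\<beta>: "\<alpha> \<in> L" "\<beta> \<in> L"
      using \<alpha> \<beta> m by auto
    \<comment> \<open>\<open>\<alpha>\<close> carries the largest row and \<open>\<beta>\<close> the
      largest column, so the binomial exchanges the two variables for their join
      \<open>\<gamma>\<close> and a remaining meet.\<close>
    have sup: "sup \<alpha> \<beta> = \<gamma>" and inf: "inf \<alpha> \<beta> = (fst \<beta>, snd \<alpha>)"
      using \<alpha> \<beta> le by (simp_all add: sup_prod_def inf_prod_def sup_nat_def inf_nat_def max_def min_def)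
    let ?m' = "Poly_Mapping.single (inf \<alpha> \<beta>) 1 + m2"
    have "Poly_Mapping.keys m2 \<subseteq> L"
      using m2(2) m1(2) m(1) by (rule order_trans[OF order_trans])
    then have "Poly_Mapping.keys ?m' \<subseteq> L"
      using Poly_Mapping.keys_add[of "Poly_Mapping.single (inf \<alpha> \<beta>) 1" m2] sub[OF \<alpha>\<beta>]
      by (auto split: if_splits)
    moreover have "pmono m = param \<gamma> + pmono ?m'"
      unfolding m1 m2 pmono_add One_nat_def pmono_single inf using \<alpha> \<beta> by (simp add: param_def add_ac)
    moreover have "monom_eval x m = x \<gamma> * monom_eval x ?m'"
      unfolding m1 m2 monom_eval_add monom_eval_single using binom[OF \<alpha>\<beta>] unfolding sup
      by (metis (no_types, lifting) mult.assoc power_one_right)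
    moreover have "tdeg m = Suc (tdeg ?m')"
      unfolding m1 m2 by (simp add: tdeg_add)
    ultimately show thesis
      by (rule that)
  qed
qed

text \<open>Equal images have equal largest rows and columns, so the same variable splits off on
  both sides. Its image cancels, and the remainders again have equal images in smaller
  degree.\<close>

lemma monom_eval_cong_pmono:
  fixes x :: "nat \<times> nat \<Rightarrow> 'k::comm_ring_1"
  assumes binom: "\<And>\<alpha> \<beta>. \<alpha> \<in> L \<Longrightarrow> \<beta> \<in> L \<Longrightarrow> x \<alpha> * x \<beta> = x (sup \<alpha> \<beta>) * x (inf \<alpha> \<beta>)"
    and sub: "\<And>\<alpha> \<beta>. \<alpha> \<in> L \<Longrightarrow> \<beta> \<in> L \<Longrightarrow> inf \<alpha> \<beta> \<in> L"
    and "Poly_Mapping.keys m \<subseteq> L" "Poly_Mapping.keys m' \<subseteq> L" "pmono m = pmono m'"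
  shows "monom_eval x m = monom_eval x m'"
  using assms(3-)
proof (induction "tdeg m" arbitrary: m m')
  case 0
  then have "tdeg m' = 0"
    by (metis adeg_pmono)
  with 0 have "m = 0" "m' = 0"
    by simp_all
  then show ?case by simp
next
  case (Suc k)
  have "tdeg m' = tdeg m"
    using Suc.prems(3) by (metis adeg_pmono)
  then have ne: "m \<noteq> 0" "m' \<noteq> 0"
    using Suc.hyps(2) by auto
  have eq: "fst ` Poly_Mapping.keys m' = fst ` Poly_Mapping.keys m"
    "snd ` Poly_Mapping.keys m' = snd ` Poly_Mapping.keys m"
    using keys_pmono[of _ m] keys_pmono[of _ m'] unfolding Suc.prems(3) by blast+
  let ?\<gamma> = "(Max (fst ` Poly_Mapping.keys m), Max (snd ` Poly_Mapping.keys m))"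
  obtain m1 where m1: "Poly_Mapping.keys m1 \<subseteq> L" "pmono m = param ?\<gamma> + pmono m1"
    "monom_eval x m = x ?\<gamma> * monom_eval x m1" "tdeg m = Suc (tdeg m1)"
    using split_off_max[of L x m, OF binom sub Suc.prems(1) ne(1)] by blast
  obtain m2 where m2: "Poly_Mapping.keys m2 \<subseteq> L" "pmono m' = param ?\<gamma> + pmono m2"
    "monom_eval x m' = x ?\<gamma> * monom_eval x m2"
    using split_off_max[of L x m', OF binom sub Suc.prems(2) ne(2)] unfolding eq by blast
  have "monom_eval x m1 = monom_eval x m2"
    using m1 m2 Suc.prems(3) Suc.hyps(2) by (intro Suc.hyps(1)) auto
  then show ?case
    using m1 m2 by simp
qed

lemma lattice_variety_iff:
  "x \<in> lattice_variety L \<longleftrightarrow> x \<in> L \<rightarrow>\<^sub>E UNIV \<and>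
     (\<forall>\<alpha>\<in>L. \<forall>\<beta>\<in>L. x \<alpha> * x \<beta> = x (sup \<alpha> \<beta>) * x (inf \<alpha> \<beta>))"
proof -
  have mvar: "mpoly_eval (mvar \<alpha> * mvar \<beta> - mvar \<gamma> * mvar \<delta>) x = x \<alpha> * x \<beta> - x \<gamma> * x \<delta>" for \<alpha> \<beta> \<gamma> \<delta>
  proof -
    have "mpoly_eval (mvar \<alpha> * mvar \<beta>) x = x \<alpha> * x \<beta>" for \<alpha> \<beta>
      by (simp add: mpoly_eval_eq lin_ext_mult monom_eval_add lin_ext_single mvar_def)
    moreover have "mpoly_eval (f - g) x + mpoly_eval g x = mpoly_eval f x" for f g
      by (simp add: mpoly_eval_eq flip: lin_ext_add)
    ultimately show ?thesis
      by (metis add_diff_cancel_right')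
  qed
  show ?thesis
    unfolding lattice_variety_def zero_locus_def lattice_binomials_def using mvar by auto (metis eq_iff_diff_eq_0)
qed

text \<open>If \<open>f\<close> vanishes on the variety, it vanishes at all parametrized points, so
  \<open>push pmono f\<close> is zero at all parameters. Conversely, the terms of \<open>f\<close>
  are grouped by image: at a point of the variety each group has one common monomial value, and its
  coefficients add up to a coefficient of \<open>push pmono f\<close>.\<close>

lemma vanishing_ideal_lattice_variety:
  fixes L :: "(nat \<times> nat) set"
  assumes inf: "infinite (UNIV :: 'k::field set)"
    and sub: "\<And>\<alpha> \<beta>. \<alpha> \<in> L \<Longrightarrow> \<beta> \<in> L \<Longrightarrow> inf \<alpha> \<beta> \<in> L"
     "\<And>\<alpha> \<beta>. \<alpha> \<in> L \<Longrightarrow> \<beta> \<in> L \<Longrightarrow> sup \<alpha> \<beta> \<in> L"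
  shows "vanishing_ideal L (lattice_variety L :: (nat \<times> nat \<Rightarrow> 'k) set) =
    {f \<in> carrier (mpoly_ring L). push pmono f = 0}"
proof -
  have "(\<forall>x\<in>(lattice_variety L :: (nat \<times> nat \<Rightarrow> 'k) set). mpoly_eval f x = 0) \<longleftrightarrow> push pmono f = 0"
    if f: "f \<in> carrier (mpoly_ring L)" for f :: "(nat \<times> nat \<Rightarrow>\<^sub>0 nat) \<Rightarrow>\<^sub>0 'k"
  proof
    have keys: "Poly_Mapping.keys m \<subseteq> L" if "m \<in> Poly_Mapping.keys f" for m
      using f that by (auto simp: mpoly_ring_def)
    assume zero: "\<forall>x\<in>lattice_variety L. mpoly_eval f x = 0"
    have "lin_ext id (monom_eval y) (push pmono f) = 0" for y
    proof -
      define x where "x = (\<lambda>\<alpha>\<in>L. y (2 * fst \<alpha>) * y (2 * snd \<alpha> + 1))"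
      \<comment> \<open>Join and meet merely redistribute the two row factors and the two column
        factors between the coordinates, so the binomials hold at \<open>x\<close>.\<close>
      have "x \<in> lattice_variety L"
        using sub by (auto simp: lattice_variety_iff x_def sup_nat_def inf_nat_def max_def min_def)
      then have "0 = mpoly_eval f x"
        using zero by simp
      also have "\<dots> = (\<Sum>m\<in>Poly_Mapping.keys f. Poly_Mapping.lookup f m * monom_eval y (pmono m))"
        unfolding mpoly_eval_eq lin_ext_def id_def
      proof (rule sum.cong)
        fix m assume "m \<in> Poly_Mapping.keys f"
        then have "monom_eval x m = monom_eval y (pmono m)"
          unfolding monom_eval_pmono using keys
          unfolding monom_eval_def by (intro prod.cong) (auto simp: x_def)
        then show "Poly_Mapping.lookup f m * monom_eval x m = Poly_Mapping.lookup f m * monom_eval y (pmono m)"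
          by simp
      qed simp
      also have "\<dots> = lin_ext id (monom_eval y) (push pmono f)"
        by (simp add: push_def lin_ext_sum lin_ext_single)
      finally show ?thesis by simp
    qed
    then show "push pmono f = 0"
      by (rule vanishing_poly_eq_0[OF inf])
  next
    have keys: "Poly_Mapping.keys m \<subseteq> L" if "m \<in> Poly_Mapping.keys f" for m
      using f that by (auto simp: mpoly_ring_def)
    assume zero: "push pmono f = 0"
    show "\<forall>x\<in>lattice_variety L. mpoly_eval f x = 0"
    proof
      fix x :: "nat \<times> nat \<Rightarrow> 'k" assume x: "x \<in> lattice_variety L"
      let ?F = "Poly_Mapping.keys f"
      have eq: "monom_eval x m = monom_eval x m'" if "m \<in> ?F" "m' \<in> ?F" "pmono m = pmono m'" for m m'
      proof (rule monom_eval_cong_pmono)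
        show "x \<alpha> * x \<beta> = x (sup \<alpha> \<beta>) * x (inf \<alpha> \<beta>)" if "\<alpha> \<in> L" "\<beta> \<in> L" for \<alpha> \<beta>
          using x that by (simp add: lattice_variety_iff)
      qed (use that keys sub in auto)
      have "mpoly_eval f x = (\<Sum>\<mu>\<in>pmono ` ?F. \<Sum>m | m \<in> ?F \<and> pmono m = \<mu>.
          Poly_Mapping.lookup f m * monom_eval x m)"
        unfolding mpoly_eval_eq lin_ext_def id_def by (rule sum.group[symmetric]) auto
      also have "\<dots> = (\<Sum>\<mu>\<in>pmono ` ?F. 0)"
      proof (rule sum.cong)
        fix \<mu> assume "\<mu> \<in> pmono ` ?F"
        then obtain m0 where m0: "m0 \<in> ?F" "\<mu> = pmono m0" by auto
        have "(\<Sum>m | m \<in> ?F \<and> pmono m = \<mu>. Poly_Mapping.lookup f m * monom_eval x m) =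
          (\<Sum>m | m \<in> ?F \<and> pmono m = \<mu>. Poly_Mapping.lookup f m * monom_eval x m0)"
          using m0 by (intro sum.cong) (auto intro!: arg_cong2[where f = times] eq)
        also have "\<dots> = Poly_Mapping.lookup (push pmono f) \<mu> * monom_eval x m0"
          by (simp add: lookup_push sum_distrib_right)
        finally show "(\<Sum>m | m \<in> ?F \<and> pmono m = \<mu>. Poly_Mapping.lookup f m * monom_eval x m) = 0"
          by (simp add: zero)
      qed simp
      finally show "mpoly_eval f x = 0" by simp
    qed
  qed
  then show ?thesis
    by (auto simp: vanishing_ideal_def)
qed


section \<open>The Hilbert function\<close>

text \<open>The variables from 2 to 2n+1 are a_1, b_1, ..., a_n, b_n. Read as a tableau, the
  exponent of a_i counts the entries i of the first row and that of b_j the entries j of the second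
  row. The inequality at \<open>t\<close> is column strictness, or Hall's condition for giving each
  b_j a partner a_i with i < j; the strict bound in \<open>{1..<t}\<close> encodes i < j.\<close>

definition dominated :: "nat \<Rightarrow> nat \<Rightarrow> nat \<Rightarrow> (nat \<Rightarrow>\<^sub>0 nat) set" where
  "dominated n p q = {\<mu>. Poly_Mapping.keys \<mu> \<subseteq> {2..2 * n + 1} \<and>
     (\<Sum>i=1..n. Poly_Mapping.lookup \<mu> (2 * i)) = p \<and>
     (\<Sum>j=1..n. Poly_Mapping.lookup \<mu> (2 * j + 1)) = q \<and>
     (\<forall>t\<in>{1..n}. (\<Sum>j=1..t. Poly_Mapping.lookup \<mu> (2 * j + 1)) \<le> (\<Sum>i=1..<t. Poly_Mapping.lookup \<mu> (2 * i)))}"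

definition lattice_monomials :: "nat \<Rightarrow> (nat \<Rightarrow>\<^sub>0 nat) set" where
  "lattice_monomials n = pmono ` {m. Poly_Mapping.keys m \<subseteq> I2 n}"

lemma keys_param: "Poly_Mapping.keys (param \<alpha>) \<subseteq> {2 * fst \<alpha>, 2 * snd \<alpha> + 1}"
  by (auto simp: param_def keys_add_nat)

lemma pmono_dominated:
  assumes "Poly_Mapping.keys m \<subseteq> I2 n"
  shows "pmono m \<in> dominated n (tdeg m) (tdeg m)"
  using assms
proof (induction m rule: monomial_induct)
  case zero
  then show ?case by (simp add: dominated_def)
next
  case (add \<alpha> m)
  have "param \<alpha> \<in> dominated n 1 1"
    using add.hyps(1) keys_param[of \<alpha>]
    by (auto simp: dominated_def I2_def lookup_param sum.delta)
  with add.IH show ?case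
    using Poly_Mapping.keys_add[of "param \<alpha>" "pmono m"]
    by (auto simp: dominated_def pmono_add tdeg_add lookup_add sum.distrib intro!: add_mono)
qed

text \<open>Greedy matching: the largest row i in use is paired with some larger column j in use.
  After removal of this pair the inequalities survive, and induction factors the rest.\<close>

lemma dominated_imp_lattice_monomial:
  assumes "\<mu> \<in> dominated n k k"
  shows "\<mu> \<in> lattice_monomials n"
  using assms
proof (induction k arbitrary: \<mu>)
  case 0
  have "Poly_Mapping.lookup \<mu> v = 0" for v
  proof (rule ccontr)
    assume "Poly_Mapping.lookup \<mu> v \<noteq> 0"
    then have "v \<in> Poly_Mapping.keys \<mu>"
      by (simp add: in_keys_iff)
    then have "v \<in> {2..2 * n + 1}"
      using 0 by (auto simp: dominated_def)
    moreover obtain i where "v = 2 * i \<or> v = 2 * i + 1"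
      by (metis evenE oddE)
    ultimately show False
      using 0 \<open>Poly_Mapping.lookup \<mu> v \<noteq> 0\<close> by (auto simp: dominated_def)
  qed
  then have "\<mu> = pmono 0"
    by (auto intro: poly_mapping_eqI)
  then show ?case
    unfolding lattice_monomials_def by (metis (mono_tags) empty_subsetI image_eqI keys_zero mem_Collect_eq)
next
  case (Suc k)
  let ?a = "\<lambda>i. Poly_Mapping.lookup \<mu> (2 * i)" and ?b = "\<lambda>j. Poly_Mapping.lookup \<mu> (2 * j + 1)"
  have a: "(\<Sum>i=1..n. ?a i) = Suc k" and b: "(\<Sum>j=1..n. ?b j) = Suc k"
    and dom: "\<And>t. t \<in> {1..n} \<Longrightarrow> (\<Sum>j=1..t. ?b j) \<le> (\<Sum>i=1..<t. ?a i)"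
    and keys: "Poly_Mapping.keys \<mu> \<subseteq> {2..2 * n + 1}"
    using Suc.prems by (auto simp: dominated_def)
  define i where "i = Max {i\<in>{1..n}. ?a i > 0}"
  have "{i\<in>{1..n}. ?a i > 0} \<noteq> {}"
    using a by (metis (mono_tags, lifting) Suc_neq_Zero empty_iff gr0I mem_Collect_eq sum.neutral)
  then have "i \<in> {i\<in>{1..n}. ?a i > 0}"
    unfolding i_def by (intro Max_in) auto
  then have i: "i \<in> {1..n}" "?a i > 0"
    by auto
  have i_max: "?a i' = 0" if "i' \<in> {1..n}" "i' > i" for i'
  proof (rule ccontr)
    assume "?a i' \<noteq> 0"
    then have "i' \<le> i"
      unfolding i_def using that by (intro Max_ge) auto
    with that show False by simp
  qed
  have a_below: "(\<Sum>i'=1..<t. ?a i') = Suc k" if "i < t" "t \<le> n" for t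
  proof -
    have "(\<Sum>i'=1..<t. ?a i') = (\<Sum>i'=1..n. ?a i')"
      using that i_max by (intro sum.mono_neutral_left) auto
    with a show ?thesis by simp
  qed
  \<comment> \<open>Otherwise all columns in use are at most i, and the inequality at i bounds their
    number by the rows below i, which miss the positive exponent of a_i.\<close>
  have "\<exists>j\<in>{i<..n}. ?b j > 0"
  proof (rule ccontr)
    assume "\<not> ?thesis"
    then have "(\<Sum>j=1..n. ?b j) = (\<Sum>j=1..i. ?b j)"
      using i by (intro sum.mono_neutral_right) auto
    also have "\<dots> \<le> (\<Sum>i'=1..<i. ?a i')"
      using dom i by auto
    also have "\<dots> < (\<Sum>i'=1..<i. ?a i') + ?a i"
      using i by simp
    also have "\<dots> = (\<Sum>i'=1..<Suc i. ?a i')"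
      using i by simp
    also have "\<dots> \<le> (\<Sum>i'=1..n. ?a i')"
      using i by (intro sum_mono2) auto
    finally show False
      using a b by simp
  qed
  then obtain j where j: "i < j" "j \<le> n" "?b j > 0"
    by auto
  let ?\<nu> = "\<mu> - param (i, j)"
  have \<nu>: "\<mu> = param (i, j) + ?\<nu>"
  proof (rule poly_mapping_eqI)
    fix v
    obtain l where "v = 2 * l \<or> v = Suc (2 * l)"
      by (metis evenE oddE Suc_eq_plus1)
    then show "Poly_Mapping.lookup \<mu> v = Poly_Mapping.lookup (param (i, j) + ?\<nu>) v"
      using i j by (auto simp: lookup_add lookup_minus lookup_param)
  qed
  have lookup: "?a l = (if l = i then 1 else 0) + Poly_Mapping.lookup ?\<nu> (2 * l)"
    "?b l = (if l = j then 1 else 0) + Poly_Mapping.lookup ?\<nu> (2 * l + 1)" for l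
    by (subst \<nu>; simp add: lookup_add lookup_param)+
  have keys\<nu>: "Poly_Mapping.keys ?\<nu> \<subseteq> {2..2 * n + 1}"
    using keys by (auto simp: in_keys_iff lookup_minus)
  have sums: "(\<Sum>l\<in>S. ?a l) = (if i \<in> S then 1 else 0) + (\<Sum>l\<in>S. Poly_Mapping.lookup ?\<nu> (2 * l))"
    "(\<Sum>l\<in>S. ?b l) = (if j \<in> S then 1 else 0) + (\<Sum>l\<in>S. Poly_Mapping.lookup ?\<nu> (2 * l + 1))"
    if "finite S" for S
    unfolding lookup sum.distrib using that by (simp_all add: sum.delta)
  have "(\<Sum>l=1..t. Poly_Mapping.lookup ?\<nu> (2 * l + 1)) \<le> (\<Sum>l=1..<t. Poly_Mapping.lookup ?\<nu> (2 * l))"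
    if t: "t \<in> {1..n}" for t
  \<comment> \<open>Only strictly between i and j does the right side drop alone. There the rows
    below \<open>t\<close> are all rows in use, so the right side is still k, while the left side
    misses the positive exponent of b_j and is at most k.\<close>
  proof (cases "i < t \<and> t < j")
    case True
    then have "(\<Sum>l=1..<t. Poly_Mapping.lookup ?\<nu> (2 * l)) = k"
      using a_below[of t] sums(1)[of "{1..<t}"] i t by auto
    moreover have "(\<Sum>l=1..t. ?b l) + ?b j = (\<Sum>l\<in>insert j {1..t}. ?b l)"
      using True by simp
    moreover have "\<dots> \<le> (\<Sum>l=1..n. ?b l)"
      using t j by (intro sum_mono2) auto
    moreover have "(\<Sum>l=1..t. ?b l) = (\<Sum>l=1..t. Poly_Mapping.lookup ?\<nu> (2 * l + 1))"
      using sums(2)[of "{1..t}"] True by auto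
    ultimately show ?thesis
      using b j by linarith
  next
    case False
    then show ?thesis
      using dom[OF t] sums(1)[of "{1..<t}"] sums(2)[of "{1..t}"] i j by (auto split: if_splits)
  qed
  then have "?\<nu> \<in> dominated n k k"
    using keys\<nu> a b sums[of "{1..n}"] i j by (auto simp: dominated_def)
  then obtain m where m: "?\<nu> = pmono m" "Poly_Mapping.keys m \<subseteq> I2 n"
    using Suc.IH by (auto simp: lattice_monomials_def)
  have "\<mu> = pmono (Poly_Mapping.single (i, j) 1 + m)"
    unfolding pmono_add One_nat_def pmono_single m(1)[symmetric] by (rule \<nu>)
  moreover have "Poly_Mapping.keys (Poly_Mapping.single (i, j) (1::nat) + m) \<subseteq> I2 n"
    using Poly_Mapping.keys_add[of "Poly_Mapping.single (i, j) 1" m] m i j by (auto simp: I2_def)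
  ultimately show ?case
    by (auto simp: lattice_monomials_def)
qed

lemma lattice_monomials_adeg:
  "{\<mu> \<in> lattice_monomials n. adeg \<mu> = k} = dominated n k k"
proof (intro equalityI subsetI)
  fix \<mu> assume "\<mu> \<in> {\<mu> \<in> lattice_monomials n. adeg \<mu> = k}"
  then show "\<mu> \<in> dominated n k k"
    using pmono_dominated by (auto simp: lattice_monomials_def adeg_pmono)
next
  fix \<mu> assume *: "\<mu> \<in> dominated n k k"
  then obtain m where m: "\<mu> = pmono m" "Poly_Mapping.keys m \<subseteq> I2 n"
    using dominated_imp_lattice_monomial[OF *] by (auto simp: lattice_monomials_def)
  then have "tdeg m = k"
    using pmono_dominated[OF m(2)] * by (auto simp: dominated_def)
  then show "\<mu> \<in> {\<mu> \<in> lattice_monomials n. adeg \<mu> = k}"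
    using m by (auto simp: lattice_monomials_def adeg_pmono)
qed

text \<open>
  \<open>dominated n p q\<close> is in bijection with the semistandard tableaux of the two-row shape \<open>(p, q)\<close> with
  entries in \<open>{1..n}\<close>: removing the entries \<open>n\<close> gives the branching rule.
\<close>

lemma dominated_branching:
  fixes n p q :: nat
  assumes "q \<le> p"
  defines "ins \<equiv> \<lambda>((p', q'), \<mu>). \<mu> + (Poly_Mapping.single (2 * Suc n) (p - p') + Poly_Mapping.single (2 * Suc n + 1) (q - q'))"
  shows "bij_betw ins (Sigma ({q..p} \<times> {..q}) (\<lambda>(p', q'). dominated n p' q')) (dominated (Suc n) p q)"
proof -
  define rem where "rem \<nu> = ((p - Poly_Mapping.lookup \<nu> (2 * Suc n), q - Poly_Mapping.lookup \<nu> (2 * Suc n + 1)),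
    \<nu> - (Poly_Mapping.single (2 * Suc n) (Poly_Mapping.lookup \<nu> (2 * Suc n)) +
      Poly_Mapping.single (2 * Suc n + 1) (Poly_Mapping.lookup \<nu> (2 * Suc n + 1))))" for \<nu> :: "nat \<Rightarrow>\<^sub>0 nat"
  have top: "Poly_Mapping.lookup \<mu> (2 * Suc n) = 0" "Poly_Mapping.lookup \<mu> (2 * Suc n + 1) = 0"
    if "\<mu> \<in> dominated n p' q'" for \<mu> p' q'
    using that by (auto simp: dominated_def in_keys_iff subset_iff)
  show ?thesis
  proof (rule bij_betw_byWitness[where f' = rem])
    show "\<forall>x\<in>Sigma ({q..p} \<times> {..q}) (\<lambda>(p', q'). dominated n p' q'). rem (ins x) = x"
    proof
      fix x assume "x \<in> Sigma ({q..p} \<times> {..q}) (\<lambda>(p', q'). dominated n p' q')"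
      then obtain p' q' \<mu> where x: "x = ((p', q'), \<mu>)" "q \<le> p'" "p' \<le> p" "q' \<le> q" "\<mu> \<in> dominated n p' q'"
        by auto
      have "Poly_Mapping.lookup (ins x) (2 * Suc n) = p - p'" "Poly_Mapping.lookup (ins x) (2 * Suc n + 1) = q - q'"
        using top[OF x(5)] by (simp_all add: ins_def x(1) lookup_add lookup_single when_def)
      then show "rem (ins x) = x"
        using x by (simp add: rem_def) (simp add: ins_def)
    qed
    show "\<forall>\<nu>\<in>dominated (Suc n) p q. ins (rem \<nu>) = \<nu>"
    proof
      fix \<nu> assume "\<nu> \<in> dominated (Suc n) p q"
      then have "Poly_Mapping.lookup \<nu> (2 * Suc n) \<le> p" "Poly_Mapping.lookup \<nu> (2 * Suc n + 1) \<le> q"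
        by (auto simp: dominated_def)
      then show "ins (rem \<nu>) = \<nu>"
        by (intro poly_mapping_eqI)
          (auto simp: ins_def rem_def lookup_add lookup_minus lookup_single when_def)
    qed
    show "ins ` Sigma ({q..p} \<times> {..q}) (\<lambda>(p', q'). dominated n p' q') \<subseteq> dominated (Suc n) p q"
    proof
      fix \<nu> assume "\<nu> \<in> ins ` Sigma ({q..p} \<times> {..q}) (\<lambda>(p', q'). dominated n p' q')"
      then obtain p' q' \<mu> where x: "\<nu> = ins ((p', q'), \<mu>)" "q \<le> p'" "p' \<le> p" "q' \<le> q" "\<mu> \<in> dominated n p' q'"
        by auto
      have low: "Poly_Mapping.lookup \<nu> (2 * i) = Poly_Mapping.lookup \<mu> (2 * i)"
        "Poly_Mapping.lookup \<nu> (2 * i + 1) = Poly_Mapping.lookup \<mu> (2 * i + 1)" if "i \<le> n" for i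
        using that by (auto simp: x(1) ins_def lookup_add lookup_single when_def)
      have high: "Poly_Mapping.lookup \<nu> (2 * Suc n) = p - p'" "Poly_Mapping.lookup \<nu> (2 * Suc n + 1) = q - q'"
        using top[OF x(5)] by (simp_all add: ins_def x(1) lookup_add lookup_single when_def)
      have "Poly_Mapping.keys \<nu> \<subseteq> Poly_Mapping.keys \<mu> \<union> {2 * Suc n, 2 * Suc n + 1}"
        by (auto simp: in_keys_iff x(1) ins_def lookup_add lookup_single when_def split: if_splits)
      then have keys: "Poly_Mapping.keys \<nu> \<subseteq> {2..2 * Suc n + 1}"
        using x(5) by (force simp: dominated_def)
      have sum1: "(\<Sum>i=1..<t. Poly_Mapping.lookup \<nu> (2 * i)) = (\<Sum>i=1..<t. Poly_Mapping.lookup \<mu> (2 * i))" if "t \<le> Suc n" for t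
        using that by (intro sum.cong) (auto simp: low)
      have sum2: "(\<Sum>i=1..t. Poly_Mapping.lookup \<nu> (2 * i + 1)) = (\<Sum>i=1..t. Poly_Mapping.lookup \<mu> (2 * i + 1))" if "t \<le> n" for t
        using that low(2) by (intro sum.cong) auto
      have a: "(\<Sum>i=1..Suc n. Poly_Mapping.lookup \<nu> (2 * i)) = p"
        using sum1[of "Suc n"] high x by (auto simp: dominated_def atLeastLessThanSuc_atLeastAtMost)
      have b: "(\<Sum>i=1..Suc n. Poly_Mapping.lookup \<nu> (2 * i + 1)) = q"
        using sum2[of n] high x by (auto simp: dominated_def)
      have "(\<Sum>j=1..t. Poly_Mapping.lookup \<nu> (2 * j + 1)) \<le> (\<Sum>i=1..<t. Poly_Mapping.lookup \<nu> (2 * i))"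
        if t: "t \<in> {1..Suc n}" for t
      proof (cases "t = Suc n")
        \<comment> \<open>At \<open>t = Suc n\<close> the condition reads \<open>q \<le> p'\<close>.
          This is the lower end of the range of \<open>p'\<close>; \<open>q'\<close> is bounded only
          from above.\<close>
        case True
        then show ?thesis
          using b sum1[of "Suc n"] x by (auto simp: dominated_def atLeastLessThanSuc_atLeastAtMost)
      next
        case False
        then show ?thesis
          using t sum1[of t] sum2[of t] x(5) by (auto simp: dominated_def)
      qed
      with keys a b show "\<nu> \<in> dominated (Suc n) p q"
        by (simp add: dominated_def)
    qed
    show "rem ` dominated (Suc n) p q \<subseteq> Sigma ({q..p} \<times> {..q}) (\<lambda>(p', q'). dominated n p' q')"
    proof
      fix x assume "x \<in> rem ` dominated (Suc n) p q"
      then obtain \<nu> where \<nu>: "\<nu> \<in> dominated (Suc n) p q" and x: "x = rem \<nu>"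
        by auto
      let ?\<mu> = "snd (rem \<nu>)"
      have low: "Poly_Mapping.lookup ?\<mu> (2 * i) = Poly_Mapping.lookup \<nu> (2 * i)"
        "Poly_Mapping.lookup ?\<mu> (2 * i + 1) = Poly_Mapping.lookup \<nu> (2 * i + 1)" if "i \<le> n" for i
        using that by (auto simp: rem_def lookup_add lookup_minus lookup_single when_def)
      have "Poly_Mapping.keys ?\<mu> \<subseteq> Poly_Mapping.keys \<nu> - {2 * Suc n, 2 * Suc n + 1}"
        by (auto simp: in_keys_iff rem_def lookup_add lookup_minus lookup_single when_def)
      also have "\<dots> \<subseteq> {2..2 * n + 1}"
        using \<nu> by (auto simp: dominated_def subset_iff)
      finally have keys: "Poly_Mapping.keys ?\<mu> \<subseteq> {2..2 * n + 1}" .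
      have sum1: "(\<Sum>i=1..<t. Poly_Mapping.lookup ?\<mu> (2 * i)) = (\<Sum>i=1..<t. Poly_Mapping.lookup \<nu> (2 * i))" if "t \<le> Suc n" for t
        using that by (intro sum.cong) (auto simp: low)
      have sum2: "(\<Sum>i=1..t. Poly_Mapping.lookup ?\<mu> (2 * i + 1)) = (\<Sum>i=1..t. Poly_Mapping.lookup \<nu> (2 * i + 1))" if "t \<le> n" for t
        using that low(2) by (intro sum.cong) auto
      have a: "(\<Sum>i=1..n. Poly_Mapping.lookup ?\<mu> (2 * i)) + Poly_Mapping.lookup \<nu> (2 * Suc n) = p"
        using sum1[of "Suc n"] \<nu> by (auto simp: dominated_def atLeastLessThanSuc_atLeastAtMost)
      have b: "(\<Sum>i=1..n. Poly_Mapping.lookup ?\<mu> (2 * i + 1)) + Poly_Mapping.lookup \<nu> (2 * Suc n + 1) = q"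
        using sum2[of n] \<nu> by (auto simp: dominated_def)
      have dom: "(\<Sum>j=1..t. Poly_Mapping.lookup \<nu> (2 * j + 1)) \<le> (\<Sum>i=1..<t. Poly_Mapping.lookup \<nu> (2 * i))"
        if "t \<in> {1..Suc n}" for t
        using \<nu> that unfolding dominated_def by blast
      have q: "q \<le> (\<Sum>i=1..n. Poly_Mapping.lookup ?\<mu> (2 * i))"
        using dom[of "Suc n"] sum1[of "Suc n"] \<nu> by (auto simp: dominated_def atLeastLessThanSuc_atLeastAtMost)
      have mem: "?\<mu> \<in> dominated n (\<Sum>i=1..n. Poly_Mapping.lookup ?\<mu> (2 * i)) (\<Sum>i=1..n. Poly_Mapping.lookup ?\<mu> (2 * i + 1))"
        using keys dom sum1 sum2 by (simp add: dominated_def)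
      have eq: "rem \<nu> = (((\<Sum>i=1..n. Poly_Mapping.lookup ?\<mu> (2 * i)), (\<Sum>i=1..n. Poly_Mapping.lookup ?\<mu> (2 * i + 1))), ?\<mu>)"
      proof -
        have "p - Poly_Mapping.lookup \<nu> (2 * Suc n) = (\<Sum>i=1..n. Poly_Mapping.lookup ?\<mu> (2 * i))"
          "q - Poly_Mapping.lookup \<nu> (2 * Suc n + 1) = (\<Sum>i=1..n. Poly_Mapping.lookup ?\<mu> (2 * i + 1))"
          using a b by linarith+
        then show ?thesis
          by (metis fst_conv prod.collapse rem_def)
      qed
      show "x \<in> Sigma ({q..p} \<times> {..q}) (\<lambda>(p', q'). dominated n p' q')"
        unfolding x by (subst eq, rule SigmaI) (use q mem a b in simp_all)
    qed
  qed
qed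

text \<open>The complete homogeneous symmetric polynomial h_k at n ones. The recursion fixes the
  degree in the first n variables; the last exponent is then determined.\<close>

primrec count_monomials :: "nat \<Rightarrow> nat \<Rightarrow> nat" where
  "count_monomials 0 k = (if k = 0 then 1 else 0)"
| "count_monomials (Suc n) k = (\<Sum>i\<le>k. count_monomials n i)"

lemma count_monomials_eq: "count_monomials (Suc n) k = (n + k) choose k"
proof (induction n arbitrary: k)
  case 0
  then show ?case by (simp add: sum.delta)
next
  case (Suc n)
  have "count_monomials (Suc (Suc n)) k = (\<Sum>i\<le>k. (n + i) choose i)"
    by (simp add: Suc.IH del: count_monomials.simps(2) add: count_monomials.simps(2)[of "Suc n"])
  also have "\<dots> = (n + k + 1) choose k"
    by (simp add: sum_choose_lower)
  finally show ?case by simp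
qed

text \<open>h_(k-1) with the convention that h_(-1) = 0. Truncated subtraction alone would give h_0
  = 1 at k = 0.\<close>

definition count_shift :: "nat \<Rightarrow> nat \<Rightarrow> nat" where
  "count_shift n k = (if k = 0 then 0 else count_monomials n (k - 1))"

text \<open>A Jacobi--Trudi determinant; it is preserved by the branching rule because the sums telescope.\<close>

lemma card_dominated:
  assumes "q \<le> p"
  shows "finite (dominated n p q)"
    and "int (card (dominated n p q)) =
      int (count_monomials n p) * int (count_monomials n q) - int (count_monomials n (Suc p)) * int (count_shift n q)"
proof -
  have "finite (dominated n p q) \<and> int (card (dominated n p q)) =
      int (count_monomials n p) * int (count_monomials n q) - int (count_monomials n (Suc p)) * int (count_shift n q)"
    using assms
  proof (induction n arbitrary: p q)
    case 0
    have "dominated 0 p q = (if p = 0 \<and> q = 0 then {0} else {})"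
      by (auto simp: dominated_def)
    then show ?case
      using 0 by (auto simp: count_shift_def)
  next
    case (Suc n)
    let ?h = "\<lambda>k. int (count_monomials n k)" and ?s = "\<lambda>k. int (count_shift n k)"
      and ?H = "\<lambda>k. int (count_monomials (Suc n) k)" and ?S = "\<lambda>k. int (count_shift (Suc n) k)"
    let ?I = "{q..p} \<times> {..q}"
    have fin: "finite (dominated n p' q')" and card: "int (card (dominated n p' q')) = ?h p' * ?h q' - ?h (Suc p') * ?s q'"
      if "p' \<in> {q..p}" "q' \<in> {..q}" for p' q'
      using Suc.IH[of q' p'] that by auto
    have *: "bij_betw (\<lambda>((p', q'), \<mu>). \<mu> + (Poly_Mapping.single (2 * Suc n) (p - p') + Poly_Mapping.single (2 * Suc n + 1) (q - q')))
        (Sigma ?I (\<lambda>(p', q'). dominated n p' q')) (dominated (Suc n) p q)"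
      by (rule dominated_branching[OF Suc.prems])
    have fin': "finite (Sigma ?I (\<lambda>(p', q'). dominated n p' q'))"
      using fin by (intro finite_SigmaI) auto
    have "int (card (dominated (Suc n) p q)) = int (card (Sigma ?I (\<lambda>(p', q'). dominated n p' q')))"
      using bij_betw_same_card[OF *] by simp
    also have "\<dots> = (\<Sum>(p', q')\<in>?I. int (card (dominated n p' q')))"
      using fin by (subst card_SigmaI) (auto simp: case_prod_beta)
    also have "\<dots> = (\<Sum>p'\<in>{q..p}. \<Sum>q'\<le>q. ?h p' * ?h q' - ?h (Suc p') * ?s q')"
      unfolding sum.cartesian_product[symmetric] by (intro sum.cong) (auto simp: card)
    also have "\<dots> = (\<Sum>p'\<in>{q..p}. ?h p') * (\<Sum>q'\<le>q. ?h q') - (\<Sum>p'\<in>{q..p}. ?h (Suc p')) * (\<Sum>q'\<le>q. ?s q')"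
      by (simp add: sum_subtractf sum_product)
    also have "(\<Sum>q'\<le>q. ?h q') = ?H q"
      by simp
    also have "(\<Sum>q'\<le>q. ?s q') = ?S q"
      by (cases q) (simp_all add: count_shift_def sum.atMost_Suc_shift del: sum.atMost_Suc)
    \<comment> \<open>The values for \<open>Suc n\<close> are partial sums of those for
      \<open>n\<close>, so a sum over an interval is a difference of two of them. The part below
      \<open>q\<close> ends at \<open>q - 1\<close>, hence the shifted count.\<close>
    also have "(\<Sum>p'\<in>{q..p}. ?h p') = ?H p - ?S q"
    proof -
      have "?H p = (\<Sum>k\<in>{..<q} \<union> {q..p}. ?h k)"
        using Suc.prems by (auto intro!: sum.cong)
      also have "\<dots> = (\<Sum>k<q. ?h k) + (\<Sum>k\<in>{q..p}. ?h k)"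
        by (rule sum.union_disjoint) auto
      also have "(\<Sum>k<q. ?h k) = ?S q"
        by (cases q) (simp_all add: count_shift_def lessThan_Suc_atMost)
      finally show ?thesis by simp
    qed
    also have "(\<Sum>p'\<in>{q..p}. ?h (Suc p')) = ?H (Suc p) - ?H q"
    proof -
      have "?H (Suc p) = (\<Sum>k\<in>{..q} \<union> {Suc q..Suc p}. ?h k)"
        unfolding count_monomials.simps of_nat_sum using Suc.prems by (intro sum.cong) auto
      also have "\<dots> = (\<Sum>k\<le>q. ?h k) + (\<Sum>k\<in>{Suc q..Suc p}. ?h k)"
        by (rule sum.union_disjoint) auto
      also have "(\<Sum>k\<in>{Suc q..Suc p}. ?h k) = (\<Sum>p'\<in>{q..p}. ?h (Suc p'))"
        by (rule sum.shift_bounds_cl_Suc_ivl)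
      finally show ?thesis by simp
    qed
    \<comment> \<open>The two correction terms \<open>?S q * ?H q\<close> cancel and leave the
      determinant for \<open>Suc n\<close>.\<close>
    also have "(?H p - ?S q) * ?H q - (?H (Suc p) - ?H q) * ?S q = ?H p * ?H q - ?H (Suc p) * ?S q"
      by (simp add: algebra_simps del: count_monomials.simps)
    finally show ?case
      using bij_betw_finite[OF *] fin' by blast
  qed
  then show "finite (dominated n p q)"
    and "int (card (dominated n p q)) =
      int (count_monomials n p) * int (count_monomials n q) - int (count_monomials n (Suc p)) * int (count_shift n q)"
    by auto
qed

text \<open>The hook content formula for the shape (k, k), as a polynomial in k. Each product has
  n-2 monic linear factors, whence degree 2n-4 and the leading coefficient.\<close>

definition hilbert_poly :: "nat \<Rightarrow> rat poly" where
  "hilbert_poly n = smult (1 / (fact (n - 1) * fact (n - 2)))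
     ((\<Prod>i\<in>{2..<n}. [:of_nat i, 1:]) * (\<Prod>i\<in>{1..<n - 1}. [:of_nat i, 1:]))"

lemma lead_coeff_hilbert_poly: "lead_coeff (hilbert_poly n) = 1 / (fact (n - 1) * fact (n - 2))"
  by (simp add: hilbert_poly_def lead_coeff_smult lead_coeff_mult lead_coeff_prod)

text \<open>For p = q = k the determinant is h_k^2 - h_(k+1) h_(k-1). Both neighbours of h_k are
  rational multiples of it, and (k+1)(k+n-1) - k(k+n) = n-1, so the determinant is (n-1) h_k^2
  divided by (k+1)(k+n-1). One factor h_k absorbs k+1 and leaves \<open>P\<close>, the other absorbs
  k+n-1 and leaves \<open>Q\<close>.\<close>

lemma card_lattice_monomials:
  assumes "n \<ge> 2"
  shows "finite {\<mu> \<in> lattice_monomials n. adeg \<mu> = k}"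
    and "of_nat (card {\<mu> \<in> lattice_monomials n. adeg \<mu> = k}) = poly (hilbert_poly n) (of_nat k)"
proof -
  show "finite {\<mu> \<in> lattice_monomials n. adeg \<mu> = k}"
    unfolding lattice_monomials_adeg by (rule card_dominated) simp
  obtain l where n: "n = Suc (Suc l)"
    using assms by (metis Suc_le_D numeral_2_eq_2 Suc_le_mono)
  define h :: "nat \<Rightarrow> rat" where "h k = of_nat (count_monomials n k)" for k
  define s :: rat where "s = of_nat (count_shift n k)"
  define P Q :: rat where "P = (\<Prod>i\<in>{2..<n}. of_nat i + of_nat k)" and "Q = (\<Prod>i\<in>{1..<n - 1}. of_nat i + of_nat k)"
  have h_eq: "h k = of_nat ((Suc l + k) choose k)" for k
    by (simp only: h_def n count_monomials_eq)
  have fact_h: "fact (Suc l) * h k = (\<Prod>i\<in>{1..<n}. of_nat i + of_nat k)"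
  proof -
    have "(\<Prod>i\<in>{1..j}. of_nat i + of_nat k :: rat) * fact k = fact (j + k)" for j
    proof (induction j)
      case (Suc j)
      show ?case by (simp add: algebra_simps flip: Suc)
    qed simp
    from this[of "Suc l"] have "(\<Prod>i\<in>{1..<n}. of_nat i + of_nat k :: rat) * fact k = fact (Suc l + k)"
      by (simp only: n atLeastLessThanSuc_atLeastAtMost)
    moreover have "h k = fact (Suc l + k) / (fact k * fact (Suc l))"
      unfolding h_eq by (subst binomial_fact) (simp_all del: fact_Suc)
    ultimately have "fact k * (fact (Suc l) * h k) = fact k * (\<Prod>i\<in>{1..<n}. of_nat i + of_nat k)"
      by (simp add: field_simps del: fact_Suc)
    then show ?thesis
      by (simp del: fact_Suc)
  qed
  have PQ: "fact (Suc l) * h k = (of_nat k + 1) * P" "fact (Suc l) * h k = (of_nat k + of_nat n - 1) * Q"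
  proof -
    have 1: "{1..<n} = insert 1 {2..<n}" and 2: "{1..<n} = insert (n - 1) {1..<n - 1}"
      using assms by auto
    have "(\<Prod>i\<in>{1..<n}. of_nat i + of_nat k :: rat) = (of_nat 1 + of_nat k) * P"
      unfolding 1 P_def by simp
    moreover have "(\<Prod>i\<in>{1..<n}. of_nat i + of_nat k :: rat) = (of_nat (n - 1) + of_nat k) * Q"
      unfolding 2 Q_def by simp
    ultimately show "fact (Suc l) * h k = (of_nat k + 1) * P" "fact (Suc l) * h k = (of_nat k + of_nat n - 1) * Q"
      using fact_h assms by (simp_all add: of_nat_diff algebra_simps del: fact_Suc)
  qed
  have h1: "(of_nat k + 1) * h (Suc k) = (of_nat k + of_nat n) * h k" for k
  proof -
    have "Suc k * ((Suc l + Suc k) choose Suc k) = (Suc l + Suc k) * ((Suc l + k) choose k)"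
      using Suc_times_binomial_eq[of "Suc l + k" k] by (simp add: mult.commute)
    from arg_cong[OF this, of "of_nat :: nat \<Rightarrow> rat"] show ?thesis
      unfolding h_eq n by (simp add: algebra_simps del: binomial_Suc_Suc)
  qed
  \<comment> \<open>\<open>s\<close> is h_(k-1), so this is the previous ratio at
    \<open>k - 1\<close>. For k = 0 both sides vanish by the convention for h_(-1).\<close>
  have s1: "(of_nat k + of_nat n - 1) * s = of_nat k * h k"
    using h1[of "k - 1"] by (cases k) (simp_all add: s_def h_def count_shift_def algebra_simps del: count_monomials.simps)
  have ne: "(of_nat k + 1 :: rat) \<noteq> 0" "(of_nat k + of_nat n - 1 :: rat) \<noteq> 0"
    using assms by (simp_all add: n add_pos_nonneg add_eq_0_iff)
  have "rat_of_int (int (card {\<mu> \<in> lattice_monomials n. adeg \<mu> = k})) = h k * h k - h (Suc k) * s"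
    unfolding lattice_monomials_adeg card_dominated(2)[OF order_refl] by (simp add: h_def s_def)
  then have "of_nat (card {\<mu> \<in> lattice_monomials n. adeg \<mu> = k}) = h k * h k - h (Suc k) * s"
    by simp
  also have "\<dots> = P * Q / (fact (Suc l) * fact l)"
  proof -
    let ?k = "of_nat k :: rat" and ?n = "of_nat n :: rat"
    have "(?k + 1) * (?k + ?n - 1) * (h k * h k - h (Suc k) * s) =
      (?k + 1) * (?k + ?n - 1) * (h k * h k) - ((?k + 1) * h (Suc k)) * ((?k + ?n - 1) * s)"
      by (simp add: algebra_simps)
    also have "\<dots> = (?n - 1) * (h k * h k)"
      unfolding h1 s1 by (simp add: algebra_simps)
    finally have "fact (Suc l) * fact (Suc l) * ((?k + 1) * (?k + ?n - 1) * (h k * h k - h (Suc k) * s)) =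
      (?n - 1) * ((fact (Suc l) * h k) * (fact (Suc l) * h k))"
      by (simp del: fact_Suc)
    also have "\<dots> = (?n - 1) * (((?k + 1) * P) * ((?k + ?n - 1) * Q))"
      using PQ by simp
    also have "\<dots> = (?k + 1) * (?k + ?n - 1) * ((?n - 1) * (P * Q))"
      by (simp add: algebra_simps)
    finally have "fact (Suc l) * (fact (Suc l) * (h k * h k - h (Suc k) * s)) = (?n - 1) * (P * Q)"
      using ne by (simp del: fact_Suc)
    moreover have "fact (Suc l) = (?n - 1) * fact l"
      by (simp add: n)
    ultimately have "(?n - 1) * (fact l * (fact (Suc l) * (h k * h k - h (Suc k) * s))) = (?n - 1) * (P * Q)"
      by (metis mult.assoc)
    moreover have "?n - 1 \<noteq> 0"
      unfolding n by (simp add: add_eq_0_iff)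
    ultimately have "fact l * (fact (Suc l) * (h k * h k - h (Suc k) * s)) = P * Q"
      by (metis mult_left_cancel)
    then show ?thesis
      by (simp add: eq_divide_eq mult_ac del: fact_Suc)
  qed
  also have "\<dots> = P * Q / (fact (n - 1) * fact (n - 2))"
    by (simp add: n del: fact_Suc)
  also have "\<dots> = poly (hilbert_poly n) (of_nat k)"
    by (simp add: hilbert_poly_def poly_prod P_def Q_def)
  finally show "of_nat (card {\<mu> \<in> lattice_monomials n. adeg \<mu> = k}) = poly (hilbert_poly n) (of_nat k)" .
qed

text \<open>With l = n-2 both sides are 1 / ((l+1)! l!), since the binomial coefficient is (2l)! /
  (l! l!).\<close>

lemma catalan_lead_coeff:
  assumes "n \<ge> 2"
  shows "1 / (fact (n - 1) * fact (n - 2)) =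
    (1 / of_nat (n - 1) * of_nat ((2 * n - 4) choose (n - 2)) :: rat) / fact (2 * n - 4)"
proof -
  obtain l where n: "n = Suc (Suc l)"
    using assms by (metis Suc_le_D numeral_2_eq_2 Suc_le_mono)
  have "of_nat ((2 * l) choose l) = (fact (2 * l) / (fact l * fact l) :: rat)"
    by (subst binomial_fact) simp_all
  moreover have "2 * n - 4 = 2 * l" "n - 1 = Suc l" "n - 2 = l"
    by (simp_all add: n)
  ultimately show ?thesis
    by simp
qed


section \<open>Graded monoid algebras and their Krull dimension\<close>

text \<open>Bridges two worlds: calculations take place in a type-class ring, while primes,
  dimensions and quotients refer to ring records.\<close>

definition class_ring :: "'a::comm_ring_1 set \<Rightarrow> 'a ring" where
  "class_ring B = \<lparr>carrier = B, monoid.mult = (*), one = 1, zero = 0, add = (+)\<rparr>"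

lemma class_ring_simps [simp]:
  "carrier (class_ring B) = B" "x \<otimes>\<^bsub>class_ring B\<^esub> y = x * y" "\<one>\<^bsub>class_ring B\<^esub> = 1"
  "\<zero>\<^bsub>class_ring B\<^esub> = 0" "x \<oplus>\<^bsub>class_ring B\<^esub> y = x + y"
  by (simp_all add: class_ring_def)

lemma cring_embedding:
  fixes R (structure) and h :: "'a \<Rightarrow> 'c::comm_ring_1"
  assumes inj: "inj_on h (carrier R)"
    and closed: "\<And>x y. x \<in> carrier R \<Longrightarrow> y \<in> carrier R \<Longrightarrow> x \<oplus> y \<in> carrier R"
      "\<And>x y. x \<in> carrier R \<Longrightarrow> y \<in> carrier R \<Longrightarrow> x \<otimes> y \<in> carrier R" "\<zero> \<in> carrier R" "\<one> \<in> carrier R"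
    and neg: "\<And>x. x \<in> carrier R \<Longrightarrow> \<exists>y\<in>carrier R. h y = - h x"
    and hom: "\<And>x y. x \<in> carrier R \<Longrightarrow> y \<in> carrier R \<Longrightarrow> h (x \<oplus> y) = h x + h y"
      "\<And>x y. x \<in> carrier R \<Longrightarrow> y \<in> carrier R \<Longrightarrow> h (x \<otimes> y) = h x * h y" "h \<zero> = 0" "h \<one> = 1"
  shows "cring R"
proof (rule cringI)
  show "abelian_group R"
  proof (rule abelian_groupI)
    fix x assume x: "x \<in> carrier R"
    then obtain y where "y \<in> carrier R" "h y = - h x"
      using neg by blast
    then show "\<exists>y\<in>carrier R. y \<oplus> x = \<zero>"
      using x by (intro bexI[of _ y] inj_onD[OF inj]) (auto simp: closed hom)
  qed (rule inj_onD[OF inj]; simp add: closed hom algebra_simps; fail | simp add: closed)+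
  show "comm_monoid R"
    by (rule comm_monoidI) (rule inj_onD[OF inj]; simp add: closed hom algebra_simps; fail | simp add: closed)+
qed (rule inj_onD[OF inj]; simp add: closed hom algebra_simps)

lemma cring_class_ring:
  assumes "0 \<in> B" "1 \<in> B" "\<And>x y. x \<in> B \<Longrightarrow> y \<in> B \<Longrightarrow> x + y \<in> B" "\<And>x y. x \<in> B \<Longrightarrow> y \<in> B \<Longrightarrow> x * y \<in> B"
    "\<And>x. x \<in> B \<Longrightarrow> - x \<in> B"
  shows "cring (class_ring B)"
  by (rule cring_embedding[where h = "\<lambda>x. x"]) (use assms in auto)

lemma krull_dim_le_iso:
  assumes "cring R" "cring S" "\<phi> \<in> ring_iso R S"
  shows "krull_dim S \<le> krull_dim R"
  unfolding krull_dim_def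
proof (rule Sup_subset_mono, safe)
  fix l P assume P: "\<forall>i\<le>l. primeideal (P i) S" "\<forall>i<l. P i \<subset> P (Suc i)"
  interpret R: cring R by fact
  interpret S: cring S by fact
  interpret \<phi>: ring_hom_ring R S \<phi>
    using assms(3) by (intro ring_hom_ringI2 R.ring_axioms S.ring_axioms) (simp add: ring_iso_def)
  define Q where "Q i = {r \<in> carrier R. \<phi> r \<in> P i}" for i
  have surj: "\<exists>r\<in>carrier R. s = \<phi> r" if "s \<in> carrier S" for s
    using that assms(3) by (auto simp: ring_iso_def bij_betw_def)
  have sub: "P i \<subseteq> carrier S" if "i \<le> l" for i
    using P that by (meson additive_subgroup.a_subset ideal.axioms(1) primeideal.axioms(1))
  have "Q i \<subset> Q (Suc i)" if i: "i < l" for i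
  proof -
    obtain s where s: "s \<in> P (Suc i)" "s \<notin> P i"
      using P i by blast
    obtain r where "r \<in> carrier R" "s = \<phi> r"
      using surj sub[of "Suc i"] s i by auto
    then have "r \<in> Q (Suc i)" "r \<notin> Q i"
      using s by (auto simp: Q_def)
    moreover have "Q i \<subseteq> Q (Suc i)"
      using P i by (auto simp: Q_def)
    ultimately show ?thesis by blast
  qed
  moreover have "primeideal (Q i) R" if "i \<le> l" for i
    unfolding Q_def using P that by (intro \<phi>.primeideal_vimage assms(1)) auto
  ultimately show "\<exists>l'. enat l = enat l' \<and> (\<exists>P. (\<forall>i\<le>l'. primeideal (P i) R) \<and> (\<forall>i<l'. P i \<subset> P (Suc i)))"
    by blast
qed

lemma krull_dim_iso:
  assumes "cring R" "cring S" "\<phi> \<in> ring_iso R S"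
  shows "krull_dim S = krull_dim R"
  by (rule antisym[OF krull_dim_le_iso[OF assms]
        krull_dim_le_iso[OF assms(2,1) ring_iso_set_sym[OF cring.axioms(1)[OF assms(1)] assms(3)]]])

text \<open>The degree is a definite description, so uniqueness is part of the claim: the Krull
  dimension fixes \<open>r\<close>, vector space dimensions are unique, and polynomials that agree
  at almost all naturals are equal. The isomorphism lets all data be computed in the simpler ring
  \<open>R\<close>.\<close>

lemma graded_degree_eqI:
  assumes R: "cring R" and G: "cring G" and iso: "\<phi> \<in> ring_iso R G"
    and K: "subfield (H 0) R" and sub: "\<And>k. H k \<subseteq> carrier R" and H': "\<And>k. H' k = \<phi> ` H k"
    and krull: "krull_dim R = enat (r + 1)"
    and dim: "\<And>k. ring.dimension R (D k) (H 0) (H k)"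
    and p: "\<And>k. poly p (of_nat k) = of_nat (D k)" and lead: "lead_coeff p = e / fact r"
  shows "graded_degree G H' = e"
proof -
  interpret R: cring R by fact
  interpret G: cring G by fact
  interpret \<phi>: ring_hom_ring R G \<phi>
    using iso by (intro ring_hom_ringI2 R.ring_axioms G.ring_axioms) (simp add: ring_iso_def)
  have inj: "inj_on \<phi> (carrier R)"
    using iso by (auto simp: ring_iso_def bij_betw_def)
  have ne: "\<one>\<^bsub>G\<^esub> \<noteq> \<zero>\<^bsub>G\<^esub>"
    using subfieldE(6)[OF K] inj by (metis R.one_closed R.zero_closed \<phi>.hom_one \<phi>.hom_zero inj_onD)
  have K': "subfield (H' 0) G"
    unfolding H' by (rule \<phi>.img_is_subfield(2)[OF K ne])
  have dim': "G.dimension (D k) (H' 0) (H' k)" for k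
    unfolding H' using inj_on_subset[OF inj sub] dim by (intro \<phi>.inj_hom_dimension[OF K ne])
  have krull': "krull_dim G = enat (r + 1)"
    using krull_dim_iso[OF R G iso] krull by simp
  have "is_hilbert_poly G H' p"
    unfolding is_hilbert_poly_def using dim' p by (intro always_eventually) blast
  with krull' lead have "has_graded_degree G H' e"
    unfolding has_graded_degree_def by blast
  moreover have "e' = e" if e': "has_graded_degree G H' e'" for e'
  proof -
    obtain r' q where q: "krull_dim G = enat (r' + 1)" "is_hilbert_poly G H' q" "lead_coeff q = e' / fact r'"
      using e' unfolding has_graded_degree_def by blast
    have "\<forall>\<^sub>F k in sequentially. poly q (of_nat k) = poly p (of_nat k)"
      using q(2) unfolding is_hilbert_poly_def
      by eventually_elim (metis G.dimension_is_inj[OF K'] dim' p)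
    then obtain N where N: "poly q (of_nat k) = poly p (of_nat k)" if "k \<ge> N" for k
      by (auto simp: eventually_sequentially)
    have "infinite ((of_nat :: nat \<Rightarrow> rat) ` {N..})"
      by (subst finite_image_iff) (auto simp: inj_on_def infinite_Ici)
    moreover have "(of_nat :: nat \<Rightarrow> rat) ` {N..} \<subseteq> {x. poly (q - p) x = 0}"
      using N by auto
    ultimately have "q - p = 0"
      using poly_roots_finite[of "q - p"] by (metis finite_subset)
    then show "e' = e"
      using q krull' lead by simp
  qed
  ultimately show ?thesis
    unfolding graded_degree_def by (rule the_equality)
qed

section \<open>Monoid algebras, their graded pieces and their monomial primes\<close>

definition restr :: "'m set \<Rightarrow> ('m \<Rightarrow>\<^sub>0 'k::comm_monoid_add) \<Rightarrow> ('m \<Rightarrow>\<^sub>0 'k)" where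
  "restr F f = (\<Sum>m\<in>Poly_Mapping.keys f \<inter> F. Poly_Mapping.single m (Poly_Mapping.lookup f m))"

lemma lookup_restr: "Poly_Mapping.lookup (restr F f) m = (if m \<in> F then Poly_Mapping.lookup f m else 0)"
  by (auto simp: restr_def lookup_sum lookup_single when_def in_keys_iff)

lemma keys_restr: "Poly_Mapping.keys (restr F f) = Poly_Mapping.keys f \<inter> F"
  by (auto simp: in_keys_iff lookup_restr split: if_splits)

lemma restr_split: "f = restr F f + restr (- F) f"
  by (rule poly_mapping_eqI) (simp add: lookup_add lookup_restr)

text \<open>\<open>M\<close> may be any set of monomials. Thus graded pieces, ideals spanned by
  monomials and the algebra itself all have this form and share the closure lemmas.\<close>

definition monoid_alg :: "'m set \<Rightarrow> ('m \<Rightarrow>\<^sub>0 'k::comm_ring_1) set" where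
  "monoid_alg M = {f. Poly_Mapping.keys f \<subseteq> M}"

lemma monoid_alg_add: "f \<in> monoid_alg M \<Longrightarrow> g \<in> monoid_alg M \<Longrightarrow> f + g \<in> monoid_alg M"
  using Poly_Mapping.keys_add[of f g] by (auto simp: monoid_alg_def)

lemma monoid_alg_uminus: "f \<in> monoid_alg M \<Longrightarrow> - f \<in> monoid_alg M"
  by (auto simp: monoid_alg_def in_keys_iff)

lemma monoid_alg_diff: "f \<in> monoid_alg M \<Longrightarrow> g \<in> monoid_alg M \<Longrightarrow> f - g \<in> monoid_alg M"
  using monoid_alg_add[of f M "- g"] monoid_alg_uminus[of g M] by simp

lemma monoid_alg_zero: "0 \<in> monoid_alg M"
  by (simp add: monoid_alg_def)

lemma monoid_alg_sum: "(\<And>i. i \<in> I \<Longrightarrow> f i \<in> monoid_alg M) \<Longrightarrow> (\<Sum>i\<in>I. f i) \<in> monoid_alg M"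
  by (induction I rule: infinite_finite_induct) (auto simp: monoid_alg_zero monoid_alg_add)

lemma monoid_alg_single: "m \<in> M \<Longrightarrow> Poly_Mapping.single m c \<in> monoid_alg M"
  by (auto simp: monoid_alg_def)

lemma monoid_alg_restr: "f \<in> monoid_alg M \<Longrightarrow> restr F f \<in> monoid_alg M"
  by (auto simp: monoid_alg_def keys_restr)

lemma monoid_alg_mono: "M \<subseteq> N \<Longrightarrow> monoid_alg M \<subseteq> monoid_alg N"
  by (auto simp: monoid_alg_def)

lemma monoid_alg_mult:
  fixes f g :: "'m::monoid_add \<Rightarrow>\<^sub>0 'k::comm_ring_1"
  assumes "f \<in> monoid_alg A" "g \<in> monoid_alg B" "\<And>a b. a \<in> A \<Longrightarrow> b \<in> B \<Longrightarrow> a + b \<in> C"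
  shows "f * g \<in> monoid_alg C"
  unfolding monoid_alg_def
proof safe
  fix x assume "x \<in> Poly_Mapping.keys (f * g)"
  then obtain a b where "x = a + b" "a \<in> Poly_Mapping.keys f" "b \<in> Poly_Mapping.keys g"
    using Poly_Mapping.keys_mult[of f g] by blast
  with assms show "x \<in> C"
    by (auto simp: monoid_alg_def)
qed

text \<open>The order on the type of monomials makes the polynomials an integral domain.
  \<open>d_eq_0\<close> reduces degree 0 to the constants, and \<open>split\<close>, applied
  repeatedly, is generation in degree 1.\<close>

locale graded_monoid =
  fixes M :: "'m::{ordered_cancel_comm_monoid_add, linorder} set" and d :: "'m \<Rightarrow> nat"
  assumes zero_mem: "0 \<in> M" and add_mem: "a \<in> M \<Longrightarrow> b \<in> M \<Longrightarrow> a + b \<in> M"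
    and d_add: "d (a + b) = d a + d b"
    and d_eq_0: "a \<in> M \<Longrightarrow> d a = 0 \<Longrightarrow> a = 0"
    and split: "a \<in> M \<Longrightarrow> d a = Suc k \<Longrightarrow> \<exists>b\<in>M. \<exists>c\<in>M. d b = k \<and> d c = 1 \<and> a = b + c"
    and finite_deg: "finite {a \<in> M. d a = k}"
begin

lemma d_zero [simp]: "d 0 = 0"
  using d_add[of 0 0] by simp

lemma deg_0: "{a \<in> M. d a = 0} = {0}"
  using zero_mem d_eq_0 by auto

definition homog :: "nat \<Rightarrow> ('m \<Rightarrow>\<^sub>0 'k::field) set" where
  "homog k = monoid_alg {a \<in> M. d a = k}"

lemma one_mem: "1 \<in> monoid_alg M"
  using zero_mem monoid_alg_single[of 0 M 1] by simp

lemma mult_mem: "f \<in> monoid_alg M \<Longrightarrow> g \<in> monoid_alg M \<Longrightarrow> f * g \<in> monoid_alg M"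
  by (rule monoid_alg_mult[where A = M and B = M]) (auto intro: add_mem)

lemma power_mem: "f \<in> monoid_alg M \<Longrightarrow> f ^ k \<in> monoid_alg M"
  by (induction k) (auto simp: one_mem mult_mem)

lemma cring: "cring (class_ring (monoid_alg M :: ('m \<Rightarrow>\<^sub>0 'k::field) set))"
  by (rule cring_class_ring)
    (auto intro: monoid_alg_zero one_mem monoid_alg_add mult_mem monoid_alg_uminus)

lemma homog_0: "homog 0 = range (Poly_Mapping.single 0)"
proof (intro equalityI subsetI)
  fix f :: "'m \<Rightarrow>\<^sub>0 'k::field" assume "f \<in> homog 0"
  then have "Poly_Mapping.keys f \<subseteq> {0}"
    unfolding homog_def deg_0 monoid_alg_def by simp
  then have "f = Poly_Mapping.single 0 (Poly_Mapping.lookup f 0)"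
    by (intro poly_mapping_eqI) (auto simp: lookup_single when_def in_keys_iff)
  then show "f \<in> range (Poly_Mapping.single 0)"
    by (rule range_eqI)
qed (unfold homog_def deg_0, auto intro: monoid_alg_single)

lemma subfield_homog_0: "subfield (homog 0) (class_ring (monoid_alg M :: ('m \<Rightarrow>\<^sub>0 'k::field) set))"
proof -
  let ?R = "class_ring (monoid_alg M :: ('m \<Rightarrow>\<^sub>0 'k) set)" and ?K = "homog 0 :: ('m \<Rightarrow>\<^sub>0 'k) set"
  interpret R: cring ?R by (rule cring)
  have K: "cring (class_ring ?K)"
  proof (rule cring_class_ring)
    show "1 \<in> ?K"
      unfolding homog_0 by (metis rangeI single_one)
    show "0 \<in> ?K"
      unfolding homog_0 by (metis rangeI single_zero)
  qed (auto simp: homog_0 mult_single simp flip: single_add single_uminus)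
  have eq: "?R\<lparr>carrier := ?K\<rparr> = class_ring ?K"
    by (simp add: class_ring_def)
  have "field (class_ring ?K)"
  proof (rule cring.cring_fieldI2[OF K])
    show "\<zero>\<^bsub>class_ring ?K\<^esub> \<noteq> \<one>\<^bsub>class_ring ?K\<^esub>"
      by simp
    fix a assume "a \<in> carrier (class_ring ?K)" "a \<noteq> \<zero>\<^bsub>class_ring ?K\<^esub>"
    then obtain c where "a = Poly_Mapping.single 0 c" "c \<noteq> 0"
      by (auto simp: homog_0) (metis single_zero)
    then show "\<exists>b\<in>carrier (class_ring ?K). a \<otimes>\<^bsub>class_ring ?K\<^esub> b = \<one>\<^bsub>class_ring ?K\<^esub>"
      by (intro bexI[of _ "Poly_Mapping.single 0 (1 / c)"]) (auto simp: homog_0 mult_single)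
  qed
  then show ?thesis
    by (intro R.subfield_iff(1)) (simp only: eq, auto simp: homog_def monoid_alg_def)
qed

text \<open>The monomials are adjoined one at a time; each is a new line outside the span of the
  previous ones and raises the dimension by one.\<close>

lemma dimension_homog:
  "ring.dimension (class_ring (monoid_alg M :: ('m \<Rightarrow>\<^sub>0 'k::field) set)) (card {a \<in> M. d a = k}) (homog 0) (homog k)"
proof -
  let ?R = "class_ring (monoid_alg M :: ('m \<Rightarrow>\<^sub>0 'k) set)" and ?K = "homog 0 :: ('m \<Rightarrow>\<^sub>0 'k) set"
  interpret R: cring ?R by (rule cring)
  have "R.dimension (card S) ?K (monoid_alg S)" if "finite S" "S \<subseteq> M" for S
    using that
  proof (induction S rule: finite_induct)
    case empty
    have "monoid_alg {} = {0 :: 'm \<Rightarrow>\<^sub>0 'k}"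
      by (auto simp: monoid_alg_def)
    then show ?case
      using R.zero_dim[of ?K] by simp
  next
    case (insert m S)
    let ?v = "Poly_Mapping.single m 1 :: 'm \<Rightarrow>\<^sub>0 'k"
    have "monoid_alg (insert m S) = R.line_extension ?K ?v (monoid_alg S)"
    proof (intro equalityI subsetI)
      fix f :: "'m \<Rightarrow>\<^sub>0 'k" assume f: "f \<in> monoid_alg (insert m S)"
      let ?c = "Poly_Mapping.lookup f m"
      have "f = Poly_Mapping.single 0 ?c \<otimes>\<^bsub>?R\<^esub> ?v \<oplus>\<^bsub>?R\<^esub> restr S f"
        using f insert.hyps(2)
        by (intro poly_mapping_eqI)
          (auto simp: mult_single lookup_add lookup_restr lookup_single when_def monoid_alg_def in_keys_iff)
      moreover have "restr S f \<in> monoid_alg S"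
        by (auto simp: monoid_alg_def keys_restr)
      ultimately show "f \<in> R.line_extension ?K ?v (monoid_alg S)"
        unfolding R.line_extension_mem_iff homog_0 by blast
    next
      fix f assume "f \<in> R.line_extension ?K ?v (monoid_alg S)"
      then obtain c g where "g \<in> monoid_alg S" "f = Poly_Mapping.single 0 c * ?v + g"
        unfolding R.line_extension_mem_iff homog_0 by auto
      then show "f \<in> monoid_alg (insert m S)"
        using monoid_alg_mono[of S "insert m S"]
        by (auto simp: mult_single intro!: monoid_alg_add monoid_alg_single)
    qed
    moreover have "R.dimension (Suc (card S)) ?K (R.line_extension ?K ?v (monoid_alg S))"
      using insert by (intro R.Suc_dim) (auto intro: monoid_alg_single simp: monoid_alg_def)
    ultimately show ?case
      using insert by simp
  qed
  from this[of "{a \<in> M. d a = k}"] show ?thesis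
    using finite_deg by (simp add: homog_def)
qed

text \<open>The quotient is the monoid algebra of the face, a domain. Concretely, modulo the ideal
  the product \<open>f * g\<close> is the product of the parts of \<open>f\<close> and
  \<open>g\<close> on the face. If \<open>f * g\<close> is in the ideal, that product is supported
  both on and off the face, so it is zero and one of the parts is zero.\<close>

lemma primeideal_face:
  assumes face: "\<And>a b. a \<in> M \<Longrightarrow> b \<in> M \<Longrightarrow> a + b \<in> F \<longleftrightarrow> a \<in> F \<and> b \<in> F" and 0: "0 \<in> F"
  shows "primeideal (monoid_alg (M - F)) (class_ring (monoid_alg M :: ('m \<Rightarrow>\<^sub>0 'k::field) set))"
    (is "primeideal ?P ?R")
proof (rule primeidealI)
  interpret R: cring ?R by (rule cring)
  have mult: "x * a \<in> ?P" if "a \<in> ?P" "x \<in> monoid_alg M" for a x :: "'m \<Rightarrow>\<^sub>0 'k"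
    using that(2,1) by (rule monoid_alg_mult) (auto simp: face add_mem)
  have sub: "?P \<subseteq> monoid_alg M"
    by (rule monoid_alg_mono) auto
  show "ideal ?P ?R"
  proof (rule idealI)
    show "ring ?R" by (rule R.ring_axioms)
    show "subgroup ?P (add_monoid ?R)"
    proof (rule subgroup.intro)
      fix x assume x: "x \<in> ?P"
      then have "\<ominus>\<^bsub>?R\<^esub> x = - x"
        using sub by (intro R.minus_equality) (auto intro: monoid_alg_uminus)
      then show "inv\<^bsub>add_monoid ?R\<^esub> x \<in> ?P"
        using x unfolding a_inv_def by (simp add: monoid_alg_uminus)
    qed (use sub in \<open>auto intro: monoid_alg_add monoid_alg_zero\<close>)
  qed (use mult in \<open>auto simp: mult.commute\<close>)
  show "cring ?R" by (rule cring)
  have "1 \<in> monoid_alg M - ?P"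
    using one_mem 0 by (auto simp: monoid_alg_def)
  then show "carrier ?R \<noteq> ?P"
    by auto
  fix f g assume "f \<in> carrier ?R" "g \<in> carrier ?R" and fg: "f \<otimes>\<^bsub>?R\<^esub> g \<in> ?P"
  then have f: "f \<in> monoid_alg M" and g: "g \<in> monoid_alg M"
    by auto
  have N: "restr (- F) h \<in> ?P" if "h \<in> monoid_alg M" for h :: "'m \<Rightarrow>\<^sub>0 'k"
    using that by (auto simp: monoid_alg_def keys_restr)
  have "f * g = restr F f * g + g * restr (- F) f"
    using restr_split[of f F] by (metis distrib_right mult.commute)
  moreover have "restr F f * g = restr F f * restr F g + restr F f * restr (- F) g"
    using restr_split[of g F] by (metis distrib_left)
  ultimately have "restr F f * restr F g = f * g - (g * restr (- F) f + restr F f * restr (- F) g)"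
    by simp
  moreover have "g * restr (- F) f \<in> ?P" "restr F f * restr (- F) g \<in> ?P"
    using f g by (intro mult N monoid_alg_restr; simp)+
  then have "f * g - (g * restr (- F) f + restr F f * restr (- F) g) \<in> ?P"
    using fg by (intro monoid_alg_diff monoid_alg_add) auto
  moreover have "restr F f * restr F g \<in> monoid_alg (M \<inter> F)"
    by (rule monoid_alg_mult[where A = "M \<inter> F" and B = "M \<inter> F"])
      (use f g in \<open>auto simp: monoid_alg_def keys_restr face add_mem\<close>)
  ultimately have "restr F f * restr F g \<in> ?P" "restr F f * restr F g \<in> monoid_alg (M \<inter> F)"
    by simp_all
  then have "restr F f * restr F g \<in> monoid_alg {}"
    unfolding monoid_alg_def by blast
  then have "restr F f = 0 \<or> restr F g = 0"
    by (simp add: monoid_alg_def)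
  then have "Poly_Mapping.keys f \<inter> F = {} \<or> Poly_Mapping.keys g \<inter> F = {}"
    using keys_restr[of F f] keys_restr[of F g] by auto
  then show "f \<in> ?P \<or> g \<in> ?P"
    using f g by (auto simp: monoid_alg_def)
qed

end

section \<open>The upper bound for the Krull dimension\<close>

definition power_prod :: "'a::comm_monoid_mult list \<Rightarrow> nat list \<Rightarrow> 'a" where
  "power_prod fs as = prod_list (map2 (^) fs as)"

lemma power_prod_simps [simp]:
  "power_prod [] as = 1" "power_prod (f # fs) (a # as) = f ^ a * power_prod fs as"
  by (simp_all add: power_prod_def)

text \<open>Each exponent is bounded separately, not their sum: the number of lists is then exactly
  \<open>(N + 1) ^ l\<close>, and the first exponent splits off as a product.\<close>

definition exponents :: "nat \<Rightarrow> nat \<Rightarrow> nat list set" where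
  "exponents l N = {as. set as \<subseteq> {..N} \<and> length as = l}"

lemma finite_exponents: "finite (exponents l N)"
  unfolding exponents_def by (rule finite_lists_length_eq) simp

lemma card_exponents: "card (exponents l N) = (N + 1) ^ l"
  unfolding exponents_def by (subst card_lists_length_eq) simp_all

lemma exponents_0: "exponents 0 N = {[]}"
  by (auto simp: exponents_def)

lemma exponents_Suc: "exponents (Suc l) N = (\<lambda>(a, as). a # as) ` ({..N} \<times> exponents l N)"
  by (auto simp: exponents_def length_Suc_conv image_iff)

context graded_monoid
begin

text \<open>
  Elements \<open>f\<^sub>i \<in> P\<^sub>i - P\<^sub>i\<^sub>-\<^sub>1\<close> along a chain of primes are algebraically independent modulo \<open>P\<^sub>0\<close>: take
  the coefficients of a relation as a polynomial in \<open>f\<^sub>1\<close>; the constant term lies in \<open>P\<^sub>1\<close>, so it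
  vanishes by induction, and \<open>f\<^sub>1 \<notin> P\<^sub>0\<close> can be cancelled.
\<close>

lemma prime_chain_independent:
  fixes P :: "nat \<Rightarrow> ('m \<Rightarrow>\<^sub>0 'k::field) set"
  assumes "\<forall>i\<le>l. primeideal (P i) (class_ring (monoid_alg M))" "\<forall>i<l. P i \<subset> P (Suc i)"
  shows "\<exists>fs. length fs = l \<and> set fs \<subseteq> monoid_alg M \<and>
    (\<forall>N c. (\<Sum>as\<in>exponents l N. Poly_Mapping.single 0 (c as) * power_prod fs as) \<in> P 0 \<longrightarrow>
      (\<forall>as\<in>exponents l N. c as = 0))"
  using assms
proof (induction l arbitrary: P)
  case 0
  have "c [] = 0" if "Poly_Mapping.single 0 (c []) \<in> P 0" for c :: "nat list \<Rightarrow> 'k"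
  proof (rule ccontr)
    assume "c [] \<noteq> 0"
    interpret P: primeideal "P 0" "class_ring (monoid_alg M)"
      using 0 by auto
    have "Poly_Mapping.single 0 (1 / c []) \<in> monoid_alg M"
      by (rule monoid_alg_single[OF zero_mem])
    then have "Poly_Mapping.single 0 (1 / c []) * Poly_Mapping.single 0 (c []) \<in> P 0"
      using P.I_l_closed[OF that] by simp
    then have "\<one>\<^bsub>class_ring (monoid_alg M)\<^esub> \<in> P 0"
      using \<open>c [] \<noteq> 0\<close> by (simp add: mult_single)
    then show False
      using P.one_imp_carrier P.I_notcarr by simp
  qed
  then show ?case
    by (auto simp: exponents_0)
next
  case (Suc l)
  let ?R = "class_ring (monoid_alg M) :: ('m \<Rightarrow>\<^sub>0 'k) ring"
  interpret P0: primeideal "P 0" ?R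
    using Suc.prems by auto
  interpret P1: primeideal "P 1" ?R
    using Suc.prems by auto
  obtain fs where fs: "length fs = l" "set fs \<subseteq> monoid_alg M"
    and indep: "\<forall>N c. (\<Sum>as\<in>exponents l N. Poly_Mapping.single 0 (c as) * power_prod fs as) \<in> P 1 \<longrightarrow>
      (\<forall>as\<in>exponents l N. c as = 0)"
    using Suc.IH[of "\<lambda>i. P (Suc i)"] Suc.prems by (auto simp del: One_nat_def simp: One_nat_def[symmetric])
  obtain f where f: "f \<in> P 1" "f \<notin> P 0"
    using Suc.prems(2)[rule_format, of 0] by auto
  have sub: "P 0 \<subseteq> P 1" "P 1 \<subseteq> monoid_alg M"
    using Suc.prems P1.a_subset by auto
  have zero1: "0 \<in> P 1"
    using additive_subgroup.zero_closed[OF P1.additive_subgroup_axioms] by simp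
  have fM: "f \<in> monoid_alg M"
    using f sub by auto
  have prod_mem: "power_prod fs as \<in> monoid_alg M" if "length as = length fs" for as
    using that[symmetric] fs(2)
    by (induction fs as rule: list_induct2) (auto simp: one_mem intro: mult_mem power_mem)
  have diff: "x - y \<in> P 1" if "x \<in> P 1" "y \<in> P 1" for x y
  proof -
    have "(- 1) * y \<in> P 1"
      using P1.I_l_closed[OF that(2), of "- 1"] by (simp add: monoid_alg_uminus one_mem)
    then show ?thesis
      using P1.a_closed[OF that(1), of "- y"] by simp
  qed
  \<comment> \<open>The coefficients are only known to vanish once they lie in \<open>P 1\<close>.
    This is what independence of \<open>fs\<close> modulo \<open>P 1\<close> provides, and it
    suffices to strip one power of \<open>f\<close> at a time.\<close>
  have cancel: "\<forall>a\<le>n. g a = 0"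
    if "\<And>a. a \<le> n \<Longrightarrow> g a \<in> monoid_alg M" "\<And>a. a \<le> n \<Longrightarrow> g a \<in> P 1 \<Longrightarrow> g a = 0"
      "(\<Sum>a\<le>n. f ^ a * g a) \<in> P 0" for n g
    using that
  proof (induction n arbitrary: g)
    case 0
    then show ?case using sub by auto
  next
    case (Suc n)
    let ?rest = "\<Sum>a\<le>n. f ^ a * g (Suc a)"
    have eq: "(\<Sum>a\<le>Suc n. f ^ a * g a) = g 0 + f * ?rest"
      by (subst sum.atMost_Suc_shift) (simp add: sum_distrib_left mult_ac)
    have rest: "?rest \<in> monoid_alg M"
      using Suc.prems(1) fM by (intro monoid_alg_sum mult_mem power_mem) auto
    have "f * ?rest \<in> P 1"
      using P1.I_r_closed[OF f(1)] rest by simp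
    then have "g 0 \<in> P 1"
      using diff[of "g 0 + f * ?rest" "f * ?rest"] Suc.prems(3) sub(1) unfolding eq by auto
    then have g0: "g 0 = 0"
      using Suc.prems(2) by auto
    then have "f * ?rest \<in> P 0"
      using Suc.prems(3) unfolding eq by simp
    then have "?rest \<in> P 0"
      using P0.I_prime[of f ?rest] f(2) fM rest by simp
    then have "\<forall>a\<le>n. g (Suc a) = 0"
      using Suc.prems by (intro Suc.IH) auto
    with g0 show ?case
      by (metis Suc_le_mono not0_implies_Suc)
  qed
  have "c as = 0"
    if zero: "(\<Sum>as\<in>exponents (Suc l) N. Poly_Mapping.single 0 (c as) * power_prod (f # fs) as) \<in> P 0"
      and as: "as \<in> exponents (Suc l) N" for N c as
  proof -
    define g where "g a = (\<Sum>as\<in>exponents l N. Poly_Mapping.single 0 (c (a # as)) * power_prod fs as)" for a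
    have "(\<Sum>as\<in>exponents (Suc l) N. Poly_Mapping.single 0 (c as) * power_prod (f # fs) as) =
        (\<Sum>(a, as)\<in>{..N} \<times> exponents l N. Poly_Mapping.single 0 (c (a # as)) * power_prod (f # fs) (a # as))"
      unfolding exponents_Suc by (subst sum.reindex) (auto simp: inj_on_def case_prod_beta)
    also have "\<dots> = (\<Sum>a\<le>N. f ^ a * g a)"
      by (simp add: g_def sum_distrib_left mult_ac flip: sum.cartesian_product)
    finally have "(\<Sum>a\<le>N. f ^ a * g a) \<in> P 0"
      using zero by simp
    moreover have "g a \<in> monoid_alg M" for a
      unfolding g_def using fs(1) zero_mem
      by (intro monoid_alg_sum mult_mem prod_mem) (auto simp: exponents_def intro: monoid_alg_single)
    moreover have "g a = 0" if "g a \<in> P 1" for a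
      using indep[rule_format, of "\<lambda>as. c (a # as)" N] that unfolding g_def by (intro sum.neutral) auto
    ultimately have g0: "\<forall>a\<le>N. g a = 0"
      by (intro cancel) auto
    obtain a as' where "as = a # as'" "a \<le> N" "as' \<in> exponents l N"
      using as unfolding exponents_Suc by auto
    then show "c as = 0"
      using indep[rule_format, of "\<lambda>as. c (a # as)" N as'] g0 zero1 unfolding g_def by auto
  qed
  then show ?case
    using fs fM by (intro exI[of _ "f # fs"]) auto
qed

end

text \<open>Independent vectors in a span of monomials. Independence is stated for a family, so a
  repeated value is a relation, and injectivity of \<open>v\<close> comes out of the
  hypothesis.\<close>

lemma card_le_card_monomials:
  fixes v :: "'i \<Rightarrow> 'm::comm_monoid_add \<Rightarrow>\<^sub>0 'k::field"
  assumes "finite J" "finite S" "\<And>j. j \<in> J \<Longrightarrow> v j \<in> monoid_alg S"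
    and indep: "\<And>c. (\<Sum>j\<in>J. Poly_Mapping.single 0 (c j) * v j) = 0 \<Longrightarrow> \<forall>j\<in>J. c j = 0"
  shows "card J \<le> card S"
proof -
  interpret vs: vector_space "\<lambda>c (p :: 'm \<Rightarrow>\<^sub>0 'k). Poly_Mapping.single 0 c * p"
    by unfold_locales (simp_all add: algebra_simps single_add mult_single flip: mult.assoc)
  let ?T = "(\<lambda>m. Poly_Mapping.single m 1 :: 'm \<Rightarrow>\<^sub>0 'k) ` S"
  have inj: "inj_on v J"
  proof (rule inj_onI, rule ccontr)
    fix i j assume ij: "i \<in> J" "j \<in> J" "v i = v j" "i \<noteq> j"
    \<comment> \<open>A repeated value gives the relation with coefficients 1 and -1.\<close>
    have "(\<Sum>k\<in>J. Poly_Mapping.single 0 (if k = i then 1 else if k = j then - 1 else 0) * v k) =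
      (\<Sum>k\<in>{i, j}. Poly_Mapping.single 0 (if k = i then 1 else if k = j then - 1 else 0) * v k)"
      using ij assms(1) by (intro sum.mono_neutral_right) auto
    also have "\<dots> = 0"
      using ij by (simp add: single_uminus)
    finally show False
      using indep[of "\<lambda>k. if k = i then 1 else if k = j then - 1 else 0"] ij by auto
  qed
  have "vs.independent (v ` J)"
    unfolding vs.dependent_finite[OF finite_imageI[OF assms(1)]]
    using indep[of "u \<circ> v" for u] by (auto simp: sum.reindex[OF inj])
  moreover have "v ` J \<subseteq> vs.span ?T"
  proof
    fix w assume "w \<in> v ` J"
    then have "Poly_Mapping.keys w \<subseteq> S"
      using assms(3) by (auto simp: monoid_alg_def)
    then have "w = (\<Sum>m\<in>S. Poly_Mapping.single 0 (Poly_Mapping.lookup w m) * Poly_Mapping.single m 1)"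
      using poly_mapping_sum_single[OF assms(2), of w] by (simp add: mult_single)
    also have "\<dots> \<in> vs.span ?T"
      by (intro vs.span_sum vs.span_scale vs.span_base) auto
    finally show "w \<in> vs.span ?T" .
  qed
  ultimately have "card (v ` J) \<le> card ?T"
    using vs.independent_span_bound[of ?T "v ` J"] assms(2) by auto
  also have "\<dots> \<le> card S"
    by (rule card_image_le[OF assms(2)])
  finally show ?thesis
    by (simp add: card_image[OF inj])
qed

lemma power_le_power_imp_le:
  fixes E l r :: nat
  assumes "\<And>N. (N + 1) ^ l \<le> (E * N + 1) ^ r"
  shows "l \<le> r"
proof (rule ccontr)
  assume "\<not> l \<le> r"
  \<comment> \<open>Chosen so that the right side is at most
    \<open>((N + 1) * (E + 1)) ^ r = (N + 1) ^ r * N\<close>, which is below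
    \<open>(N + 1) ^ Suc r\<close>.\<close>
  define N where "N = (E + 1) ^ r"
  have "(N + 1) ^ r * (N + 1) = (N + 1) ^ Suc r"
    by simp
  also have "\<dots> \<le> (N + 1) ^ l"
    using \<open>\<not> l \<le> r\<close> by (intro power_increasing) auto
  also have "\<dots> \<le> (E * N + 1) ^ r"
    by (rule assms)
  also have "\<dots> \<le> ((N + 1) * (E + 1)) ^ r"
    by (rule power_mono) simp_all
  also have "\<dots> = (N + 1) ^ r * N"
    by (simp only: power_mult_distrib N_def)
  finally show False
    by simp
qed

context graded_monoid
begin

text \<open>A chain of length \<open>l\<close> yields \<open>(N + 1) ^ l\<close> independent
  products inside degree \<open>l * (N * e)\<close>, where the hypothesis leaves room for at most
  \<open>(l * (N * e) + 1) ^ r\<close>. Since \<open>e\<close> does not depend on \<open>N\<close>,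
  growth in \<open>N\<close> forces \<open>l \<le> r\<close>.\<close>

lemma krull_dim_le:
  assumes bound: "\<And>k. card {a \<in> M. d a \<le> k} \<le> (k + 1) ^ r"
  shows "krull_dim (class_ring (monoid_alg M :: ('m \<Rightarrow>\<^sub>0 'k::field) set)) \<le> enat r"
  unfolding krull_dim_def
proof (rule Sup_least, safe)
  fix l and P :: "nat \<Rightarrow> ('m \<Rightarrow>\<^sub>0 'k) set"
  assume chain: "\<forall>i\<le>l. primeideal (P i) (class_ring (monoid_alg M))" "\<forall>i<l. P i \<subset> P (Suc i)"
  obtain fs where fs: "length fs = l" "set fs \<subseteq> monoid_alg M"
    and indep: "\<forall>N c. (\<Sum>as\<in>exponents l N. Poly_Mapping.single 0 (c as) * power_prod fs as) \<in> P 0 \<longrightarrow>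
      (\<forall>as\<in>exponents l N. c as = 0)"
    using prime_chain_independent[OF chain] by blast
  interpret P0: primeideal "P 0" "class_ring (monoid_alg M)"
    using chain by blast
  define le where "le k = {a \<in> M. d a \<le> k}" for k
  have fin: "finite (le k)" for k
  proof -
    have "le k = (\<Union>i\<le>k. {a \<in> M. d a = i})"
      by (auto simp: le_def)
    then show ?thesis
      using finite_deg by simp
  qed
  \<comment> \<open>Bounds the degrees of all monomials of the chosen elements; 0 is inserted
    because there may be none.\<close>
  define e where "e = Max (insert 0 (d ` (\<Union>f\<in>set fs. Poly_Mapping.keys f)))"
  have "d m \<le> e" if "f \<in> set fs" "m \<in> Poly_Mapping.keys f" for f m
    unfolding e_def using that by (intro Max_ge) auto
  then have e: "f \<in> monoid_alg (le e)" if "f \<in> set fs" for f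
    using that fs(2) by (auto simp: monoid_alg_def le_def)
  have mult: "f * g \<in> monoid_alg (le (i + j))" if "f \<in> monoid_alg (le i)" "g \<in> monoid_alg (le j)"
    for f g :: "'m \<Rightarrow>\<^sub>0 'k" and i j
    using that by (rule monoid_alg_mult) (auto simp: le_def d_add intro: add_mem add_mono)
  have power: "f ^ n \<in> monoid_alg (le (n * i))" if "f \<in> monoid_alg (le i)" for f :: "'m \<Rightarrow>\<^sub>0 'k" and n i
  proof (induction n)
    case 0
    then show ?case
      using monoid_alg_single[of 0 "le 0" 1] zero_mem by (simp add: le_def)
  next
    case (Suc n)
    then show ?case
      using mult[OF that Suc] by (simp add: add.commute)
  qed
  have le_mono: "monoid_alg (le i) \<subseteq> (monoid_alg (le j) :: ('m \<Rightarrow>\<^sub>0 'k) set)" if "i \<le> j" for i j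
    using that by (intro monoid_alg_mono) (auto simp: le_def)
  have prod: "power_prod gs as \<in> monoid_alg (le (length gs * (N * e)))"
    if "length gs = length as" "set gs \<subseteq> set fs" "set as \<subseteq> {..N}" for gs as N
    using that
  proof (induction gs as rule: list_induct2)
    case Nil
    then show ?case
      using monoid_alg_single[of 0 "le 0" 1] zero_mem by (simp add: le_def)
  next
    case (Cons g gs a as)
    have "g ^ a \<in> monoid_alg (le (N * e))"
      using power[OF e[of g], of a] le_mono[of "a * e" "N * e"] Cons.prems by auto
    from mult[OF this Cons.IH] show ?case
      using Cons.prems by simp
  qed
  have "(N + 1) ^ l \<le> ((l * e) * N + 1) ^ r" for N
  proof -
    have "card (exponents l N) \<le> card (le (l * (N * e)))"
    proof (rule card_le_card_monomials[where v = "power_prod fs"])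
      show "power_prod fs as \<in> monoid_alg (le (l * (N * e)))" if "as \<in> exponents l N" for as
        using prod[of fs as N] that fs(1) by (auto simp: exponents_def)
      fix c assume "(\<Sum>as\<in>exponents l N. Poly_Mapping.single 0 (c as) * power_prod fs as) = 0"
      then show "\<forall>as\<in>exponents l N. c as = 0"
        using indep[rule_format, of c N] additive_subgroup.zero_closed[OF P0.additive_subgroup_axioms] by simp
    qed (rule finite_exponents fin)+
    also have "\<dots> \<le> (l * (N * e) + 1) ^ r"
      unfolding le_def by (rule bound)
    finally show ?thesis
      by (simp add: card_exponents mult_ac)
  qed
  then have "l \<le> r"
    by (rule power_le_power_imp_le)
  then show "enat l \<le> enat r"
    by simp
qed

text \<open>Complements of faces span primes, so a descending chain of faces gives an ascending
  chain of primes. Strictness is measured inside \<open>M\<close>, since the sets \<open>F i\<close>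
  may contain monomials outside it.\<close>

lemma krull_dim_ge:
  assumes "\<And>i a b. i \<le> l \<Longrightarrow> a \<in> M \<Longrightarrow> b \<in> M \<Longrightarrow> a + b \<in> F i \<longleftrightarrow> a \<in> F i \<and> b \<in> F i"
    and "\<And>i. i \<le> l \<Longrightarrow> 0 \<in> F i" and "\<And>i. i < l \<Longrightarrow> M \<inter> F (Suc i) \<subset> M \<inter> F i"
  shows "enat l \<le> krull_dim (class_ring (monoid_alg M :: ('m \<Rightarrow>\<^sub>0 'k::field) set))"
  unfolding krull_dim_def
proof (rule Sup_upper, intro CollectI exI conjI allI impI)
  let ?P = "\<lambda>i. monoid_alg (M - F i) :: ('m \<Rightarrow>\<^sub>0 'k) set"
  show "primeideal (?P i) (class_ring (monoid_alg M))" if "i \<le> l" for i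
    using that assms by (intro primeideal_face) auto
  show "?P i \<subset> ?P (Suc i)" if i: "i < l" for i
  proof -
    obtain m where m: "m \<in> M" "m \<in> F i" "m \<notin> F (Suc i)"
      using assms(3)[OF i] by blast
    have "Poly_Mapping.single m 1 \<in> ?P (Suc i) - ?P i"
      using m by (auto simp: monoid_alg_def)
    moreover have "?P i \<subseteq> ?P (Suc i)"
      using assms(3)[OF i] by (intro monoid_alg_mono) auto
    ultimately show ?thesis
      by blast
  qed
qed simp

end


section \<open>Localization\<close>

text \<open>\<open>A\<close> embeds in a domain, so its localization can be modelled by fractions in
  a field, where sums and products are those of the type class.\<close>

locale embedded_fractions =
  fixes A (structure) and S and e :: "'a \<Rightarrow> 'i::idom"
  assumes cring: "cring A" and inj: "inj_on e (carrier A)"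
    and e_mult: "x \<in> carrier A \<Longrightarrow> y \<in> carrier A \<Longrightarrow> e (x \<otimes> y) = e x * e y"
    and e_add: "x \<in> carrier A \<Longrightarrow> y \<in> carrier A \<Longrightarrow> e (x \<oplus> y) = e x + e y"
    and e_one: "e \<one> = 1"
    and S_sub: "S \<subseteq> carrier A" and S_one: "\<one> \<in> S" and S_mult: "s \<in> S \<Longrightarrow> t \<in> S \<Longrightarrow> s \<otimes> t \<in> S"
    and S_zero: "\<zero> \<notin> S"
begin

interpretation A: cring A by (rule cring)

lemma e_zero: "e \<zero> = 0"
  using e_add[of \<zero> \<zero>] by (simp only: A.l_zero A.zero_closed add_cancel_right_right)

lemma e_minus: "x \<in> carrier A \<Longrightarrow> y \<in> carrier A \<Longrightarrow> e (x \<ominus> y) = e x - e y"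
  using e_add[of y "\<ominus> y"] e_add[of x "\<ominus> y"] e_zero by (simp add: A.minus_eq A.r_neg algebra_simps)

lemma e_S: "s \<in> S \<Longrightarrow> e s \<noteq> 0"
  using S_zero S_sub inj e_zero by (metis A.zero_closed inj_onD subsetD)

definition fracs :: "'i fract set" where
  "fracs = {Fract (e a) (e s) | a s. a \<in> carrier A \<and> s \<in> S}"

text \<open>The fibre of the map from pairs to fractions. These fibres are exactly the equivalence
  classes that make up the localization.\<close>

definition cls :: "'i fract \<Rightarrow> ('a \<times> 'a) set" where
  "cls q = {(b, t). b \<in> carrier A \<and> t \<in> S \<and> Fract (e b) (e t) = q}"

lemma fraction_eq_cls:
  assumes a: "a \<in> carrier A" and s: "s \<in> S"
  shows "fraction A S a s = cls (Fract (e a) (e s))"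
proof -
  have "(\<exists>u\<in>S. u \<otimes> ((a \<otimes> t) \<ominus> (b \<otimes> s)) = \<zero>) \<longleftrightarrow> Fract (e b) (e t) = Fract (e a) (e s)"
    if b: "b \<in> carrier A" and t: "t \<in> S" for b t
  proof -
    have sc: "s \<in> carrier A" "t \<in> carrier A"
      using s t S_sub by auto
    \<comment> \<open>The image of \<open>u\<close> is nonzero in a domain and cancels, so the
      relation is equality of fractions.\<close>
    have "u \<otimes> ((a \<otimes> t) \<ominus> (b \<otimes> s)) = \<zero> \<longleftrightarrow> e a * e t = e b * e s" if "u \<in> S" for u
    proof -
      have u: "u \<in> carrier A"
        using that S_sub by auto
      have "u \<otimes> ((a \<otimes> t) \<ominus> (b \<otimes> s)) = \<zero> \<longleftrightarrow> e (u \<otimes> ((a \<otimes> t) \<ominus> (b \<otimes> s))) = 0"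
        using inj_on_eq_iff[OF inj, of "u \<otimes> ((a \<otimes> t) \<ominus> (b \<otimes> s))" \<zero>] u a b sc by (simp add: e_zero)
      also have "\<dots> \<longleftrightarrow> e u * (e a * e t - e b * e s) = 0"
        using u a b sc by (simp add: e_mult e_minus)
      finally show ?thesis
        using e_S[OF that] by simp
    qed
    moreover have "Fract (e b) (e t) = Fract (e a) (e s) \<longleftrightarrow> e a * e t = e b * e s"
      using e_S[OF s] e_S[OF t] by (auto simp: eq_fract)
    ultimately show ?thesis
      using S_one by blast
  qed
  then show ?thesis
    using a s by (auto simp: fraction_def fraction_rel_def cls_def)
qed

lemma cls_mem_iff: "(a, s) \<in> cls q \<longleftrightarrow> a \<in> carrier A \<and> s \<in> S \<and> Fract (e a) (e s) = q"
  by (simp add: cls_def)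

lemma cls_nonempty: "q \<in> fracs \<Longrightarrow> \<exists>a s. (a, s) \<in> cls q"
  by (auto simp: fracs_def cls_def)

lemma inj_cls: "inj_on cls fracs"
  by (rule inj_onI) (metis cls_nonempty cls_mem_iff)

lemma cls_iso: "cls \<in> ring_iso (class_ring fracs) (localization A S)"
proof (rule ring_iso_memI)
  have quot: "carrier (localization A S) = cls ` fracs"
  proof -
    have "carrier (localization A S) = {fraction A S a s | a s. a \<in> carrier A \<and> s \<in> S}"
      by (auto simp: localization_def quotient_def fraction_def)
    also have "\<dots> = {cls (Fract (e a) (e s)) | a s. a \<in> carrier A \<and> s \<in> S}"
      by (intro Collect_cong iff_exI) (auto simp: fraction_eq_cls)
    also have "\<dots> = cls ` fracs"
      by (auto simp: fracs_def)
    finally show ?thesis .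
  qed
  then show "bij_betw cls (carrier (class_ring fracs)) (carrier (localization A S))"
    using inj_cls by (simp add: bij_betw_def)
  show "cls x \<in> carrier (localization A S)" if "x \<in> carrier (class_ring fracs)" for x
    using that quot by simp
  have SS: "s \<in> carrier A" if "s \<in> S" for s
    using that S_sub by auto
  show "cls (x \<otimes>\<^bsub>class_ring fracs\<^esub> y) = cls x \<otimes>\<^bsub>localization A S\<^esub> cls y"
    if "x \<in> carrier (class_ring fracs)" "y \<in> carrier (class_ring fracs)" for x y
  proof -
    have "fraction A S (a \<otimes> b) (s \<otimes> t) = cls (x * y)" if "(a, s) \<in> cls x" "(b, t) \<in> cls y" for a s b t
      using that by (auto simp: cls_mem_iff fraction_eq_cls S_mult SS e_mult mult_fract)
    \<comment> \<open>All representatives give the same class, so the double union is constant; it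
      equals that class because both index sets are nonempty.\<close>
    then have "cls x \<otimes>\<^bsub>localization A S\<^esub> cls y = (\<Union>(a, s)\<in>cls x. \<Union>(b, t)\<in>cls y. cls (x * y))"
      unfolding localization_def monoid.simps ring.simps
      by (intro SUP_cong refl; clarify; intro SUP_cong refl; clarify)
    then show ?thesis
      using cls_nonempty[of x] cls_nonempty[of y] that by auto
  qed
  show "cls (x \<oplus>\<^bsub>class_ring fracs\<^esub> y) = cls x \<oplus>\<^bsub>localization A S\<^esub> cls y"
    if "x \<in> carrier (class_ring fracs)" "y \<in> carrier (class_ring fracs)" for x y
  proof -
    have "fraction A S ((a \<otimes> t) \<oplus> (b \<otimes> s)) (s \<otimes> t) = cls (x + y)" if "(a, s) \<in> cls x" "(b, t) \<in> cls y" for a s b t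
      using that by (auto simp: cls_mem_iff fraction_eq_cls S_mult SS e_mult e_add e_S)
    then have "cls x \<oplus>\<^bsub>localization A S\<^esub> cls y = (\<Union>(a, s)\<in>cls x. \<Union>(b, t)\<in>cls y. cls (x + y))"
      unfolding localization_def monoid.simps ring.simps
      by (intro SUP_cong refl; clarify; intro SUP_cong refl; clarify)
    then show ?thesis
      using cls_nonempty[of x] cls_nonempty[of y] that by auto
  qed
  show "cls \<one>\<^bsub>class_ring fracs\<^esub> = \<one>\<^bsub>localization A S\<^esub>"
    by (simp add: localization_def fraction_eq_cls S_one e_one One_fract_def)
qed

lemma cls_zero: "cls 0 = \<zero>\<^bsub>localization A S\<^esub>"
  by (simp add: localization_def fraction_eq_cls S_one e_one e_zero Zero_fract_def)

end

section \<open>Powers of ideals under isomorphism\<close>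

lemma ideal_prod_image:
  assumes "I \<subseteq> carrier R" "J \<subseteq> carrier R" "ring R" "ring S" "h \<in> ring_hom R S"
  shows "h ` I \<cdot>\<^bsub>S\<^esub> h ` J = h ` (I \<cdot>\<^bsub>R\<^esub> J)"
proof -
  interpret R: ring R by fact
  interpret S: ring S by fact
  have hom: "h (x \<otimes>\<^bsub>R\<^esub> y) = h x \<otimes>\<^bsub>S\<^esub> h y" "h (x \<oplus>\<^bsub>R\<^esub> y) = h x \<oplus>\<^bsub>S\<^esub> h y"
    if "x \<in> carrier R" "y \<in> carrier R" for x y
    using assms(5) that by (auto simp: ring_hom_def)
  have carr: "x \<in> carrier R" if "x \<in> I \<cdot>\<^bsub>R\<^esub> J" for x
    using that by induction (use assms in auto)
  show ?thesis
  proof (intro equalityI subsetI)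
    fix x assume "x \<in> h ` I \<cdot>\<^bsub>S\<^esub> h ` J"
    then show "x \<in> h ` (I \<cdot>\<^bsub>R\<^esub> J)"
    proof induction
      case (prod i j)
      then obtain i' j' where ij: "i' \<in> I" "j' \<in> J" "i = h i'" "j = h j'" by auto
      moreover have "h (i' \<otimes>\<^bsub>R\<^esub> j') = h i' \<otimes>\<^bsub>S\<^esub> h j'"
        using assms(1,2) ij by (intro hom) auto
      ultimately show ?case
        by (intro image_eqI[of _ _ "i' \<otimes>\<^bsub>R\<^esub> j'"]) (auto intro: ideal_prod.prod)
    next
      case (sum s1 s2)
      then obtain s1' s2' where s: "s1' \<in> I \<cdot>\<^bsub>R\<^esub> J" "s2' \<in> I \<cdot>\<^bsub>R\<^esub> J" "s1 = h s1'" "s2 = h s2'" by auto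
      then show ?case
        by (intro image_eqI[of _ _ "s1' \<oplus>\<^bsub>R\<^esub> s2'"]) (auto simp: hom carr intro: ideal_prod.sum)
    qed
  next
    fix x assume "x \<in> h ` (I \<cdot>\<^bsub>R\<^esub> J)"
    then obtain y where "y \<in> I \<cdot>\<^bsub>R\<^esub> J" and x: "x = h y" by auto
    from this(1) have "h y \<in> h ` I \<cdot>\<^bsub>S\<^esub> h ` J"
    proof induction
      case (prod i j)
      then have "h (i \<otimes>\<^bsub>R\<^esub> j) = h i \<otimes>\<^bsub>S\<^esub> h j"
        using assms(1,2) by (intro hom) auto
      with prod show ?case by (auto intro: ideal_prod.prod)
    next
      case (sum s1 s2)
      then have "h (s1 \<oplus>\<^bsub>R\<^esub> s2) = h s1 \<oplus>\<^bsub>S\<^esub> h s2"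
        using carr by (intro hom) auto
      with sum show ?case by (auto intro: ideal_prod.sum)
    qed
    then show "x \<in> h ` I \<cdot>\<^bsub>S\<^esub> h ` J"
      by (simp add: x)
  qed
qed

lemma ideal_power_image:
  assumes "I \<subseteq> carrier R" "ring R" "ring S" "h \<in> ring_iso R S"
  shows "ideal_power S (h ` I) k = h ` ideal_power R I k \<and> ideal_power R I k \<subseteq> carrier R"
proof (induction k)
  case 0
  then show ?case
    using assms(4) by (simp add: ring_iso_def bij_betw_def)
next
  case (Suc k)
  interpret R: ring R by fact
  have "x \<in> carrier R" if "x \<in> ideal_power R I k \<cdot>\<^bsub>R\<^esub> I" for x
    using that by induction (use Suc assms(1) in auto)
  then show ?case
    using Suc ideal_prod_image[of "ideal_power R I k" R I S h] assms by (auto simp: ring_iso_def)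
qed

lemma monoid_alg_mult_single_0:
  "f \<in> monoid_alg M \<Longrightarrow> Poly_Mapping.single 0 c * f \<in> monoid_alg (M :: 'm::comm_monoid_add set)"
  by (rule monoid_alg_mult[where A = "{0}" and B = M]) (auto simp: monoid_alg_def)

section \<open>The filtration of the local ring by order\<close>

context graded_monoid
begin

definition upper :: "nat \<Rightarrow> ('m \<Rightarrow>\<^sub>0 'k::field) set" where
  "upper k = monoid_alg {a \<in> M. k \<le> d a}"

definition comp :: "nat \<Rightarrow> ('m \<Rightarrow>\<^sub>0 'k::field) \<Rightarrow> ('m \<Rightarrow>\<^sub>0 'k)" where
  "comp k = restr {a. d a = k}"

definition unital :: "('m \<Rightarrow>\<^sub>0 'k::field) set" where
  "unital = {s \<in> monoid_alg M. Poly_Mapping.lookup s 0 \<noteq> 0}"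

text \<open>\<open>unital\<close> is the complement of the maximal ideal of the origin, so
  \<open>filt 0\<close> is the local ring. By \<open>ideal_power_filt\<close> the others are the
  powers of its maximal ideal, here described by the order of the numerator.\<close>

definition filt :: "nat \<Rightarrow> ('m \<Rightarrow>\<^sub>0 'k::field) fract set" where
  "filt k = {Fract a s | a s. a \<in> upper k \<and> s \<in> unital}"

lemma upper_0: "upper 0 = monoid_alg M"
  by (simp add: upper_def)

lemma upper_sub: "f \<in> upper k \<Longrightarrow> f \<in> monoid_alg M"
  by (auto simp: upper_def monoid_alg_def)

lemma upper_mono: "f \<in> upper k \<Longrightarrow> j \<le> k \<Longrightarrow> f \<in> upper j"
  by (auto simp: upper_def monoid_alg_def)

lemma homog_sub_upper: "f \<in> homog k \<Longrightarrow> f \<in> upper k"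
  by (auto simp: upper_def homog_def monoid_alg_def)

lemma upper_mult: "f \<in> upper i \<Longrightarrow> g \<in> upper j \<Longrightarrow> f * g \<in> upper (i + j)"
  unfolding upper_def by (erule (1) monoid_alg_mult) (auto simp: d_add add_mem)

lemma homog_mult: "f \<in> homog i \<Longrightarrow> g \<in> homog j \<Longrightarrow> f * g \<in> homog (i + j)"
  unfolding homog_def by (erule (1) monoid_alg_mult) (auto simp: d_add add_mem)

lemma comp_homog: "f \<in> monoid_alg M \<Longrightarrow> comp k f \<in> homog k"
  by (auto simp: comp_def homog_def monoid_alg_def keys_restr)

lemma diff_comp_upper: "f \<in> upper k \<Longrightarrow> f - comp k f \<in> upper (Suc k)"
proof -
  assume f: "f \<in> upper k"
  have "f - comp k f = restr (- {a. d a = k}) f"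
    unfolding comp_def by (metis add_diff_cancel_left' restr_split)
  with f show ?thesis
    by (force simp: upper_def monoid_alg_def keys_restr)
qed

lemma diff_const_upper:
  assumes "f \<in> monoid_alg M"
  shows "f - Poly_Mapping.single 0 (Poly_Mapping.lookup f 0) \<in> upper 1"
  unfolding upper_def monoid_alg_def
proof safe
  fix m assume "m \<in> Poly_Mapping.keys (f - Poly_Mapping.single 0 (Poly_Mapping.lookup f 0))"
  then have "m \<noteq> 0" "m \<in> Poly_Mapping.keys f"
    by (auto simp: in_keys_iff lookup_minus lookup_single when_def split: if_splits)
  with assms show "m \<in> M" "1 \<le> d m"
    using d_eq_0[of m] by (auto simp: monoid_alg_def Suc_le_eq)
qed

lemma upper_1_iff: "f \<in> upper 1 \<longleftrightarrow> f \<in> monoid_alg M \<and> Poly_Mapping.lookup f 0 = 0"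
proof
  assume "f \<in> upper 1"
  then show "f \<in> monoid_alg M \<and> Poly_Mapping.lookup f 0 = 0"
    using upper_sub by (force simp: upper_def monoid_alg_def in_keys_iff)
next
  assume "f \<in> monoid_alg M \<and> Poly_Mapping.lookup f 0 = 0"
  then show "f \<in> upper 1"
    using diff_const_upper[of f] by simp
qed

text \<open>The constant term is the residue modulo the ideal \<open>upper 1\<close>; the difference
  of \<open>f * g\<close> and the product of the constants splits into two members of this
  ideal.\<close>

lemma lookup_mult_0:
  fixes f g :: "'m \<Rightarrow>\<^sub>0 'k::field"
  assumes f: "f \<in> monoid_alg M" and g: "g \<in> monoid_alg M"
  shows "Poly_Mapping.lookup (f * g) 0 = Poly_Mapping.lookup f 0 * Poly_Mapping.lookup g 0"
proof -
  define a b where "a = Poly_Mapping.lookup f 0" and "b = Poly_Mapping.lookup g 0"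
  have "(f - Poly_Mapping.single 0 a) * g \<in> upper (1 + 0)"
    unfolding a_def using g by (intro upper_mult diff_const_upper f) (simp add: upper_0)
  moreover have "Poly_Mapping.single 0 a * (g - Poly_Mapping.single 0 b) \<in> upper 1"
    using diff_const_upper[OF g] unfolding b_def upper_def by (rule monoid_alg_mult_single_0)
  ultimately have "(f - Poly_Mapping.single 0 a) * g + Poly_Mapping.single 0 a * (g - Poly_Mapping.single 0 b) \<in> upper 1"
    unfolding upper_def by (simp add: monoid_alg_add)
  moreover have "(f - Poly_Mapping.single 0 a) * g + Poly_Mapping.single 0 a * (g - Poly_Mapping.single 0 b) =
    f * g - Poly_Mapping.single 0 (a * b)"
    by (simp add: algebra_simps mult_single)
  ultimately have "Poly_Mapping.lookup (f * g - Poly_Mapping.single 0 (a * b)) 0 = 0"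
    by (metis upper_1_iff)
  then show ?thesis
    by (simp add: lookup_minus a_def b_def)
qed

lemma unital_one: "1 \<in> unital"
  by (simp add: unital_def one_mem lookup_one)

lemma unital_mult: "s \<in> unital \<Longrightarrow> t \<in> unital \<Longrightarrow> s * t \<in> unital"
  by (simp add: unital_def mult_mem lookup_mult_0)

lemma unital_nonzero: "s \<in> unital \<Longrightarrow> s \<noteq> 0"
  by (auto simp: unital_def)

lemma unital_upper_0: "s \<in> unital \<Longrightarrow> s \<in> upper 0"
  by (simp add: unital_def upper_0)

lemma upper_add: "f \<in> upper k \<Longrightarrow> g \<in> upper k \<Longrightarrow> f + g \<in> upper k"
  unfolding upper_def by (rule monoid_alg_add)

lemma upper_uminus: "f \<in> upper k \<Longrightarrow> - f \<in> upper k"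
  unfolding upper_def by (rule monoid_alg_uminus)

lemma filt_I: "a \<in> upper k \<Longrightarrow> s \<in> unital \<Longrightarrow> Fract a s \<in> filt k"
  by (auto simp: filt_def)

lemma filt_E:
  assumes "z \<in> filt k"
  obtains a s where "z = Fract a s" "a \<in> upper k" "s \<in> unital"
  using assms by (auto simp: filt_def)

lemma filt_mono: "z \<in> filt k \<Longrightarrow> j \<le> k \<Longrightarrow> z \<in> filt j"
  by (auto simp: filt_def intro: upper_mono)

lemma filt_mult: "y \<in> filt i \<Longrightarrow> z \<in> filt j \<Longrightarrow> y * z \<in> filt (i + j)"
  by (elim filt_E) (auto intro!: filt_I upper_mult unital_mult)

lemma filt_add:
  assumes "y \<in> filt k" "z \<in> filt k"
  shows "y + z \<in> filt k"
proof -
  obtain a s where y: "y = Fract a s" "a \<in> upper k" "s \<in> unital"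
    using assms(1) by (rule filt_E)
  obtain b t where z: "z = Fract b t" "b \<in> upper k" "t \<in> unital"
    using assms(2) by (rule filt_E)
  have "a * t \<in> upper (k + 0)" "b * s \<in> upper (k + 0)"
    using y z by (intro upper_mult unital_upper_0; simp)+
  then have "Fract (a * t + b * s) (s * t) \<in> filt k"
    using y z by (intro filt_I upper_add unital_mult) simp_all
  also have "Fract (a * t + b * s) (s * t) = y + z"
    using y z unital_nonzero[of s] unital_nonzero[of t] by simp
  finally show ?thesis .
qed

lemma filt_uminus: "z \<in> filt k \<Longrightarrow> - z \<in> filt k"
  by (elim filt_E) (auto intro!: filt_I upper_uminus)

lemma filt_diff: "y \<in> filt k \<Longrightarrow> z \<in> filt k \<Longrightarrow> y - z \<in> filt k"
  using filt_add[of y k "- z"] filt_uminus[of z k] by simp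

lemma filt_zero: "0 \<in> filt k"
  using filt_I[of 0 k 1] unital_one by (simp add: upper_def monoid_alg_zero Zero_fract_def)

lemma filt_sum: "(\<And>i. i \<in> I \<Longrightarrow> f i \<in> filt k) \<Longrightarrow> (\<Sum>i\<in>I. f i) \<in> filt k"
  by (induction I rule: infinite_finite_induct) (auto simp: filt_zero filt_add)

lemma filt_one: "1 \<in> filt 0"
  using filt_I[of 1 0 1] unital_one by (simp add: upper_0 one_mem One_fract_def)

lemma filt_0: "z \<in> filt k \<Longrightarrow> z \<in> filt 0"
  by (rule filt_mono) auto

lemma cring_filt_0: "cring (class_ring (filt 0 :: ('m \<Rightarrow>\<^sub>0 'k::field) fract set))"
  using filt_mult[of _ 0 _ 0]
  by (intro cring_class_ring) (auto intro: filt_zero filt_one filt_add filt_uminus)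

lemma homog_filt: "b \<in> homog k \<Longrightarrow> Fract b 1 \<in> filt k"
  by (intro filt_I homog_sub_upper unital_one)

text \<open>Clearing the denominator gives \<open>b * s = a\<close> with \<open>a\<close> of order
  above k. If c is the constant term of \<open>s\<close>, then c b = a - b (s - c) has order above k
  and is homogeneous of degree k, so it vanishes.\<close>

lemma homog_filt_Suc_eq_0:
  fixes b :: "'m \<Rightarrow>\<^sub>0 'k::field"
  assumes b: "b \<in> homog k" and "Fract b 1 \<in> filt (Suc k)"
  shows "b = 0"
proof -
  obtain a s where as: "Fract b 1 = Fract a s" "a \<in> upper (Suc k)" "s \<in> unital"
    using assms(2) by (rule filt_E)
  then have eq: "b * s = a"
    using unital_nonzero[OF as(3)] by (simp add: eq_fract)
  define c where "c = Poly_Mapping.lookup s 0"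
  have "b * (s - Poly_Mapping.single 0 c) \<in> upper (k + 1)"
    using b as(3) unfolding c_def by (intro upper_mult diff_const_upper homog_sub_upper) (simp_all add: unital_def)
  then have "a + - (b * (s - Poly_Mapping.single 0 c)) \<in> upper (Suc k)"
    using as(2) by (intro upper_add upper_uminus) auto
  also have "a + - (b * (s - Poly_Mapping.single 0 c)) = Poly_Mapping.single 0 c * b"
    using eq by (simp add: algebra_simps)
  finally have "Poly_Mapping.single 0 c * b \<in> upper (Suc k)" .
  moreover have "Poly_Mapping.single 0 c * b \<in> homog k"
    using b unfolding homog_def by (rule monoid_alg_mult_single_0)
  ultimately have "Poly_Mapping.keys (Poly_Mapping.single 0 c * b) = {}"
    by (fastforce simp: upper_def homog_def monoid_alg_def)
  then have "Poly_Mapping.single 0 c * b = 0"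
    by simp
  moreover have "c \<noteq> 0"
    using as(3) by (simp add: unital_def c_def)
  then have "Poly_Mapping.single 0 c \<noteq> (0 :: 'm \<Rightarrow>\<^sub>0 'k)"
    by (metis lookup_single_eq lookup_zero)
  ultimately show "b = 0"
    by simp
qed

text \<open>Modulo higher order the denominator acts as its constant term c, so a / s has the
  leading form of a divided by c.\<close>

lemma filt_leading_form:
  fixes z :: "('m \<Rightarrow>\<^sub>0 'k::field) fract"
  assumes "z \<in> filt k"
  obtains b where "b \<in> homog k" "z - Fract b 1 \<in> filt (Suc k)"
proof -
  obtain a s where z: "z = Fract a s" and a: "a \<in> upper k" and s: "s \<in> unital"
    using assms by (rule filt_E)
  define c where "c = Poly_Mapping.lookup s 0"
  have c: "c \<noteq> 0"
    using s by (simp add: unital_def c_def)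
  define b where "b = Poly_Mapping.single 0 (1 / c) * comp k a"
  have b: "b \<in> homog k"
    unfolding b_def homog_def
    using comp_homog[OF upper_sub[OF a], of k, unfolded homog_def] by (rule monoid_alg_mult_single_0)
  have "b * (s - Poly_Mapping.single 0 c) \<in> upper (k + 1)"
    using b s unfolding c_def by (intro upper_mult diff_const_upper homog_sub_upper) (simp_all add: unital_def)
  then have "(a - comp k a) + - (b * (s - Poly_Mapping.single 0 c)) \<in> upper (Suc k)"
    using diff_comp_upper[OF a] by (intro upper_add upper_uminus) auto
  also have "Poly_Mapping.single 0 (1 / c) * Poly_Mapping.single 0 c = (1 :: 'm \<Rightarrow>\<^sub>0 'k)"
    using c by (simp add: mult_single)
  then have "b * Poly_Mapping.single 0 c = comp k a"
    unfolding b_def by (metis mult.assoc mult.commute mult_1)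
  then have "(a - comp k a) + - (b * (s - Poly_Mapping.single 0 c)) = a - b * s"
    by (simp add: algebra_simps)
  finally have "Fract (a - b * s) s \<in> filt (Suc k)"
    using s by (rule filt_I)
  moreover have "Fract (a - b * s) s = z - Fract b 1"
    using unital_nonzero[OF s] by (simp add: z diff_fract eq_fract)
  ultimately show thesis
    using b that by simp
qed

text \<open>Generation in degree 1 enters here: a monomial of degree at least k+1 is a product of
  one of degree at least k and one of degree 1.\<close>

lemma ideal_power_filt: "ideal_power (class_ring (filt 0)) (filt 1) k = (filt k :: ('m \<Rightarrow>\<^sub>0 'k::field) fract set)"
proof (induction k)
  case 0
  then show ?case by simp
next
  case (Suc k)
  let ?R = "class_ring (filt 0 :: ('m \<Rightarrow>\<^sub>0 'k) fract set)"
  have "filt k \<cdot>\<^bsub>?R\<^esub> filt 1 = (filt (Suc k) :: ('m \<Rightarrow>\<^sub>0 'k) fract set)"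
  proof (intro equalityI subsetI)
    fix z assume "z \<in> filt k \<cdot>\<^bsub>?R\<^esub> filt 1"
    then show "z \<in> filt (Suc k)"
    proof induction
      case (prod i j)
      then show ?case using filt_mult[of i k j 1] by simp
    next
      case (sum s1 s2)
      then show ?case using filt_add by simp
    qed
  next
    fix z :: "('m \<Rightarrow>\<^sub>0 'k) fract" assume "z \<in> filt (Suc k)"
    then obtain a s where z: "z = Fract a s" and a: "a \<in> upper (Suc k)" and s: "s \<in> unital"
      by (rule filt_E)
    have summand: "Fract (Poly_Mapping.single m c) s \<in> filt k \<cdot>\<^bsub>?R\<^esub> filt 1" if m: "m \<in> M" "Suc k \<le> d m" for m c
    proof -
      obtain j where "d m = Suc j"
        using m(2) by (metis Suc_le_D)
      then obtain m1 m2 where mm: "m1 \<in> M" "m2 \<in> M" "k \<le> d m1" "d m2 = 1" "m = m1 + m2"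
        using split[OF m(1)] m(2) by (metis Suc_le_mono)
      have "Fract (Poly_Mapping.single m1 c) s \<otimes>\<^bsub>?R\<^esub> Fract (Poly_Mapping.single m2 1) 1 \<in> filt k \<cdot>\<^bsub>?R\<^esub> filt 1"
        using mm s unital_one by (intro ideal_prod.prod filt_I) (auto simp: upper_def intro: monoid_alg_single)
      then show ?thesis
        by (simp add: mm(5) mult_single)
    qed
    \<comment> \<open>The product of ideals is closed under binary sums only, so the numerator is
      assembled term by term over subsets of its support.\<close>
    have "Fract (\<Sum>m\<in>F. Poly_Mapping.single m (Poly_Mapping.lookup a m)) s \<in> filt k \<cdot>\<^bsub>?R\<^esub> filt 1"
      if "finite F" "F \<subseteq> Poly_Mapping.keys a" for F
      using that
    proof (induction F rule: finite_induct)
      case empty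
      have "0 \<otimes>\<^bsub>?R\<^esub> 0 \<in> filt k \<cdot>\<^bsub>?R\<^esub> filt 1"
        by (intro ideal_prod.prod filt_zero)
      then show ?case
        using fract_collapse(1)[of s] by simp
    next
      case (insert m F)
      have "Fract (Poly_Mapping.single m (Poly_Mapping.lookup a m)) s \<oplus>\<^bsub>?R\<^esub>
          Fract (\<Sum>m\<in>F. Poly_Mapping.single m (Poly_Mapping.lookup a m)) s \<in> filt k \<cdot>\<^bsub>?R\<^esub> filt 1"
        using insert a by (intro ideal_prod.sum summand) (auto simp: upper_def monoid_alg_def)
      moreover have "Fract x s + Fract y s = Fract (x + y) s" for x y
        using unital_nonzero[OF s] by (simp add: eq_fract algebra_simps)
      ultimately show ?case
        using insert by simp
    qed
    from this[of "Poly_Mapping.keys a"] show "z \<in> filt k \<cdot>\<^bsub>?R\<^esub> filt 1"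
      using z by (simp flip: poly_mapping_sum_single)
  qed
  with Suc show ?case by simp
qed

lemma comp_add: "comp k (f + g) = comp k f + comp k g"
  unfolding comp_def by (rule poly_mapping_eqI) (simp add: lookup_restr lookup_add)

lemma comp_zero: "comp k 0 = 0"
  unfolding comp_def by (rule poly_mapping_eqI) (simp add: lookup_restr)

lemma comp_sum: "comp k (\<Sum>i\<in>I. f i) = (\<Sum>i\<in>I. comp k (f i))"
  by (induction I rule: infinite_finite_induct) (simp_all add: comp_add comp_zero)

lemma comp_of_homog: "f \<in> homog i \<Longrightarrow> comp k f = (if k = i then f else 0)"
  unfolding comp_def
  by (rule poly_mapping_eqI) (auto simp: lookup_restr homog_def monoid_alg_def in_keys_iff)

lemma comp_ext:
  assumes "\<And>k. comp k f = comp k g"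
  shows "f = g"
proof (rule poly_mapping_eqI)
  fix m
  show "Poly_Mapping.lookup f m = Poly_Mapping.lookup g m"
    using arg_cong[OF assms[of "d m"], of "\<lambda>f. Poly_Mapping.lookup f m"] by (simp add: comp_def lookup_restr)
qed

lemma sum_comp:
  assumes "\<And>m. m \<in> Poly_Mapping.keys f \<Longrightarrow> d m \<le> N"
  shows "f = (\<Sum>i\<le>N. comp i f)"
proof (rule poly_mapping_eqI)
  fix m
  have "(\<Sum>i\<le>N. if d m = i then Poly_Mapping.lookup f m else 0) = Poly_Mapping.lookup f m"
    using assms[of m] by (auto simp: in_keys_iff)
  then show "Poly_Mapping.lookup f m = Poly_Mapping.lookup (\<Sum>i\<le>N. comp i f) m"
    by (simp add: lookup_sum comp_def lookup_restr)
qed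

lemma comp_mult:
  fixes f g :: "'m \<Rightarrow>\<^sub>0 'k::field"
  assumes f: "f \<in> monoid_alg M" and g: "g \<in> monoid_alg M"
  shows "comp k (f * g) = (\<Sum>i\<le>k. comp i f * comp (k - i) g)"
proof -
  define N where "N = Max (insert k (d ` (Poly_Mapping.keys f \<union> Poly_Mapping.keys g)))"
  have N: "d m \<le> N" if "m \<in> Poly_Mapping.keys f \<union> Poly_Mapping.keys g" for m
    unfolding N_def using that by (intro Max_ge) auto
  have k: "k \<le> N"
    unfolding N_def by (intro Max_ge) auto
  have "f * g = (\<Sum>i\<le>N. comp i f) * (\<Sum>j\<le>N. comp j g)"
    using N sum_comp[of f N] sum_comp[of g N] by simp
  then have "comp k (f * g) = (\<Sum>i\<le>N. \<Sum>j\<le>N. comp k (comp i f * comp j g))"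
    by (simp add: sum_product comp_sum)
  also have "\<dots> = (\<Sum>i\<le>N. \<Sum>j\<le>N. if k = i + j then comp i f * comp j g else 0)"
    by (intro sum.cong refl comp_of_homog homog_mult comp_homog f g)
  also have "\<dots> = (\<Sum>i\<le>N. if i \<le> k then comp i f * comp (k - i) g else 0)"
  proof (rule sum.cong)
    fix i
    show "(\<Sum>j\<le>N. if k = i + j then comp i f * comp j g else 0) = (if i \<le> k then comp i f * comp (k - i) g else 0)"
    proof (cases "i \<le> k")
      case True
      have "(\<Sum>j\<le>N. if k = i + j then comp i f * comp j g else 0) =
          (\<Sum>j\<le>N. if j = k - i then comp i f * comp j g else 0)"
        using True by (intro sum.cong) auto
      then show ?thesis
        using True k by (simp add: sum.delta)
    qed (auto intro: sum.neutral)
  qed simp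
  also have "\<dots> = (\<Sum>i\<le>k. comp i f * comp (k - i) g)"
    using k by (intro sum.mono_neutral_cong_right) auto
  finally show ?thesis .
qed

end


section \<open>The associated graded ring\<close>

text \<open>\<open>R\<close> is any isomorphic copy of the local ring, so the associated graded ring
  is computed with fractions. Preservation of zero is a separate assumption because
  \<open>ring_iso\<close> does not mention it and \<open>R\<close> is not yet known to be a
  ring.\<close>

locale graded_local = graded_monoid M d
  for M :: "'m::{ordered_cancel_comm_monoid_add, linorder} set" and d +
  fixes R :: "'r ring" (structure) and h :: "('m \<Rightarrow>\<^sub>0 'k::field) fract \<Rightarrow> 'r"
  assumes iso: "h \<in> ring_iso (class_ring (filt 0)) R" and h_zero: "h 0 = \<zero>"
begin

definition max_ideal :: "'r set" where
  "max_ideal = h ` filt 1"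

abbreviation gr :: "(nat \<Rightarrow> 'r set) ring" where
  "gr \<equiv> assoc_graded R max_ideal"

lemma cring_R: "cring R"
proof -
  have "cring (R\<lparr>zero := h \<zero>\<^bsub>class_ring (filt 0)\<^esub>\<rparr>)"
    by (rule cring.ring_iso_imp_img_cring[OF cring_filt_0 iso])
  then show ?thesis
    by (simp add: h_zero)
qed

interpretation R: cring R by (rule cring_R)

declare ideal_power.simps(2) [simp del]

lemma filt_sub: "z \<in> filt k \<Longrightarrow> z \<in> (filt 0 :: ('m \<Rightarrow>\<^sub>0 'k) fract set)"
  by (rule filt_0)

lemma h_mult: "x \<in> filt 0 \<Longrightarrow> y \<in> filt 0 \<Longrightarrow> h x \<otimes> h y = h (x * y)"
  and h_add: "x \<in> filt 0 \<Longrightarrow> y \<in> filt 0 \<Longrightarrow> h x \<oplus> h y = h (x + y)"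
  and h_one: "h 1 = \<one>"
  and h_carrier: "h ` filt 0 = carrier R"
  and h_inj: "inj_on h (filt 0)"
  using iso by (auto simp: ring_iso_def ring_hom_def bij_betw_def)

lemma h_closed: "x \<in> filt 0 \<Longrightarrow> h x \<in> carrier R"
  using h_carrier by auto

lemma ideal_power_R: "ideal_power R max_ideal k = h ` filt k"
proof -
  have "ideal_power R max_ideal k = h ` ideal_power (class_ring (filt 0)) (filt 1) k"
    using ideal_power_image[of "filt 1" "class_ring (filt 0)" R h k] filt_sub iso
    by (auto simp: max_ideal_def cring.axioms(1)[OF cring_filt_0] R.ring_axioms)
  then show ?thesis
    by (simp only: ideal_power_filt)
qed

definition coset :: "nat \<Rightarrow> ('m \<Rightarrow>\<^sub>0 'k) fract \<Rightarrow> 'r set" where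
  "coset k z = h ` {w \<in> filt 0. w - z \<in> filt k}"

lemma coset_eq:
  assumes "z \<in> filt 0"
  shows "h ` filt k +> h z = coset k z"
proof -
  have "h ` filt k +> h z = (\<lambda>w. h (w + z)) ` filt k"
    using assms filt_sub by (auto simp: a_r_coset_def' h_add)
  also have "\<dots> = h ` (\<lambda>w. w + z) ` filt k"
    by (simp add: image_image)
  also have "(\<lambda>w. w + z) ` filt k = {w \<in> filt 0. w - z \<in> filt k}"
  proof (intro equalityI subsetI)
    fix w assume "w \<in> {w \<in> filt 0. w - z \<in> filt k}"
    then show "w \<in> (\<lambda>w. w + z) ` filt k"
      by (intro image_eqI[of _ _ "w - z"]) auto
  qed (use assms in \<open>auto intro: filt_add filt_sub\<close>)
  finally show ?thesis
    by (simp add: coset_def)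
qed

lemma h_mem_coset: "w \<in> filt 0 \<Longrightarrow> h w \<in> coset k z \<longleftrightarrow> w - z \<in> filt k"
  using h_inj by (auto simp: coset_def inj_on_def)

lemma coset_zero: "coset k 0 = h ` filt k"
  using filt_sub by (auto simp: coset_def)

lemma coset_eq_iff:
  assumes "z \<in> filt 0" "z' \<in> filt 0"
  shows "coset k z = coset k z' \<longleftrightarrow> z - z' \<in> filt k"
proof
  assume "coset k z = coset k z'"
  moreover have "h z \<in> coset k z"
    using assms by (simp add: h_mem_coset filt_zero)
  ultimately show "z - z' \<in> filt k"
    using assms by (simp add: h_mem_coset)
next
  assume zz: "z - z' \<in> filt k"
  have "w - z \<in> filt k \<longleftrightarrow> w - z' \<in> filt k" for w
    using filt_add[OF _ zz, of "w - z"] filt_diff[OF _ zz, of "w - z'"] by auto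
  then show "coset k z = coset k z'"
    by (simp add: coset_def)
qed

lemma coset_add:
  assumes "z \<in> filt 0" "z' \<in> filt 0"
  shows "coset k z <+>\<^bsub>R\<^esub> coset k z' = coset k (z + z')"
proof (intro equalityI subsetI)
  fix x assume "x \<in> coset k z <+>\<^bsub>R\<^esub> coset k z'"
  then obtain w w' where w: "w \<in> filt 0" "w - z \<in> filt k" "w' \<in> filt 0" "w' - z' \<in> filt k" and x: "x = h w \<oplus> h w'"
    by (auto simp: set_add_def' coset_def)
  have "w + w' - (z + z') \<in> filt k"
    using filt_add[OF w(2,4)] by (simp add: algebra_simps)
  then show "x \<in> coset k (z + z')"
    using w x by (simp add: h_add h_mem_coset filt_add)
next
  fix x assume "x \<in> coset k (z + z')"
  then obtain w where w: "w \<in> filt 0" "w - (z + z') \<in> filt k" and x: "x = h w"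
    by (auto simp: coset_def)
  have "h (w - z') \<in> coset k z" "h z' \<in> coset k z'"
    using w assms by (simp_all add: h_mem_coset filt_diff filt_zero algebra_simps)
  moreover have "x = h (w - z') \<oplus> h z'"
    using w assms by (simp add: x h_add filt_diff)
  ultimately show "x \<in> coset k z <+>\<^bsub>R\<^esub> coset k z'"
    unfolding set_add_def' by blast
qed

lemma h_finsum:
  assumes "finite I" "\<And>i. i \<in> I \<Longrightarrow> f i \<in> filt 0"
  shows "(\<Oplus>i\<in>I. h (f i)) = h (\<Sum>i\<in>I. f i)"
  using assms
proof (induction I rule: finite_induct)
  case (insert i I)
  then have "(\<Oplus>i\<in>insert i I. h (f i)) = h (f i) \<oplus> (\<Oplus>i\<in>I. h (f i))"
    by (intro R.finsum_insert) (auto intro: h_closed)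
  with insert show ?case
    by (simp add: h_add filt_sum)
qed (simp add: h_zero)

text \<open>Changing a representative in degree i by an element of \<open>filt (Suc i)\<close>
  changes its product with an element of \<open>filt (k - i)\<close> only within
  \<open>filt (Suc k)\<close>. Every choice of representatives thus produces the same coset.\<close>

lemma coset_conv:
  assumes "\<And>i. i \<le> k \<Longrightarrow> \<alpha> i \<in> filt i" "\<And>i. i \<le> k \<Longrightarrow> \<beta> i \<in> filt i"
  shows "{c. \<exists>a b. (\<forall>i\<le>k. a i \<in> coset (Suc i) (\<alpha> i) \<and> b i \<in> coset (Suc i) (\<beta> i)) \<and>
      c \<in> h ` filt (Suc k) +> (\<Oplus>i\<in>{..k}. a i \<otimes> b (k - i))} = coset (Suc k) (\<Sum>i\<le>k. \<alpha> i * \<beta> (k - i))"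
    (is "?lhs = ?rhs")
proof -
  have mem: "\<alpha> i \<in> filt 0" "\<beta> i \<in> filt 0" if "i \<le> k" for i
    using assms that filt_sub by blast+
  have "h ` filt (Suc k) +> (\<Oplus>i\<in>{..k}. a i \<otimes> b (k - i)) = ?rhs"
    if ab: "\<forall>i\<le>k. a i \<in> coset (Suc i) (\<alpha> i) \<and> b i \<in> coset (Suc i) (\<beta> i)" for a b
  proof -
    have "\<forall>i\<in>{..k}. \<exists>w. w \<in> filt 0 \<and> w - \<alpha> i \<in> filt (Suc i) \<and> a i = h w"
      and "\<forall>i\<in>{..k}. \<exists>w. w \<in> filt 0 \<and> w - \<beta> i \<in> filt (Suc i) \<and> b i = h w"
      using ab by (auto simp: coset_def)
    then obtain a' b' where a': "\<And>i. i \<le> k \<Longrightarrow> a' i \<in> filt 0 \<and> a' i - \<alpha> i \<in> filt (Suc i) \<and> a i = h (a' i)"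
      and b': "\<And>i. i \<le> k \<Longrightarrow> b' i \<in> filt 0 \<and> b' i - \<beta> i \<in> filt (Suc i) \<and> b i = h (b' i)"
      by (metis atMost_iff)
    have prod_mem: "a' i * b' (k - i) \<in> filt 0" if "i \<le> k" for i
      using filt_mult[of "a' i" 0 "b' (k - i)" 0] a' b' that by simp
    have "(\<Oplus>i\<in>{..k}. a i \<otimes> b (k - i)) = (\<Oplus>i\<in>{..k}. h (a' i * b' (k - i)))"
      using a' b' by (intro R.finsum_cong') (auto simp: h_mult intro!: h_closed prod_mem)
    also have "\<dots> = h (\<Sum>i\<le>k. a' i * b' (k - i))"
      by (rule h_finsum) (auto intro: prod_mem)
    finally have eq: "(\<Oplus>i\<in>{..k}. a i \<otimes> b (k - i)) = h (\<Sum>i\<le>k. a' i * b' (k - i))" .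
    have "a' i * b' (k - i) - \<alpha> i * \<beta> (k - i) \<in> filt (Suc k)" if i: "i \<le> k" for i
    proof -
      have "\<beta> (k - i) + (b' (k - i) - \<beta> (k - i)) \<in> filt (k - i)"
        using assms(2)[of "k - i"] b'[of "k - i"] filt_mono[of _ "Suc (k - i)" "k - i"] by (intro filt_add) auto
      then have "(a' i - \<alpha> i) * b' (k - i) \<in> filt (Suc i + (k - i))"
        using a' i by (intro filt_mult) auto
      moreover have "\<alpha> i * (b' (k - i) - \<beta> (k - i)) \<in> filt (i + Suc (k - i))"
        using b' i assms by (intro filt_mult) auto
      ultimately have "(a' i - \<alpha> i) * b' (k - i) + \<alpha> i * (b' (k - i) - \<beta> (k - i)) \<in> filt (Suc k)"
        using i by (intro filt_add) simp_all
      then show ?thesis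
        by (simp add: algebra_simps)
    qed
    then have "(\<Sum>i\<le>k. a' i * b' (k - i) - \<alpha> i * \<beta> (k - i)) \<in> filt (Suc k)"
      by (intro filt_sum) simp
    then have "coset (Suc k) (\<Sum>i\<le>k. a' i * b' (k - i)) = ?rhs"
      using prod_mem filt_mult[of "\<alpha> i" 0 "\<beta> (k - i)" 0 for i] mem
      by (subst coset_eq_iff) (auto intro!: filt_sum simp: sum_subtractf)
    then show ?thesis
      unfolding eq using prod_mem by (subst coset_eq) (auto intro!: filt_sum)
  qed
  \<comment> \<open>Without some choice of representatives the set on the left would be
    empty.\<close>
  moreover have "\<exists>a b. \<forall>i\<le>k. a i \<in> coset (Suc i) (\<alpha> i) \<and> b i \<in> coset (Suc i) (\<beta> i)"
    using mem by (intro exI[of _ "\<lambda>i. h (\<alpha> i)"] exI[of _ "\<lambda>i. h (\<beta> i)"]) (simp add: h_mem_coset filt_zero)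
  ultimately show ?thesis
    by blast
qed

text \<open>Not the leading form alone: every homogeneous component of \<open>b\<close> is kept, as
  its class in its own degree.\<close>

definition lead :: "('m \<Rightarrow>\<^sub>0 'k) \<Rightarrow> nat \<Rightarrow> 'r set" where
  "lead b = (\<lambda>k. coset (Suc k) (Fract (comp k b) 1))"

lemma homog_mem: "(b :: 'm \<Rightarrow>\<^sub>0 'k) \<in> homog k \<Longrightarrow> Fract b 1 \<in> filt 0"
  by (rule filt_sub[OF homog_filt])

lemma comp_mem: "(b :: 'm \<Rightarrow>\<^sub>0 'k) \<in> monoid_alg M \<Longrightarrow> Fract (comp k b) 1 \<in> filt 0"
  by (rule homog_mem[OF comp_homog])

lemma coset_homog_eq_iff:
  assumes "b \<in> homog k" "b' \<in> homog k"
  shows "coset (Suc k) (Fract b 1) = coset (Suc k) (Fract b' 1) \<longleftrightarrow> b = b'"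
proof
  assume "coset (Suc k) (Fract b 1) = coset (Suc k) (Fract b' 1)"
  then have "Fract (b - b') 1 \<in> filt (Suc k)"
    using assms by (simp add: coset_eq_iff homog_mem)
  moreover have "b - b' \<in> homog k"
    using assms unfolding homog_def by (rule monoid_alg_diff)
  ultimately show "b = b'"
    using homog_filt_Suc_eq_0[of "b - b'" k] by simp
qed simp

lemma homog_zero: "(0 :: 'm \<Rightarrow>\<^sub>0 'k) \<in> homog k"
  by (simp add: homog_def monoid_alg_zero)

lemma coset_homog_zero: "b \<in> homog k \<Longrightarrow> coset (Suc k) (Fract b 1) = h ` filt (Suc k) \<longleftrightarrow> b = 0"
  using coset_homog_eq_iff[of b k 0] homog_zero by (simp add: coset_zero flip: Zero_fract_def)

lemma finite_comp: "finite {k. comp k b \<noteq> 0}"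
proof (rule finite_subset)
  show "{k. comp k b \<noteq> 0} \<subseteq> d ` Poly_Mapping.keys b"
  proof
    fix k assume "k \<in> {k. comp k b \<noteq> 0}"
    then obtain m where "m \<in> Poly_Mapping.keys (comp k b)"
      by (metis (mono_tags) all_not_in_conv keys_eq_empty mem_Collect_eq)
    then show "k \<in> d ` Poly_Mapping.keys b"
      by (auto simp: comp_def keys_restr)
  qed
qed simp

text \<open>Each entry of a family is the class of a form. An entry that is zero forces its form to
  be zero, so finite support of the family turns the sum of the forms into a polynomial.\<close>

lemma carrier_gr: "carrier gr = lead ` monoid_alg M"
proof (intro equalityI subsetI)
  fix x assume "x \<in> carrier gr"
  then have x: "\<And>k. \<exists>a\<in>h ` filt k. x k = h ` filt (Suc k) +> a" and fin: "finite {k. x k \<noteq> h ` filt (Suc k)}"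
    by (simp_all only: assoc_graded_def partial_object.simps mem_Collect_eq ideal_power_R)
  have "\<exists>b\<in>homog k. x k = coset (Suc k) (Fract b 1)" for k
  proof -
    obtain z where z: "z \<in> filt k" "x k = h ` filt (Suc k) +> h z"
      using x by blast
    obtain b where "b \<in> homog k" "z - Fract b 1 \<in> filt (Suc k)"
      using z(1) by (rule filt_leading_form)
    then show ?thesis
      using z filt_sub by (intro bexI[of _ b]) (auto simp: coset_eq coset_eq_iff homog_mem)
  qed
  then obtain b where b: "\<And>k. b k \<in> homog k" "\<And>k. x k = coset (Suc k) (Fract (b k) 1)"
    by metis
  define K where "K = {k. x k \<noteq> h ` filt (Suc k)}"
  have zero: "b k = 0" if "k \<notin> K" for k
    using that b coset_homog_zero[of "b k" k] by (simp add: K_def)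
  have "comp k (\<Sum>j\<in>K. b j) = b k" for k
  proof -
    have "comp k (\<Sum>j\<in>K. b j) = (\<Sum>j\<in>K. if k = j then b j else 0)"
      by (simp add: comp_sum comp_of_homog[OF b(1)])
    also have "\<dots> = b k"
      using fin zero by (simp add: K_def)
    finally show ?thesis .
  qed
  then have "x = lead (\<Sum>j\<in>K. b j)"
    by (simp add: fun_eq_iff lead_def b(2))
  moreover have "(\<Sum>j\<in>K. b j) \<in> monoid_alg M"
    using homog_sub_upper[OF b(1)] upper_sub by (intro monoid_alg_sum) blast
  ultimately show "x \<in> lead ` monoid_alg M"
    by blast
next
  fix x assume "x \<in> lead ` monoid_alg M"
  then obtain b where b: "b \<in> monoid_alg M" and x: "x = lead b"
    by blast
  have "\<exists>a\<in>h ` filt k. lead b k = h ` filt (Suc k) +> a" for k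
    using homog_filt[OF comp_homog[OF b]] comp_mem[OF b]
    by (intro bexI[of _ "h (Fract (comp k b) 1)"] imageI) (simp_all add: lead_def coset_eq)
  moreover have "{k. lead b k \<noteq> h ` filt (Suc k)} = {k. comp k b \<noteq> 0}"
    using coset_homog_zero[OF comp_homog[OF b]] by (simp add: lead_def)
  ultimately show "x \<in> carrier gr"
    using finite_comp unfolding x by (simp add: assoc_graded_def ideal_power_R)
qed

lemma inj_lead: "inj_on lead (monoid_alg M)"
proof (rule inj_onI, rule comp_ext)
  fix b b' k assume b: "b \<in> monoid_alg M" "b' \<in> monoid_alg M" and "lead b = lead b'"
  then have "lead b k = lead b' k"
    by simp
  then show "comp k b = comp k b'"
    using coset_homog_eq_iff[OF comp_homog[OF b(1)] comp_homog[OF b(2)]] by (simp add: lead_def)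
qed

lemma lead_zero: "lead 0 = \<zero>\<^bsub>gr\<^esub>"
  by (simp add: lead_def assoc_graded_def ideal_power_R comp_zero coset_zero flip: Zero_fract_def)

lemma lead_iso: "lead \<in> ring_iso (class_ring (monoid_alg M)) gr"
proof (rule ring_iso_memI)
  show "bij_betw lead (carrier (class_ring (monoid_alg M))) (carrier gr)"
    using inj_lead by (simp add: bij_betw_def carrier_gr)
  show "lead x \<in> carrier gr" if "x \<in> carrier (class_ring (monoid_alg M))" for x
    using that by (simp add: carrier_gr)
  show "lead (x \<oplus>\<^bsub>class_ring (monoid_alg M)\<^esub> y) = lead x \<oplus>\<^bsub>gr\<^esub> lead y"
    if "x \<in> carrier (class_ring (monoid_alg M))" "y \<in> carrier (class_ring (monoid_alg M))" for x y
    using that by (simp add: fun_eq_iff lead_def assoc_graded_def coset_add comp_mem comp_add)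
  show "lead (x \<otimes>\<^bsub>class_ring (monoid_alg M)\<^esub> y) = lead x \<otimes>\<^bsub>gr\<^esub> lead y"
    if "x \<in> carrier (class_ring (monoid_alg M))" "y \<in> carrier (class_ring (monoid_alg M))" for x y
  proof
    fix k
    have sum_fract: "Fract (\<Sum>i\<in>I. f i) 1 = (\<Sum>i\<in>I. Fract (f i) 1)" for I :: "nat set" and f :: "nat \<Rightarrow> ('m \<Rightarrow>\<^sub>0 'k)"
    proof -
      have "Fract (x + y) 1 = Fract x 1 + Fract y 1" for x y :: "'m \<Rightarrow>\<^sub>0 'k"
        by simp
      then show ?thesis
        by (induction I rule: infinite_finite_induct) (simp_all del: add_fract flip: Zero_fract_def)
    qed
    have "(lead x \<otimes>\<^bsub>gr\<^esub> lead y) k = coset (Suc k) (\<Sum>i\<le>k. Fract (comp i x) 1 * Fract (comp (k - i) y) 1)"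
      using that unfolding assoc_graded_def monoid.simps ideal_power_R lead_def
      by (intro coset_conv homog_filt comp_homog) simp_all
    also have "(\<Sum>i\<le>k. Fract (comp i x) 1 * Fract (comp (k - i) y) 1) = Fract (comp k (x * y)) 1"
      using that by (simp add: comp_mult sum_fract)
    finally show "lead (x \<otimes>\<^bsub>class_ring (monoid_alg M)\<^esub> y) k = (lead x \<otimes>\<^bsub>gr\<^esub> lead y) k"
      by (simp add: lead_def)
  qed
  have "1 \<in> homog 0"
    unfolding homog_0 by (metis rangeI single_one)
  then have comp_one: "comp k 1 = (if k = 0 then 1 else 0)" for k
    by (rule comp_of_homog)
  show "lead \<one>\<^bsub>class_ring (monoid_alg M)\<^esub> = \<one>\<^bsub>gr\<^esub>"
    using coset_eq[OF filt_one, of "Suc 0"]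
    by (auto simp: fun_eq_iff lead_def assoc_graded_def ideal_power_R comp_one coset_zero h_one
        simp flip: Zero_fract_def One_fract_def)
qed

lemma cring_gr: "cring gr"
  using cring.ring_iso_imp_img_cring[OF cring lead_iso] by (simp add: lead_zero)

lemma assoc_graded_part_eq: "assoc_graded_part R max_ideal k = lead ` homog k"
proof (intro equalityI subsetI)
  fix x assume "x \<in> assoc_graded_part R max_ideal k"
  then obtain b where b: "b \<in> monoid_alg M" "x = lead b" and "\<And>j. j \<noteq> k \<Longrightarrow> x j = h ` filt (Suc j)"
    by (auto simp: assoc_graded_part_def carrier_gr ideal_power_R)
  then have "comp j b = 0" if "j \<noteq> k" for j
    using that coset_homog_zero[OF comp_homog[OF b(1)]] by (simp add: lead_def)
  then have "comp j b = comp j (comp k b)" for j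
    using comp_of_homog[OF comp_homog[OF b(1)], of j k] by simp
  then have "b = comp k b"
    by (rule comp_ext)
  then have "b \<in> homog k"
    using comp_homog[OF b(1)] by metis
  with b show "x \<in> lead ` homog k"
    by blast
next
  fix x assume "x \<in> lead ` homog k"
  then obtain b where b: "b \<in> homog k" "x = lead b"
    by blast
  then have "b \<in> monoid_alg M"
    using homog_sub_upper upper_sub by blast
  moreover have "lead b j = h ` filt (Suc j)" if "j \<noteq> k" for j
    using that comp_of_homog[OF b(1), of j] by (simp add: lead_def coset_zero flip: Zero_fract_def)
  ultimately show "x \<in> assoc_graded_part R max_ideal k"
    using b by (auto simp: assoc_graded_part_def carrier_gr ideal_power_R)
qed

lemma graded_degree_gr:
  assumes krull: "krull_dim (class_ring (monoid_alg M :: ('m \<Rightarrow>\<^sub>0 'k) set)) = enat (r + 1)"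
    and p: "\<And>k. poly p (of_nat k) = of_nat (card {a \<in> M. d a = k})" "lead_coeff p = e / fact r"
  shows "graded_degree gr (assoc_graded_part R max_ideal) = e"
proof (rule graded_degree_eqI[where \<phi> = lead and H = homog and p = p])
  show "homog k \<subseteq> carrier (class_ring (monoid_alg M))" for k
    using homog_sub_upper upper_sub by fastforce
  show "ring.dimension (class_ring (monoid_alg M)) (card {a \<in> M. d a = k}) (homog 0) (homog k)" for k
    by (rule dimension_homog)
qed (use krull p in \<open>auto intro: cring cring_gr lead_iso subfield_homog_0 simp: assoc_graded_part_eq\<close>)

end


section \<open>The lattice of pairs\<close>

lemma graded_monoid_lattice_monomials:
  assumes "n \<ge> 2"
  shows "graded_monoid (lattice_monomials n) adeg"
proof
  show "0 \<in> lattice_monomials n"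
    unfolding lattice_monomials_def by (rule image_eqI[of _ _ 0]) auto
  show "a + b \<in> lattice_monomials n" if ab: "a \<in> lattice_monomials n" "b \<in> lattice_monomials n" for a b
  proof -
    obtain m m' where "a = pmono m" "b = pmono m'" "Poly_Mapping.keys m \<subseteq> I2 n" "Poly_Mapping.keys m' \<subseteq> I2 n"
      using ab by (auto simp: lattice_monomials_def)
    then show ?thesis
      unfolding lattice_monomials_def by (intro image_eqI[of _ _ "m + m'"]) (auto simp: pmono_add keys_add_nat)
  qed
  show "adeg (a + b) = adeg a + adeg b" for a b
    by (rule adeg_add)
  show "a = 0" if "a \<in> lattice_monomials n" "adeg a = 0" for a
    using that by (auto simp: lattice_monomials_def adeg_pmono)
  show "\<exists>b\<in>lattice_monomials n. \<exists>c\<in>lattice_monomials n. adeg b = k \<and> adeg c = 1 \<and> a = b + c"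
    if a: "a \<in> lattice_monomials n" "adeg a = Suc k" for a k
  proof -
    obtain m where m: "a = pmono m" "Poly_Mapping.keys m \<subseteq> I2 n"
      using a(1) by (auto simp: lattice_monomials_def)
    then have "m \<noteq> 0"
      using a(2) by (auto simp: adeg_pmono)
    then obtain v where v: "v \<in> Poly_Mapping.keys m"
      by (metis keys_eq_empty all_not_in_conv)
    obtain m' where m': "m = Poly_Mapping.single v 1 + m'" "Poly_Mapping.keys m' \<subseteq> Poly_Mapping.keys m"
      using extract_single[OF v] by blast
    have "pmono m' \<in> lattice_monomials n" "pmono (Poly_Mapping.single v 1) \<in> lattice_monomials n"
      using m m' v unfolding lattice_monomials_def by (intro imageI; auto)+
    moreover have "a = pmono m' + pmono (Poly_Mapping.single v 1)"
      unfolding m(1) m'(1) pmono_add by (rule add.commute)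
    moreover have "adeg (pmono m') = k" "adeg (pmono (Poly_Mapping.single v 1)) = 1"
      using a(2) m(1) m'(1) by (simp_all only: adeg_pmono tdeg_add tdeg_single)
    ultimately show ?thesis
      by blast
  qed
  show "finite {a \<in> lattice_monomials n. adeg a = k}" for k
    by (rule card_lattice_monomials(1)[OF assms])
qed

text \<open>
  The exponents of \<open>a\<^sub>n\<close> and \<open>b\<^sub>1\<close> vanish and the exponent of \<open>b\<^sub>n\<close> is determined by the others, since the
  degrees in the \<open>a\<^sub>i\<close> and in the \<open>b\<^sub>j\<close> agree.
\<close>

lemma card_lattice_monomials_le:
  assumes n: "n \<ge> 2"
  shows "card {\<mu> \<in> lattice_monomials n. adeg \<mu> \<le> k} \<le> (k + 1) ^ (2 * n - 3)"
proof -
  let ?M = "{\<mu> \<in> lattice_monomials n. adeg \<mu> \<le> k}"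
  \<comment> \<open>The positions of a_1, ..., a_(n-1) and b_2, ..., b_(n-1), altogether (n-1) +
    (n-2) = 2n-3.\<close>
  define W where "W = (\<lambda>i. 2 * i) ` {1..n - 1} \<union> (\<lambda>j. 2 * j + 1) ` {2..n - 1}"
  have "card W = card ((\<lambda>i::nat. 2 * i) ` {1..n - 1}) + card ((\<lambda>j::nat. 2 * j + 1) ` {2..n - 1})"
    unfolding W_def by (rule card_Un_disjoint) (auto simp: double_not_eq_Suc_double)
  also have "\<dots> = 2 * n - 3"
    using n by (simp add: card_image inj_on_def)
  finally have W: "card W = 2 * n - 3" "finite W"
    by (auto simp: W_def)
  have dom: "\<mu> \<in> dominated n (adeg \<mu>) (adeg \<mu>)" if "\<mu> \<in> ?M" for \<mu>
    using that lattice_monomials_adeg[of n "adeg \<mu>"] by blast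
  have lookup_le: "Poly_Mapping.lookup \<mu> v \<le> k" if \<mu>: "\<mu> \<in> ?M" and v: "v \<in> W" for \<mu> v
  proof -
    have "\<exists>i\<in>{1..n}. v = 2 * i \<or> v = 2 * i + 1"
      using v unfolding W_def by force
    then obtain i where i: "i \<in> {1..n}" "v = 2 * i \<or> v = 2 * i + 1"
      by blast
    have "Poly_Mapping.lookup \<mu> (2 * i) \<le> (\<Sum>i=1..n. Poly_Mapping.lookup \<mu> (2 * i))"
      "Poly_Mapping.lookup \<mu> (2 * i + 1) \<le> (\<Sum>i=1..n. Poly_Mapping.lookup \<mu> (2 * i + 1))"
      by (rule member_le_sum[OF i(1)]; simp)+
    then show ?thesis
      using dom[OF \<mu>] \<mu> i(2) by (auto simp: dominated_def)
  qed
  have inj: "inj_on (\<lambda>\<mu>. restrict (Poly_Mapping.lookup \<mu>) W) ?M"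
  proof (rule inj_onI)
    fix \<mu> \<nu> assume \<mu>: "\<mu> \<in> ?M" and \<nu>: "\<nu> \<in> ?M" and
      eq: "restrict (Poly_Mapping.lookup \<mu>) W = restrict (Poly_Mapping.lookup \<nu>) W"
    have ends: "Poly_Mapping.lookup \<rho> (2 * n) = 0" "Poly_Mapping.lookup \<rho> (2 * 1 + 1) = 0"
      "\<And>v. v \<notin> {2..2 * n + 1} \<Longrightarrow> Poly_Mapping.lookup \<rho> v = 0"
      and sums: "(\<Sum>i=1..n. Poly_Mapping.lookup \<rho> (2 * i)) = adeg \<rho>"
        "(\<Sum>j\<in>{1..<n}. Poly_Mapping.lookup \<rho> (2 * j + 1)) + Poly_Mapping.lookup \<rho> (2 * n + 1) = adeg \<rho>"
      if "\<rho> \<in> ?M" for \<rho>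
    proof -
      have a: "(\<Sum>i=1..n. Poly_Mapping.lookup \<rho> (2 * i)) = adeg \<rho>"
        and b: "(\<Sum>j=1..n. Poly_Mapping.lookup \<rho> (2 * j + 1)) = adeg \<rho>"
        and le: "\<And>t. t \<in> {1..n} \<Longrightarrow> (\<Sum>j=1..t. Poly_Mapping.lookup \<rho> (2 * j + 1)) \<le> (\<Sum>i=1..<t. Poly_Mapping.lookup \<rho> (2 * i))"
        and keys: "Poly_Mapping.keys \<rho> \<subseteq> {2..2 * n + 1}"
        using dom[OF that] by (auto simp: dominated_def)
      have split: "(\<Sum>i=1..n. f i) = (\<Sum>i=1..<n. f i) + f n" for f :: "nat \<Rightarrow> nat"
        using n by (metis Suc_leD Suc_1 add.commute sum.last_plus)
      \<comment> \<open>At \<open>t = n\<close> the inequality bounds the whole degree in the b_j by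
        the degree in the a_i with i < n, and both total degrees agree. At \<open>t = 1\<close> its
        right side is an empty sum.\<close>
      show "Poly_Mapping.lookup \<rho> (2 * n) = 0"
        using le[of n] a b n unfolding split by auto
      show "Poly_Mapping.lookup \<rho> (2 * 1 + 1) = 0"
        using le[of 1] n by simp
      show "Poly_Mapping.lookup \<rho> v = 0" if "v \<notin> {2..2 * n + 1}" for v
        using keys that by (auto simp: in_keys_iff)
      show "(\<Sum>i=1..n. Poly_Mapping.lookup \<rho> (2 * i)) = adeg \<rho>" by (rule a)
      show "(\<Sum>j\<in>{1..<n}. Poly_Mapping.lookup \<rho> (2 * j + 1)) + Poly_Mapping.lookup \<rho> (2 * n + 1) = adeg \<rho>"
        using b unfolding split .
    qed
    have W_eq: "Poly_Mapping.lookup \<mu> v = Poly_Mapping.lookup \<nu> v" if "v \<in> W" for v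
      using fun_cong[OF eq, of v] that by simp
    have a_eq: "Poly_Mapping.lookup \<mu> (2 * i) = Poly_Mapping.lookup \<nu> (2 * i)" if "i \<in> {1..n}" for i
    proof (cases "i = n")
      case True
      then show ?thesis using ends(1)[OF \<mu>] ends(1)[OF \<nu>] by simp
    next
      case False
      then show ?thesis using that by (intro W_eq) (auto simp: W_def)
    qed
    have b_eq: "Poly_Mapping.lookup \<mu> (2 * j + 1) = Poly_Mapping.lookup \<nu> (2 * j + 1)" if "j \<in> {1..<n}" for j
    proof (cases "j = 1")
      case True
      then show ?thesis using ends(2)[OF \<mu>] ends(2)[OF \<nu>] by simp
    next
      case False
      then have "2 * j + 1 \<in> W"
        using that unfolding W_def by (intro UnI2 imageI) auto
      then show ?thesis by (rule W_eq)
    qed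
    have "adeg \<mu> = adeg \<nu>"
      unfolding sums(1)[OF \<mu>, symmetric] sums(1)[OF \<nu>, symmetric] by (rule sum.cong) (use a_eq in auto)
    moreover have "(\<Sum>j\<in>{1..<n}. Poly_Mapping.lookup \<mu> (2 * j + 1)) = (\<Sum>j\<in>{1..<n}. Poly_Mapping.lookup \<nu> (2 * j + 1))"
      by (rule sum.cong) (use b_eq in auto)
    ultimately have bn: "Poly_Mapping.lookup \<mu> (2 * n + 1) = Poly_Mapping.lookup \<nu> (2 * n + 1)"
      using sums(2)[OF \<mu>] sums(2)[OF \<nu>] by simp
    show "\<mu> = \<nu>"
    proof (rule poly_mapping_eqI)
      fix v :: nat
      obtain i where i: "v = 2 * i \<or> v = 2 * i + 1"
        by (metis evenE oddE)
      show "Poly_Mapping.lookup \<mu> v = Poly_Mapping.lookup \<nu> v"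
      proof (cases "v \<in> {2..2 * n + 1}")
        case True
        then have "i \<in> {1..n}"
          using i by auto
        then show ?thesis
          using a_eq[of i] b_eq[of i] bn i by (cases "i = n") auto
      next
        case False
        then show ?thesis
          using ends(3)[OF \<mu>] ends(3)[OF \<nu>] by simp
      qed
    qed
  qed
  have "card ?M \<le> card (W \<rightarrow>\<^sub>E {..k})"
    using inj W(2) lookup_le by (intro card_inj_on_le) (auto intro: finite_PiE)
  also have "\<dots> = (k + 1) ^ (2 * n - 3)"
    using W by (simp add: card_PiE)
  finally show ?thesis .
qed

text \<open>
  The faces of the chain kill the parameters \<open>b\<^sub>2, a\<^sub>1, b\<^sub>3, a\<^sub>2, \<dots>\<close> one after the other; the monomials lost
  on the way, \<open>a\<^sub>1b\<^sub>2, a\<^sub>1b\<^sub>3, a\<^sub>2b\<^sub>3, \<dots>\<close>, form a maximal chain of the lattice.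
\<close>

lemma krull_dim_lattice_monomials:
  assumes n: "n \<ge> 2"
  shows "krull_dim (class_ring (monoid_alg (lattice_monomials n) :: ((nat \<Rightarrow>\<^sub>0 nat) \<Rightarrow>\<^sub>0 'k::field) set)) = enat (2 * n - 3)"
proof (rule antisym)
  interpret graded_monoid "lattice_monomials n" adeg
    by (rule graded_monoid_lattice_monomials[OF n])
  let ?R = "class_ring (monoid_alg (lattice_monomials n) :: ((nat \<Rightarrow>\<^sub>0 nat) \<Rightarrow>\<^sub>0 'k) set)"
  show "krull_dim ?R \<le> enat (2 * n - 3)"
    by (rule krull_dim_le) (rule card_lattice_monomials_le[OF n])
  \<comment> \<open>Lists 5, 2, 7, 4, ... from 1 on, the numbers of b_2, a_1, b_3, a_2, and so
    on.\<close>
  define var where "var s = (if odd s then s + 4 else s)" for s :: nat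
  define F where "F t = {\<mu> :: nat \<Rightarrow>\<^sub>0 nat. Poly_Mapping.keys \<mu> \<inter> var ` {1..t} = {}}" for t
  show "enat (2 * n - 3) \<le> krull_dim ?R"
  proof (rule krull_dim_ge[where F = F])
    show "a + b \<in> F i \<longleftrightarrow> a \<in> F i \<and> b \<in> F i" for i a b
      by (auto simp: F_def keys_add_nat)
    show "0 \<in> F i" for i
      by (simp add: F_def)
    show "lattice_monomials n \<inter> F (Suc t) \<subset> lattice_monomials n \<inter> F t" if t: "t < 2 * n - 3" for t
    proof
      show "lattice_monomials n \<inter> F (Suc t) \<subseteq> lattice_monomials n \<inter> F t"
        by (auto simp: F_def)
      have "\<exists>\<alpha>\<in>I2 n. param \<alpha> \<in> F t \<and> param \<alpha> \<notin> F (Suc t)"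
      proof (cases "even t")
        case True
        then obtain q where q: "t = 2 * q" by (elim evenE)
        \<comment> \<open>Step \<open>t + 1\<close> kills b_(q+2); a_(q+1) is killed only in the
          step after it.\<close>
        define \<alpha> where "\<alpha> = (q + 1, q + 2)"
        have keys: "Poly_Mapping.keys (param \<alpha>) = {t + 2, t + 5}"
          by (auto simp: \<alpha>_def param_def keys_add_nat q)
        have "\<alpha> \<in> I2 n"
          using t q by (auto simp: \<alpha>_def I2_def)
        moreover have "param \<alpha> \<in> F t" "param \<alpha> \<notin> F (Suc t)"
          using True by (auto simp: F_def keys var_def image_iff Bex_def split: if_splits)
        ultimately show ?thesis by blast
      next
        case False
        then obtain q where q: "t = 2 * q + 1" by (elim oddE)
        \<comment> \<open>Step \<open>t + 1\<close> kills a_(q+1). Since b_(q+2) is already gone,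
          the witness uses b_(q+3), which is killed next.\<close>
        define \<alpha> where "\<alpha> = (q + 1, q + 3)"
        have keys: "Poly_Mapping.keys (param \<alpha>) = {t + 1, t + 6}"
          by (auto simp: \<alpha>_def param_def keys_add_nat q)
        have "\<alpha> \<in> I2 n"
          using t q by (auto simp: \<alpha>_def I2_def)
        moreover have "param \<alpha> \<in> F t" "param \<alpha> \<notin> F (Suc t)"
          using False by (auto simp: F_def keys var_def image_iff Bex_def split: if_splits)
        ultimately show ?thesis by blast
      qed
      then obtain \<alpha> where \<alpha>: "\<alpha> \<in> I2 n" "param \<alpha> \<in> F t" "param \<alpha> \<notin> F (Suc t)"
        by blast
      have "param \<alpha> \<in> lattice_monomials n"
        unfolding lattice_monomials_def using \<alpha>(1)
        by (intro image_eqI[of _ _ "Poly_Mapping.single \<alpha> (Suc 0)"]) (simp_all only: pmono_single, simp)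
      then show "lattice_monomials n \<inter> F (Suc t) \<noteq> lattice_monomials n \<inter> F t"
        using \<alpha> by blast
    qed
  qed
qed

section \<open>The coordinate ring and its localization at the origin\<close>

lemma mpoly_ring_eq: "mpoly_ring V = class_ring (monoid_alg {m. Poly_Mapping.keys m \<subseteq> V})"
  by (auto simp: mpoly_ring_def class_ring_def monoid_alg_def)

lemma cring_mpoly_ring: "cring (mpoly_ring V :: (('v \<Rightarrow>\<^sub>0 nat) \<Rightarrow>\<^sub>0 'k::field) ring)"
  unfolding mpoly_ring_eq
proof (rule cring_class_ring)
  show "1 \<in> monoid_alg {m :: 'v \<Rightarrow>\<^sub>0 nat. Poly_Mapping.keys m \<subseteq> V}"
    by (simp add: monoid_alg_def)
qed (auto intro: monoid_alg_zero monoid_alg_add monoid_alg_uminus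
      intro!: monoid_alg_mult[where A = "{m. Poly_Mapping.keys m \<subseteq> V}" and B = "{m. Poly_Mapping.keys m \<subseteq> V}"]
      simp: keys_add_nat)

lemma push_image_monoid_alg:
  fixes \<phi> :: "'m \<Rightarrow> 'm'::comm_monoid_add"
  shows "push \<phi> ` monoid_alg N = (monoid_alg (\<phi> ` N) :: ('m' \<Rightarrow>\<^sub>0 'k::comm_ring_1) set)"
proof (intro equalityI subsetI)
  fix g :: "'m' \<Rightarrow>\<^sub>0 'k" assume "g \<in> push \<phi> ` monoid_alg N"
  then show "g \<in> monoid_alg (\<phi> ` N)"
    using keys_push[of \<phi>] by (fastforce simp: monoid_alg_def)
next
  fix g :: "'m' \<Rightarrow>\<^sub>0 'k" assume g: "g \<in> monoid_alg (\<phi> ` N)"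
  have push_sum: "push \<phi> (\<Sum>i\<in>I. f i) = (\<Sum>i\<in>I. push \<phi> (f i))" for I :: "'m' set" and f :: "'m' \<Rightarrow> 'm \<Rightarrow>\<^sub>0 'k"
    by (induction I rule: infinite_finite_induct) (simp_all add: push_add, simp_all add: push_def)
  have inv: "inv_into N \<phi> \<mu> \<in> N" "\<phi> (inv_into N \<phi> \<mu>) = \<mu>" if "\<mu> \<in> Poly_Mapping.keys g" for \<mu>
    using g that by (auto simp: monoid_alg_def inv_into_into f_inv_into_f)
  let ?f = "\<Sum>\<mu>\<in>Poly_Mapping.keys g. Poly_Mapping.single (inv_into N \<phi> \<mu>) (Poly_Mapping.lookup g \<mu>)"
  have "push \<phi> ?f = (\<Sum>\<mu>\<in>Poly_Mapping.keys g. Poly_Mapping.single \<mu> (Poly_Mapping.lookup g \<mu>))"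
    unfolding push_sum push_single by (intro sum.cong) (simp_all add: inv)
  also have "\<dots> = g"
    by (simp flip: poly_mapping_sum_single)
  finally have "g = push \<phi> ?f" ..
  then show "g \<in> push \<phi> ` monoid_alg N"
    by (rule image_eqI) (intro monoid_alg_sum monoid_alg_single inv)
qed

lemma push_one: "push pmono 1 = 1"
  using push_single[of pmono 0 1] by simp

lemma mpoly_eval_origin:
  fixes f :: "('v \<Rightarrow>\<^sub>0 nat) \<Rightarrow>\<^sub>0 'k::comm_ring_1"
  assumes f: "f \<in> carrier (mpoly_ring V)"
  shows "mpoly_eval f (affine_origin V) = Poly_Mapping.lookup f 0"
proof -
  let ?o = "affine_origin V :: 'v \<Rightarrow> 'k"
  have "monom_eval ?o m = (if m = 0 then 1 else 0)" if "m \<in> Poly_Mapping.keys f" for m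
  proof (cases "m = 0")
    case False
    then obtain v where v: "v \<in> Poly_Mapping.keys m"
      by (metis keys_eq_empty all_not_in_conv)
    moreover have "v \<in> V"
      using f that v by (auto simp: mpoly_ring_def)
    ultimately have "?o v ^ Poly_Mapping.lookup m v = 0"
      by (simp add: affine_origin_def in_keys_iff zero_power)
    then show ?thesis
      using v False unfolding monom_eval_def by (metis finite_keys prod_zero)
  qed simp
  then have "mpoly_eval f (affine_origin V) =
      (\<Sum>m\<in>Poly_Mapping.keys f. Poly_Mapping.lookup f m * (if m = 0 then 1 else 0))"
    unfolding mpoly_eval_eq lin_ext_def by (intro sum.cong) auto
  also have "\<dots> = (\<Sum>m\<in>Poly_Mapping.keys f. if m = 0 then Poly_Mapping.lookup f m else 0)"
    by (intro sum.cong) auto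
  also have "\<dots> = Poly_Mapping.lookup f 0"
    by (simp add: in_keys_iff)
  finally show ?thesis .
qed

text \<open>By degree only the trivial monomial has trivial image, so nothing is added to the
  constant term. This identifies vanishing at the origin after passage to the monoid
  algebra.\<close>

lemma lookup_push_pmono_0: "Poly_Mapping.lookup (push pmono f) 0 = Poly_Mapping.lookup f 0"
proof -
  have "pmono m = 0 \<longleftrightarrow> m = 0" for m
    by (metis adeg_pmono adeg_zero pmono_zero tdeg_eq_0_iff)
  then have "{m \<in> Poly_Mapping.keys f. pmono m = 0} = (if 0 \<in> Poly_Mapping.keys f then {0} else {})"
    by auto
  then show ?thesis
    by (simp add: lookup_push in_keys_iff)
qed

theorem corollary7p3:
  fixes n :: nat
  assumes "n \<ge> 2"
  shows "multiplicity_at (I2 n) (X2 n :: (nat \<times> nat \<Rightarrow> 'k::alg_closed_field) set)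
           (affine_origin (I2 n))
         = 1 / of_nat (n - 1) * of_nat ((2 * n - 4) choose (n - 2))"
proof -
  let ?V = "I2 n" and ?X = "X2 n :: (nat \<times> nat \<Rightarrow> 'k) set"
  let ?P = "mpoly_ring ?V :: ((nat \<times> nat \<Rightarrow>\<^sub>0 nat) \<Rightarrow>\<^sub>0 'k) ring"
  let ?B = "monoid_alg (lattice_monomials n) :: ((nat \<Rightarrow>\<^sub>0 nat) \<Rightarrow>\<^sub>0 'k) set"
  let ?I = "vanishing_ideal ?V ?X"
  define A where "A = coordinate_ring ?V ?X"
  define p where "p = point_ideal ?V ?X (affine_origin ?V)"
  \<comment> \<open>The isomorphism induced on the quotient: \<open>push pmono\<close> is constant
    on each coset, so its image there is a singleton.\<close>
  define e where "e x = the_elem (push pmono ` x)" for x :: "((nat \<times> nat \<Rightarrow>\<^sub>0 nat) \<Rightarrow>\<^sub>0 'k) set"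
  interpret gm: graded_monoid "lattice_monomials n" adeg
    by (rule graded_monoid_lattice_monomials[OF assms])
  interpret P: cring ?P
    by (rule cring_mpoly_ring)
  interpret B: cring "class_ring ?B"
    by (rule gm.cring)
  have image: "push pmono ` carrier ?P = ?B"
    by (simp add: mpoly_ring_eq push_image_monoid_alg lattice_monomials_def)
  interpret \<pi>: ring_hom_ring ?P "class_ring ?B" "push pmono"
  proof (rule ring_hom_ringI[OF P.ring_axioms B.ring_axioms])
    show "push pmono x \<in> carrier (class_ring ?B)" if "x \<in> carrier ?P" for x
      using image that by auto
  qed (auto simp: mpoly_ring_eq push_mult pmono_add push_add push_one)
  have "?I = {f \<in> carrier ?P. push pmono f = 0}"
    unfolding X2_def
    by (rule vanishing_ideal_lattice_variety[OF infinite_UNIV_alg_closed])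
      (auto simp: I2_def sup_nat_def inf_nat_def max_def min_def)
  also have "\<dots> = a_kernel ?P (class_ring ?B) (push pmono)"
    unfolding a_kernel_def' by (simp only: class_ring_simps)
  finally have I: "?I = a_kernel ?P (class_ring ?B) (push pmono)" .
  have e_iso: "e \<in> ring_iso A (class_ring ?B)"
    unfolding A_def coordinate_ring_def I e_def using \<pi>.FactRing_iso_set image by simp
  have e_coset: "e (?I +>\<^bsub>?P\<^esub> f) = push pmono f" if "f \<in> carrier ?P" for f
    unfolding e_def I by (rule \<pi>.the_elem_simp[OF that])
  have carrier_A: "carrier A = {?I +>\<^bsub>?P\<^esub> f | f. f \<in> carrier ?P}"
    by (auto simp: A_def coordinate_ring_def FactRing_def A_RCOSETS_def')
  have cring_A: "cring A"
  proof -
    have "ideal ?I ?P"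
      unfolding I by (rule \<pi>.kernel_is_ideal)
    then show ?thesis
      unfolding A_def coordinate_ring_def by (rule ideal.quotient_is_cring) (rule P.is_cring)
  qed
  have e_carrier: "e ` carrier A = ?B" and e_inj: "inj_on e (carrier A)"
    using e_iso by (auto simp: ring_iso_def bij_betw_def)
  \<comment> \<open>Seen in the monoid algebra, the ideal of the origin consists of the elements
    with zero constant term, so its complement \<open>S\<close> corresponds to
    \<open>gm.unital\<close>.\<close>
  have p_iff: "x \<in> p \<longleftrightarrow> x \<in> carrier A \<and> Poly_Mapping.lookup (e x) 0 = 0" for x
  proof
    assume "x \<in> p"
    then obtain f where "f \<in> carrier ?P" "x = ?I +>\<^bsub>?P\<^esub> f" "mpoly_eval f (affine_origin ?V) = 0"
      by (auto simp: p_def point_ideal_def)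
    then show "x \<in> carrier A \<and> Poly_Mapping.lookup (e x) 0 = 0"
      by (auto simp: carrier_A e_coset lookup_push_pmono_0 mpoly_eval_origin)
  next
    assume x: "x \<in> carrier A \<and> Poly_Mapping.lookup (e x) 0 = 0"
    then obtain f where "f \<in> carrier ?P" "x = ?I +>\<^bsub>?P\<^esub> f"
      by (auto simp: carrier_A)
    with x show "x \<in> p"
      by (auto simp: p_def point_ideal_def e_coset lookup_push_pmono_0 mpoly_eval_origin)
  qed
  define S where "S = carrier A - p"
  have S_iff: "s \<in> S \<longleftrightarrow> s \<in> carrier A \<and> e s \<in> gm.unital" for s
    using e_carrier by (auto simp: S_def p_iff gm.unital_def)
  interpret A: cring A by (rule cring_A)
  have e_hom: "e (x \<otimes>\<^bsub>A\<^esub> y) = e x * e y" "e (x \<oplus>\<^bsub>A\<^esub> y) = e x + e y" "e \<one>\<^bsub>A\<^esub> = 1"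
    if "x \<in> carrier A" "y \<in> carrier A" for x y
    using e_iso that by (auto simp: ring_iso_def ring_hom_def)
  interpret loc: embedded_fractions A S e
  proof
    have "e \<zero>\<^bsub>A\<^esub> = 0"
      using e_hom(2)[of "\<zero>\<^bsub>A\<^esub>" "\<zero>\<^bsub>A\<^esub>"] by (simp only: A.l_zero A.zero_closed add_cancel_right_right)
    then show "\<zero>\<^bsub>A\<^esub> \<notin> S"
      by (simp add: S_iff gm.unital_def)
  qed (use e_hom[OF A.zero_closed A.zero_closed] in
      \<open>auto simp: S_iff e_hom intro: cring_A e_inj gm.unital_one gm.unital_mult\<close>)
  \<comment> \<open>\<open>e\<close> maps \<open>A\<close> onto the monoid algebra and
    \<open>S\<close> onto \<open>gm.unital\<close>, so both sides have the same numerators and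
    denominators.\<close>
  have fracs: "loc.fracs = gm.filt 0"
  proof (intro equalityI subsetI)
    fix z :: "((nat \<Rightarrow>\<^sub>0 nat) \<Rightarrow>\<^sub>0 'k) fract" assume "z \<in> gm.filt 0"
    then obtain a s where z: "z = Fract a s" "a \<in> ?B" "s \<in> gm.unital"
      by (auto simp: gm.filt_def gm.upper_0)
    then have "s \<in> ?B"
      by (simp add: gm.unital_def)
    then obtain x y where "x \<in> carrier A" "a = e x" "y \<in> carrier A" "s = e y"
      using z e_carrier by blast
    with z show "z \<in> loc.fracs"
      by (auto simp: loc.fracs_def S_iff)
  qed (use e_carrier in \<open>auto simp: loc.fracs_def gm.filt_def gm.upper_0 S_iff\<close>)
  have max_ideal: "localization_max_ideal A p = loc.cls ` gm.filt 1"
  proof -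
    have "localization_max_ideal A p = {loc.cls (Fract (e a) (e s)) | a s. a \<in> p \<and> s \<in> S}"
      unfolding localization_max_ideal_def S_def[symmetric]
      by (intro Collect_cong iff_exI) (auto simp: loc.fraction_eq_cls p_iff)
    also have "\<dots> = loc.cls ` {Fract (e a) (e s) | a s. a \<in> p \<and> s \<in> S}"
      by auto
    also have "{Fract (e a) (e s) | a s. a \<in> p \<and> s \<in> S} = gm.filt 1"
    proof (intro equalityI subsetI)
      fix z :: "((nat \<Rightarrow>\<^sub>0 nat) \<Rightarrow>\<^sub>0 'k) fract" assume "z \<in> gm.filt 1"
      then obtain a s where z: "z = Fract a s" "a \<in> gm.upper 1" "s \<in> gm.unital"
        by (rule gm.filt_E)
      then have "a \<in> ?B" "Poly_Mapping.lookup a 0 = 0" "s \<in> ?B"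
        using gm.upper_1_iff[of a] by (auto simp: gm.unital_def)
      moreover from this obtain x y where "x \<in> carrier A" "a = e x" "y \<in> carrier A" "s = e y"
        using e_carrier by blast
      ultimately show "z \<in> {Fract (e a) (e s) | a s. a \<in> p \<and> s \<in> S}"
        using z by (auto simp: p_iff S_iff)
    next
      fix z :: "((nat \<Rightarrow>\<^sub>0 nat) \<Rightarrow>\<^sub>0 'k) fract" assume "z \<in> {Fract (e a) (e s) | a s. a \<in> p \<and> s \<in> S}"
      then obtain a s where z: "z = Fract (e a) (e s)" "a \<in> p" "s \<in> S"
        by blast
      then have "e a \<in> gm.upper 1"
        using gm.upper_1_iff[of "e a"] e_carrier by (auto simp: p_iff)
      then show "z \<in> gm.filt 1"
        using z by (auto simp: S_iff intro: gm.filt_I)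
    qed
    finally show ?thesis .
  qed
  interpret gl: graded_local "lattice_monomials n" adeg "localization A S" loc.cls
    by unfold_locales (use loc.cls_iso loc.cls_zero in \<open>simp_all add: fracs\<close>)
  have "multiplicity_at ?V ?X (affine_origin ?V) =
      graded_degree (assoc_graded (localization A S) gl.max_ideal) (assoc_graded_part (localization A S) gl.max_ideal)"
    unfolding gl.max_ideal_def max_ideal[symmetric]
    by (simp only: multiplicity_at_def Let_def A_def p_def localization_at_def S_def)
  also have "\<dots> = 1 / of_nat (n - 1) * of_nat ((2 * n - 4) choose (n - 2))"
  proof (rule gl.graded_degree_gr[where r = "2 * n - 4" and p = "hilbert_poly n"])
    have "2 * n - 4 + 1 = 2 * n - 3"
      using assms by simp
    then show "krull_dim (class_ring ?B) = enat (2 * n - 4 + 1)"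
      using krull_dim_lattice_monomials[OF assms] by simp
    show "poly (hilbert_poly n) (of_nat k) = of_nat (card {a \<in> lattice_monomials n. adeg a = k})" for k
      by (rule card_lattice_monomials(2)[OF assms, symmetric])
    show "lead_coeff (hilbert_poly n) = 1 / of_nat (n - 1) * of_nat ((2 * n - 4) choose (n - 2)) / fact (2 * n - 4)"
      unfolding lead_coeff_hilbert_poly by (rule catalan_lead_coeff[OF assms])
  qed
  finally show ?thesis .
qed

end
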